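(* The eigenvalues of $P_n$ are labelled by the standard Young tableaux of size $n$, and the eigenvalue represented by a tableau of shape $\lambda$ appears $d_\lambda$ times. Precisely: for every $\lambda\vdash n$ and every standard Young tableau $T$ of shape $\lambda$, the vector $v_T$ defined in the context is an eigenvector of $\frac1nQ_n$; write $\mathrm{eig}(T)$ for its eigenvalue. Then the multiset of the $n!$ eigenvalues of $P_n$ (counted with multiplicity) is obtained by taking, for each $\lambda\vdash n$ and each standard Young tableau $T$ of shape $\lambda$, the number $\mathrm{eig}(T)$ exactly $d_\lambda$ times.
   Context: $P_n$ is the probability distribution on $S_n$ with $P_n((i\,j))=\frac1{nj}$ for $1\le i<j\le n$, $P_n(\mathrm{id})=\frac1n\sum_{j=1}^n\frac1j$, and $P_n(\tau)=0$ otherwise. Its eigenvalues are those of the $n!\times n!$ transition matrix of the random walk on $S_n$ generated by $P_n$, i.e. of multiplication by $\sum_\tau P_n(\tau)\tau=\frac1nQ_n$ on the group algebra $\mathfrak S_n=\mathbb C[S_n]$, where $Q_n=\sum_{1\le i\le j\le n}\frac1j(i\,j)\in\mathfrak S_n$ with $(i\,i)=\mathrm{id}$. A partition $\lambda\vdash n$ is identified with its Young diagram; box $(i,j)$ is in row $i$ (rows numbered downwards), column $j$. A standard Young tableau (SYT) of shape $\lambda\vdash n$ has entries $1,\dots,n$, once each, increasing along rows and down columns; $d_\lambda$ is the number of SYT of shape $\lambda$. Labelling. Let $W^n$ be the set of words $w_1\cdot\ldots\cdot w_n$ of length $n$ with letters in $[n]=\{1,\dots,n\}$, and $M^n$ the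 complex vector space with basis $W^n$; $S_n$ acts by place permutations, $\sigma(w)=w_{\sigma^{-1}(1)}\cdot\ldots\cdot w_{\sigma^{-1}(n)}$, making $M^n$ an $\mathfrak S_n$-module. For $\lambda\vdash n$, $M^\lambda\subseteq M^n$ is the span of the words in which letter $i$ occurs $\lambda_i$ times for each $i$ ($\lambda$ padded with zeros). For a tableau $T$ of shape $\lambda$ with entries $1,\dots,n$ once each, $w(T)$ is the word whose letter in position $T(i,j)$ is $i$ for each box $(i,j)$. The Specht module $S^\lambda\subseteq M^\lambda$ is the span of the vectors $s(T)=\sum_{\sigma\in C_T}\mathrm{sign}(\sigma)\,w(\sigma(T))$, $T$ an SYT of shape $\lambda$, where $C_T$ is the group of permutations preserving each column's set of entries; $S^\lambda$ is simple of dimension $d_\lambda$ and occurs exactly once in $M^\lambda$. For $a\in[n+1]$ the adding operator $\Phi_a:M^n\to M^{n+1}$ appends the letter $a$: $\Phi_a(w)=w\cdot a$. If $\lambda\vdash n$ and $\mu=\lambda+e_a\vdash n+1$ (one box added in row $a$), the lifting operator is $\kappa_a^{\lambda,\mu}=\pi^\mu\circ\Phi_a:S^\lambda\to S^\mu$, where $\pi^\mu:M^\mu\to M^\mu$ is the projection onto the $S^\mu$-isotypic component. Given an SYT $T$ of size $n$, let $T_m$ be its subtableau with entries $1,\dots,m$, of shape $\lambda^{(m)}$. Put $v_{T_1}=1\in S^{(1)}$ (the one-letter word) and $v_{T_{m+1}}=\kappa_a^{\lambda^{(m)},\lambda^{(m+1)}}(v_{T_m})$, where $a$ is the row of $T$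 containing $m+1$. Then $v_T=v_{T_n}\in S^{\lambda}$. *)

theory Defs
  imports
    "HOL-Library.Poly_Mapping"
    "HOL-Combinatorics.Permutations"
    "Jordan_Normal_Form.Char_Poly"
begin

section \<open>Free complex vector spaces\<close>

text \<open>The complex vector space with basis a type \<open>'a\<close> is the type of finitely supported
  functions; the basis vector of \<open>b\<close> is \<open>Poly_Mapping.single b 1\<close>.\<close>

definition scalev :: "complex \<Rightarrow> ('a \<Rightarrow>\<^sub>0 complex) \<Rightarrow> ('a \<Rightarrow>\<^sub>0 complex)" where
  "scalev c v = Poly_Mapping.map ((*) c) v"

abbreviation bvec :: "'a \<Rightarrow> ('a \<Rightarrow>\<^sub>0 complex)" where
  "bvec b \<equiv> Poly_Mapping.single b 1"

lemma lookup_scalev [simp]: "Poly_Mapping.lookup (scalev c v) x = c * Poly_Mapping.lookup v x"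
  by (cases "Poly_Mapping.lookup v x = 0") (simp_all add: scalev_def Poly_Mapping.map.rep_eq when_def)

interpretation fv: vector_space "scalev :: complex \<Rightarrow> ('a \<Rightarrow>\<^sub>0 complex) \<Rightarrow> ('a \<Rightarrow>\<^sub>0 complex)"
  by unfold_locales (auto intro!: poly_mapping_eqI simp: lookup_add algebra_simps)

text \<open>The linear extension of a function defined on the basis.\<close>

definition lin_ext :: "('a \<Rightarrow> ('b \<Rightarrow>\<^sub>0 complex)) \<Rightarrow> ('a \<Rightarrow>\<^sub>0 complex) \<Rightarrow> ('b \<Rightarrow>\<^sub>0 complex)" where
  "lin_ext F v = (\<Sum>b\<in>Poly_Mapping.keys v. scalev (Poly_Mapping.lookup v b) (F b))"


section \<open>The one-sided transposition shuffle\<close>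

definition Sym :: "nat \<Rightarrow> (nat \<Rightarrow> nat) set" where
  "Sym n = {\<sigma>. \<sigma> permutes {1..n}}"

text \<open>In the second case, exactly one pair contributes if \<open>\<tau>\<close> is a transposition in \<open>Sym n\<close>, and
  none otherwise; see the three lemmas below.\<close>

definition P :: "nat \<Rightarrow> (nat \<Rightarrow> nat) \<Rightarrow> real" where
  "P n \<tau> =
    (if \<tau> = id then 1 / real n * (\<Sum>j = 1..n. 1 / real j)
     else (\<Sum>(i, j) \<in> {(i, j). 1 \<le> i \<and> i < j \<and> j \<le> n \<and> \<tau> = Transposition.transpose i j}.
             1 / (real n * real j)))"

lemma P_id: "P n id = 1 / real n * (\<Sum>j = 1..n. 1 / real j)"
  by (simp add: P_def)

lemma transpose_pair_eq:
  assumes "a < b" "i < j" "Transposition.transpose a b = Transposition.transpose i (j::nat)"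
  shows "a = i \<and> b = j"
proof -
  have "Transposition.transpose i j a = b" "Transposition.transpose i j b = a"
    using assms(3)[symmetric] by simp_all
  then show ?thesis
    using assms(1,2) by (auto simp: Transposition.transpose_def split: if_splits)
qed

lemma P_transpose:
  assumes "1 \<le> i" "i < j" "j \<le> n"
  shows "P n (Transposition.transpose i j) = 1 / (real n * real j)"
proof -
  have "{(a, b). 1 \<le> a \<and> a < b \<and> b \<le> n \<and>
          Transposition.transpose i j = Transposition.transpose a b} = {(i, j)}"
    using assms transpose_pair_eq[OF assms(2)] by auto
  moreover have "Transposition.transpose i j \<noteq> id"
    using assms by (metis id_apply nat_less_le transpose_apply_first)
  ultimately show ?thesis
    by (simp add: P_def)
qed

lemma P_other:
  assumes "\<tau> \<noteq> id" "\<nexists>i j. 1 \<le> i \<and> i < j \<and> j \<le> n \<and> \<tau> = Transposition.transpose i j"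
  shows "P n \<tau> = 0"
proof -
  have "{(i, j). 1 \<le> i \<and> i < j \<and> j \<le> n \<and> \<tau> = Transposition.transpose i j} = {}"
    using assms(2) by auto
  then show ?thesis
    using assms(1) unfolding P_def by (simp only: if_False sum.empty)
qed

text \<open>Transition matrix of the walk \<open>\<sigma> \<mapsto> \<tau> \<circ> \<sigma>\<close>, \<open>\<tau>\<close> drawn from \<open>P n\<close>; the states are enumerated
  by the list \<open>ps\<close>, and the entry \<open>(k, l)\<close> is the probability of going from state \<open>k\<close> to state \<open>l\<close>.\<close>

definition transition_matrix :: "nat \<Rightarrow> (nat \<Rightarrow> nat) list \<Rightarrow> complex mat" where
  "transition_matrix n ps =
    mat (length ps) (length ps) (\<lambda>(k, l). complex_of_real (P n (ps ! l \<circ> inv_into UNIV (ps ! k))))"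

text \<open>Elements of the group algebra of \<open>Sym n\<close> are finitely supported functions on permutations.
  Since \<open>Transposition.transpose i i = id\<close>, the convention \<open>(i i) = id\<close> is built in.\<close>

definition Q :: "nat \<Rightarrow> ((nat \<Rightarrow> nat) \<Rightarrow>\<^sub>0 complex)" where
  "Q n = (\<Sum>(i, j) \<in> {(i, j). 1 \<le> i \<and> i \<le> j \<and> j \<le> n}.
            scalev (1 / of_nat j) (bvec (Transposition.transpose i j)))"

lemma lookup_Q: "Poly_Mapping.lookup (scalev (1 / of_nat n) (Q n)) \<tau> = complex_of_real (P n \<tau>)"
proof -
  define A where "A = {(i, j). 1 \<le> i \<and> i \<le> j \<and> j \<le> n}"
  have fin: "finite A"
    by (rule finite_subset[of _ "{1..n} \<times> {1..n}"]) (auto simp: A_def)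
  have "Poly_Mapping.lookup (scalev (1 / of_nat n) (Q n)) \<tau> =
      (\<Sum>(i, j)\<in>A. if Transposition.transpose i j = \<tau> then 1 / (of_nat n * of_nat j) else 0)"
    unfolding Q_def A_def
    by (auto simp: lookup_sum sum_distrib_left lookup_single when_def intro!: sum.cong)
  also have "\<dots> = (\<Sum>(i, j)\<in>{(i, j). (i, j) \<in> A \<and> Transposition.transpose i j = \<tau>}.
      1 / (of_nat n * of_nat j))"
    using fin by (intro sum.mono_neutral_cong_right) (auto split: if_splits)
  also have "\<dots> = complex_of_real (P n \<tau>)"
  proof (cases "\<tau> = id")
    case True
    have "{(i, j). (i, j) \<in> A \<and> Transposition.transpose i j = \<tau>} = (\<lambda>j. (j, j)) ` {1..n}"
      using True by (auto simp: A_def transpose_eq_id_iff)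
    moreover have "inj_on (\<lambda>j. (j, j)) {1..n}"
      by (auto simp: inj_on_def)
    ultimately show ?thesis
      by (simp add: True P_def sum.reindex sum_distrib_left)
  next
    case False
    have "{(i, j). (i, j) \<in> A \<and> Transposition.transpose i j = \<tau>} =
        {(i, j). 1 \<le> i \<and> i < j \<and> j \<le> n \<and> \<tau> = Transposition.transpose i j}"
      using False by (auto simp: A_def order_le_less)
    then show ?thesis
      using False by (simp add: P_def case_prod_unfold)
  qed
  finally show ?thesis .
qed


section \<open>Words\<close>

definition words :: "nat \<Rightarrow> nat list set" where
  "words n = {w. length w = n \<and> set w \<subseteq> {1..n}}"

text \<open>Positions of words are numbered from 1.\<close>

definition act_word :: "(nat \<Rightarrow> nat) \<Rightarrow> nat list \<Rightarrow> nat list" where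
  "act_word \<sigma> w = map (\<lambda>k. w ! (inv_into UNIV \<sigma> k - 1)) [1..<length w + 1]"

definition act :: "(nat \<Rightarrow> nat) \<Rightarrow> (nat list \<Rightarrow>\<^sub>0 complex) \<Rightarrow> (nat list \<Rightarrow>\<^sub>0 complex)" where
  "act \<sigma> = lin_ext (\<lambda>w. bvec (act_word \<sigma> w))"

definition act_alg :: "((nat \<Rightarrow> nat) \<Rightarrow>\<^sub>0 complex) \<Rightarrow> (nat list \<Rightarrow>\<^sub>0 complex) \<Rightarrow> (nat list \<Rightarrow>\<^sub>0 complex)" where
  "act_alg x v = lin_ext (\<lambda>\<sigma>. act \<sigma> v) x"

definition word_module :: "nat \<Rightarrow> (nat list \<Rightarrow>\<^sub>0 complex) set" where
  "word_module n = fv.span (bvec ` words n)"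

definition submodule :: "nat \<Rightarrow> (nat list \<Rightarrow>\<^sub>0 complex) set \<Rightarrow> bool" where
  "submodule n V \<longleftrightarrow>
    V \<subseteq> word_module n \<and> fv.subspace V \<and> (\<forall>\<sigma>\<in>Sym n. \<forall>v\<in>V. act \<sigma> v \<in> V)"

definition simple :: "nat \<Rightarrow> (nat list \<Rightarrow>\<^sub>0 complex) set \<Rightarrow> bool" where
  "simple n V \<longleftrightarrow>
    submodule n V \<and> V \<noteq> {0} \<and> (\<forall>U. submodule n U \<and> U \<subseteq> V \<longrightarrow> U = {0} \<or> U = V)"

text \<open>Only the restriction of \<open>f\<close> to \<open>V\<close> matters: every linear map on a subspace extends to a linear
  map on the whole space.\<close>

definition isomorphic :: "nat \<Rightarrow> (nat list \<Rightarrow>\<^sub>0 complex) set \<Rightarrow> (nat list \<Rightarrow>\<^sub>0 complex) set \<Rightarrow> bool" where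
  "isomorphic n V W \<longleftrightarrow>
    (\<exists>f. Vector_Spaces.linear scalev scalev f \<and> bij_betw f V W \<and>
         (\<forall>\<sigma>\<in>Sym n. \<forall>v\<in>V. f (act \<sigma> v) = act \<sigma> (f v)))"

definition append_letter :: "nat \<Rightarrow> (nat list \<Rightarrow>\<^sub>0 complex) \<Rightarrow> (nat list \<Rightarrow>\<^sub>0 complex)" where
  "append_letter a = lin_ext (\<lambda>w. bvec (w @ [a]))"


section \<open>Partitions and tableaux\<close>

text \<open>A partition of \<open>n\<close> is the function giving its row lengths, with rows numbered from 1 and
  padded with zeros.  A tableau maps boxes to entries, with the value 0 outside the diagram, so that
  a tableau is determined by its entries.\<close>

definition partitions_of :: "nat \<Rightarrow> (nat \<Rightarrow> nat) set" where
  "partitions_of n =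
    {lam. lam 0 = 0 \<and> (\<forall>i\<ge>1. lam (Suc i) \<le> lam i) \<and> (\<forall>i>n. lam i = 0) \<and> (\<Sum>i = 1..n. lam i) = n}"

definition diagram :: "(nat \<Rightarrow> nat) \<Rightarrow> (nat \<times> nat) set" where
  "diagram lam = {(i, j). 1 \<le> i \<and> 1 \<le> j \<and> j \<le> lam i}"

definition tableaux :: "nat \<Rightarrow> (nat \<Rightarrow> nat) \<Rightarrow> (nat \<times> nat \<Rightarrow> nat) set" where
  "tableaux n lam = {T. bij_betw T (diagram lam) {1..n} \<and> (\<forall>b. b \<notin> diagram lam \<longrightarrow> T b = 0)}"

definition SYT :: "nat \<Rightarrow> (nat \<Rightarrow> nat) \<Rightarrow> (nat \<times> nat \<Rightarrow> nat) set" where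
  "SYT n lam =
    {T \<in> tableaux n lam.
      (\<forall>i j j'. (i, j) \<in> diagram lam \<and> (i, j') \<in> diagram lam \<and> j < j' \<longrightarrow> T (i, j) < T (i, j')) \<and>
      (\<forall>i i' j. (i, j) \<in> diagram lam \<and> (i', j) \<in> diagram lam \<and> i < i' \<longrightarrow> T (i, j) < T (i', j))}"

text \<open>The row containing the entry \<open>k \<ge> 1\<close>.\<close>

definition row_of :: "(nat \<times> nat \<Rightarrow> nat) \<Rightarrow> nat \<Rightarrow> nat" where
  "row_of T k = (THE i. \<exists>j. T (i, j) = k)"

text \<open>The shape of the subtableau with entries \<open>1, \<dots>, m\<close>.\<close>

definition subshape :: "(nat \<times> nat \<Rightarrow> nat) \<Rightarrow> nat \<Rightarrow> (nat \<Rightarrow> nat)" where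
  "subshape T m = (\<lambda>i. card {j. T (i, j) \<in> {1..m}})"


section \<open>Specht modules\<close>

definition perm_module :: "nat \<Rightarrow> (nat \<Rightarrow> nat) \<Rightarrow> (nat list \<Rightarrow>\<^sub>0 complex) set" where
  "perm_module n lam =
    fv.span (bvec ` {w \<in> words n. \<forall>i\<in>{1..n}. count_list w i = lam i})"

definition tableau_word :: "nat \<Rightarrow> (nat \<times> nat \<Rightarrow> nat) \<Rightarrow> nat list" where
  "tableau_word n T = map (row_of T) [1..<n + 1]"

definition column_group :: "nat \<Rightarrow> (nat \<times> nat \<Rightarrow> nat) \<Rightarrow> (nat \<Rightarrow> nat) set" where
  "column_group n T =
    {\<sigma> \<in> Sym n. \<forall>j. \<sigma> ` {T (i, j) | i. T (i, j) \<noteq> 0} = {T (i, j) | i. T (i, j) \<noteq> 0}}"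

definition specht_vector :: "nat \<Rightarrow> (nat \<times> nat \<Rightarrow> nat) \<Rightarrow> (nat list \<Rightarrow>\<^sub>0 complex)" where
  "specht_vector n T =
    (\<Sum>\<sigma>\<in>column_group n T. scalev (of_int (sign \<sigma>)) (bvec (tableau_word n (\<sigma> \<circ> T))))"

definition specht :: "nat \<Rightarrow> (nat \<Rightarrow> nat) \<Rightarrow> (nat list \<Rightarrow>\<^sub>0 complex) set" where
  "specht n lam = fv.span (specht_vector n ` SYT n lam)"


section \<open>Lifting operators\<close>

text \<open>The isotypic component of \<open>perm_module n mu\<close> belonging to \<open>specht n mu\<close>, and the sum of all
  its other isotypic components.\<close>

definition isotypic :: "nat \<Rightarrow> (nat \<Rightarrow> nat) \<Rightarrow> (nat list \<Rightarrow>\<^sub>0 complex) set" where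
  "isotypic n mu =
    fv.span (\<Union>{V. simple n V \<and> V \<subseteq> perm_module n mu \<and> isomorphic n V (specht n mu)})"

definition co_isotypic :: "nat \<Rightarrow> (nat \<Rightarrow> nat) \<Rightarrow> (nat list \<Rightarrow>\<^sub>0 complex) set" where
  "co_isotypic n mu =
    fv.span (\<Union>{V. simple n V \<and> V \<subseteq> perm_module n mu \<and> \<not> isomorphic n V (specht n mu)})"

text \<open>Meaningful for \<open>v\<close> in \<open>perm_module n mu\<close>, the direct sum of these two submodules.\<close>

definition isotypic_proj ::
    "nat \<Rightarrow> (nat \<Rightarrow> nat) \<Rightarrow> (nat list \<Rightarrow>\<^sub>0 complex) \<Rightarrow> (nat list \<Rightarrow>\<^sub>0 complex)" where
  "isotypic_proj n mu v = (THE u. u \<in> isotypic n mu \<and> v - u \<in> co_isotypic n mu)"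

text \<open>The lifting operator into the Specht module of the partition \<open>mu\<close> of \<open>n\<close>, obtained by adding a
  box in row \<open>a\<close>.  The source partition, which is \<open>mu\<close> with this box removed, only determines the
  domain on which it is used.\<close>

definition lifting ::
    "nat \<Rightarrow> (nat \<Rightarrow> nat) \<Rightarrow> nat \<Rightarrow> (nat list \<Rightarrow>\<^sub>0 complex) \<Rightarrow> (nat list \<Rightarrow>\<^sub>0 complex)" where
  "lifting n mu a v = isotypic_proj n mu (append_letter a v)"

text \<open>\<open>lift_vec T m\<close> is the vector of the subtableau with entries \<open>1, \<dots>, m\<close>; the value at
  \<open>m = 0\<close> is not used.\<close>

fun lift_vec :: "(nat \<times> nat \<Rightarrow> nat) \<Rightarrow> nat \<Rightarrow> (nat list \<Rightarrow>\<^sub>0 complex)" where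
  "lift_vec T 0 = 0"
| "lift_vec T (Suc 0) = bvec [1]"
| "lift_vec T (Suc (Suc m)) =
    lifting (Suc (Suc m)) (subshape T (Suc (Suc m))) (row_of T (Suc (Suc m))) (lift_vec T (Suc m))"

definition eig :: "nat \<Rightarrow> (nat \<times> nat \<Rightarrow> nat) \<Rightarrow> complex" where
  "eig n T =
    (THE c. act_alg (scalev (1 / of_nat n) (Q n)) (lift_vec T n) = scalev c (lift_vec T n))"

end

theory Submission
  imports Defs
begin

text \<open>
  All eigenvectors of the walk come from lifting.  Appending the letter \<open>a\<close> to words of length
  \<open>n\<close> adds to \<open>Q\<^sub>n\<close> the terms \<open>(i n+1) / (n+1)\<close>, and \<open>(i n+1)\<close> exchanges the new letter with the
  \<open>i\<close>-th one.  Collecting the exchanged letters by their value \<open>b\<close> expresses \<open>Q\<^sub>n\<^sub>+\<^sub>1\<close> on appended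
  words through \<open>Q\<^sub>n\<close> and the operators that replace one letter \<open>b\<close> by \<open>a\<close> (\<open>Q_append_letter\<close>).
  Replacing a letter by a smaller one kills every polytabloid (\<open>raising_full_specht\<close>), and replacing
  \<open>b\<close> by \<open>a\<close> is adjoint to replacing \<open>a\<close> by \<open>b\<close>.  Hence after projection to \<open>S\<^sup>\<mu>\<close>, where \<open>\<mu> = \<lambda> + e\<^sub>a\<close>,
  all these operators become scalars, and the lift of an eigenvector of \<open>Q\<^sub>n\<close> in \<open>S\<^sup>\<lambda>\<close> is an eigenvector
  of \<open>Q\<^sub>n\<^sub>+\<^sub>1\<close> whose eigenvalue has grown by \<open>(\<lambda>\<^sub>a - a + 2) / (n+1)\<close> (\<open>lifted_eigenvector\<close>).  The lift is not
  zero because it pairs with the polytabloid of an extended tableau as the original vector does with the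
  polytabloid of the original tableau (\<open>ip_append_letter_specht_vector\<close>).

  The representation theory is reduced to one fact about the Hermitian inner product on words, for which
  permutations are unitary.  For a tableau \<open>T\<close> of shape \<open>\<lambda>\<close> with polytabloid \<open>s(T)\<close>, the antisymmetrizer
  over the column group acts on \<open>M\<^sup>\<lambda>\<close> as \<open>y \<mapsto> \<langle>y, s(T)\<rangle> s(T)\<close>, and it kills \<open>M\<^sup>\<mu>\<close> unless \<open>\<lambda>\<close> dominates \<open>\<mu>\<close>
  (\<open>col_antisym_perm_module_eq\<close>, \<open>col_antisym_not_dominated\<close>).  This yields Schur's lemma in the following
  form: an invariant sesquilinear form vanishes between Specht modules of different shapes and is a multiple
  of the inner product on each of them (\<open>form_different_shapes\<close>, \<open>form_same_shape\<close>).  Applied to lifts, it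
  shows that the vectors \<open>v\<^sub>T\<close> of one shape are pairwise orthogonal; applied to the matrix coefficients
  \<open>\<sigma> \<mapsto> \<langle>\<sigma> x, v\<rangle>\<close>, it shows that those built from orthogonal vectors, or from different shapes, are
  orthogonal functions on \<open>S\<^sub>n\<close>.  The rank-one property also gives James' submodule theorem, by which the
  isotypic projection of \<open>M\<^sup>\<lambda>\<close> is the orthogonal projection to \<open>S\<^sup>\<lambda>\<close> (\<open>isotypic_proj_eq_orth_proj\<close>).

  The matrix coefficient of \<open>v\<^sub>U\<close> and \<open>v\<^sub>T\<close> is an eigenfunction of the walk with eigenvalue \<open>eig(T)\<close>, for
  each of the \<open>d\<^sub>\<lambda>\<close> tableaux \<open>U\<close> of the shape of \<open>T\<close>.  These functions are orthogonal and nonzero, and there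
  are \<open>\<Sum>\<^sub>\<lambda> d\<^sub>\<lambda>\<^sup>2 = n!\<close> of them, so they diagonalize the transition matrix.  The last identity follows
  from the commutation relation between adding and removing boxes in Young's lattice
  (\<open>sum_card_SYT_squared\<close>).  The same count shows that the standard polytabloids, which are
  independent, span all polytabloids (\<open>specht_eq_full_specht\<close>): the dimensions \<open>f\<^sub>\<lambda>\<close> of the
  spans of all polytabloids satisfy \<open>f\<^sub>\<lambda> \<ge> d\<^sub>\<lambda>\<close> and, by orthogonality of the matrix coefficients, \<open>\<Sum>\<^sub>\<lambda> f\<^sub>\<lambda>\<^sup>2 \<le> n!\<close>.
\<close>

section \<open>Hermitian geometry of free vector spaces\<close>

interpretation fv2: vector_space_pair
  "scalev :: complex \<Rightarrow> ('a \<Rightarrow>\<^sub>0 complex) \<Rightarrow> ('a \<Rightarrow>\<^sub>0 complex)"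
  "scalev :: complex \<Rightarrow> ('b \<Rightarrow>\<^sub>0 complex) \<Rightarrow> ('b \<Rightarrow>\<^sub>0 complex)"
  by unfold_locales

lemma linearI_scalev:
  fixes f :: "('a \<Rightarrow>\<^sub>0 complex) \<Rightarrow> ('b \<Rightarrow>\<^sub>0 complex)"
  assumes "\<And>u v. f (u + v) = f u + f v" "\<And>c u. f (scalev c u) = scalev c (f u)"
  shows "Vector_Spaces.linear scalev scalev f"
  using assms unfolding Vector_Spaces.linear_iff by (auto intro: fv.vector_space_axioms)

lemma lin_ext_superset:
  assumes "finite A" "Poly_Mapping.keys v \<subseteq> A"
  shows "lin_ext F v = (\<Sum>b\<in>A. scalev (Poly_Mapping.lookup v b) (F b))"
  unfolding lin_ext_def
  using assms by (intro sum.mono_neutral_left) (auto simp: in_keys_iff)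

lemma linear_lin_ext: "Vector_Spaces.linear scalev scalev (lin_ext F)"
proof (rule linearI_scalev)
  fix u v :: "'a \<Rightarrow>\<^sub>0 complex" and c
  let ?A = "Poly_Mapping.keys u \<union> Poly_Mapping.keys v"
  have "Poly_Mapping.keys (u + v) \<subseteq> ?A"
    by (rule Poly_Mapping.keys_add)
  then show "lin_ext F (u + v) = lin_ext F u + lin_ext F v"
    by (simp add: lin_ext_superset[where A = ?A] lookup_add fv.scale_left_distrib sum.distrib)
  have "Poly_Mapping.keys (scalev c u) \<subseteq> Poly_Mapping.keys u"
    by (auto simp: in_keys_iff)
  then show "lin_ext F (scalev c u) = scalev c (lin_ext F u)"
    by (simp add: lin_ext_superset[where A = "Poly_Mapping.keys u"] fv.scale_sum_right)
qed

lemmas lin_ext_scale = fv2.linear_scale[OF linear_lin_ext]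
  and lin_ext_sum = fv2.linear_sum[OF linear_lin_ext]

lemma lin_ext_bvec [simp]: "lin_ext F (bvec b) = F b"
  by (simp add: lin_ext_superset[where A = "{b}"])

lemma bvec_expansion:
  assumes "finite A" "Poly_Mapping.keys v \<subseteq> A"
  shows "v = (\<Sum>b\<in>A. scalev (Poly_Mapping.lookup v b) (bvec b))"
proof (rule poly_mapping_eqI)
  fix k
  show "Poly_Mapping.lookup v k =
      Poly_Mapping.lookup (\<Sum>b\<in>A. scalev (Poly_Mapping.lookup v b) (bvec b)) k"
  proof (cases "k \<in> A")
    case True
    have "(\<Sum>b\<in>A. Poly_Mapping.lookup v b * (1 when b = k)) = (\<Sum>b\<in>{k}. Poly_Mapping.lookup v b * (1 when b = k))"
      using assms(1) True by (intro sum.mono_neutral_right) auto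
    then show ?thesis
      by (simp add: lookup_sum lookup_single)
  next
    case False
    then have "(\<Sum>b\<in>A. Poly_Mapping.lookup v b * (1 when b = k)) = 0"
      by (intro sum.neutral) auto
    with False assms(2) show ?thesis
      by (auto simp: lookup_sum lookup_single in_keys_iff)
  qed
qed

lemma span_bvec: "fv.span (bvec ` A) = {v :: 'a \<Rightarrow>\<^sub>0 complex. Poly_Mapping.keys v \<subseteq> A}"
proof
  have "fv.subspace {v :: 'a \<Rightarrow>\<^sub>0 complex. Poly_Mapping.keys v \<subseteq> A}"
  proof (rule fv.subspaceI)
    fix u v :: "'a \<Rightarrow>\<^sub>0 complex" and c
    assume u: "u \<in> {v. Poly_Mapping.keys v \<subseteq> A}"
    show "scalev c u \<in> {v. Poly_Mapping.keys v \<subseteq> A}"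
      using u by (auto simp: in_keys_iff)
    assume v: "v \<in> {v. Poly_Mapping.keys v \<subseteq> A}"
    show "u + v \<in> {v. Poly_Mapping.keys v \<subseteq> A}"
      using u v Poly_Mapping.keys_add[of u v] by blast
  qed simp
  then show "fv.span (bvec ` A) \<subseteq> {v :: 'a \<Rightarrow>\<^sub>0 complex. Poly_Mapping.keys v \<subseteq> A}"
    by (intro fv.span_minimal) auto
next
  show "{v. Poly_Mapping.keys v \<subseteq> A} \<subseteq> fv.span (bvec ` A)"
  proof
    fix v :: "'a \<Rightarrow>\<^sub>0 complex" assume "v \<in> {v. Poly_Mapping.keys v \<subseteq> A}"
    then have "(\<Sum>b\<in>Poly_Mapping.keys v. scalev (Poly_Mapping.lookup v b) (bvec b)) \<in> fv.span (bvec ` A)"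
      by (intro fv.span_sum fv.span_scale fv.span_base) auto
    then show "v \<in> fv.span (bvec ` A)"
      using bvec_expansion[of "Poly_Mapping.keys v" v] by simp
  qed
qed

lemma span_image_induct [consumes 1, case_names zero step]:
  assumes "v \<in> fv.span (f ` A)" "R 0"
    "\<And>c a y. a \<in> A \<Longrightarrow> y \<in> fv.span (f ` A) \<Longrightarrow> R y \<Longrightarrow> R (scalev c (f a) + y)"
  shows "R v"
proof -
  have "v \<in> fv.span (f ` A) \<and> R v"
    using assms(1)
  proof (induction rule: fv.span_induct_alt)
    case base
    then show ?case
      using assms(2) by (simp add: fv.span_zero)
  next
    case (step c x y)
    then obtain a where a: "a \<in> A" "x = f a"
      by blast
    then have "f a \<in> fv.span (f ` A)"
      by (intro fv.span_base) simp
    then have "scalev c (f a) + y \<in> fv.span (f ` A)"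
      using step by (intro fv.span_add fv.span_scale) auto
    with a step assms(3)[of a y c] show ?case
      by simp
  qed
  then show ?thesis ..
qed

definition ip :: "('a \<Rightarrow>\<^sub>0 complex) \<Rightarrow> ('a \<Rightarrow>\<^sub>0 complex) \<Rightarrow> complex" where
  "ip u v = (\<Sum>w\<in>Poly_Mapping.keys u. Poly_Mapping.lookup u w * cnj (Poly_Mapping.lookup v w))"

lemma ip_superset:
  assumes "finite A" "Poly_Mapping.keys u \<subseteq> A"
  shows "ip u v = (\<Sum>w\<in>A. Poly_Mapping.lookup u w * cnj (Poly_Mapping.lookup v w))"
  unfolding ip_def using assms by (intro sum.mono_neutral_left) (auto simp: in_keys_iff)

lemma ip_commute: "ip v u = cnj (ip u v)"
  by (simp add: ip_superset[where A = "Poly_Mapping.keys u \<union> Poly_Mapping.keys v"] mult.commute)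

lemma ip_add_left: "ip (u + u') v = ip u v + ip u' v"
  using Poly_Mapping.keys_add[of u u']
  by (simp add: ip_superset[where A = "Poly_Mapping.keys u \<union> Poly_Mapping.keys u'"]
      lookup_add distrib_right sum.distrib)

lemma ip_scale_left: "ip (scalev c u) v = c * ip u v"
proof -
  have "Poly_Mapping.keys (scalev c u) \<subseteq> Poly_Mapping.keys u"
    by (auto simp: in_keys_iff)
  then show ?thesis
    by (simp add: ip_superset[where A = "Poly_Mapping.keys u"] sum_distrib_left mult.assoc)
qed

lemma ip_zero_left [simp]: "ip 0 v = 0"
  by (simp add: ip_def)

lemma ip_sum_left: "ip (sum f A) v = (\<Sum>a\<in>A. ip (f a) v)"
  by (induction A rule: infinite_finite_induct) (auto simp: ip_add_left)

lemma ip_uminus_left: "ip (- u) v = - ip u v"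
  using ip_add_left[of u "- u" v] by (simp add: add_eq_0_iff)

lemma ip_diff_left: "ip (u - u') v = ip u v - ip u' v"
  using ip_add_left[of u "- u'" v] by (simp add: ip_uminus_left)

lemma ip_zero_right [simp]: "ip u 0 = 0"
  using ip_commute[of 0 u] by simp

lemma ip_add_right: "ip u (v + v') = ip u v + ip u v'"
  by (subst (1 2 3) ip_commute) (simp add: ip_add_left)

lemma ip_scale_right: "ip u (scalev c v) = cnj c * ip u v"
  by (subst (1 2) ip_commute) (simp add: ip_scale_left)

lemma ip_sum_right: "ip u (sum f A) = (\<Sum>a\<in>A. ip u (f a))"
  by (induction A rule: infinite_finite_induct) (auto simp: ip_add_right)

lemma ip_bvec_left: "ip (bvec w) v = cnj (Poly_Mapping.lookup v w)"
  by (simp add: ip_def)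

lemma ip_bvec_right: "ip v (bvec w) = Poly_Mapping.lookup v w"
  using ip_commute[of v "bvec w"] by (simp add: ip_bvec_left)

lemma ip_self: "ip v v = of_real (\<Sum>w\<in>Poly_Mapping.keys v. (cmod (Poly_Mapping.lookup v w))\<^sup>2)"
  by (simp add: ip_def complex_norm_square[symmetric] del: of_real_power)

lemma ip_self_eq_0_iff [simp]: "ip v v = 0 \<longleftrightarrow> v = 0"
proof
  assume "ip v v = 0"
  then have "(\<Sum>w\<in>Poly_Mapping.keys v. (cmod (Poly_Mapping.lookup v w))\<^sup>2) = 0"
    unfolding ip_self by (simp only: of_real_eq_0_iff)
  then have "\<forall>w\<in>Poly_Mapping.keys v. Poly_Mapping.lookup v w = 0"
    by (simp add: sum_nonneg_eq_0_iff)
  then show "v = 0"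
    by (auto simp: in_keys_iff intro: poly_mapping_eqI)
qed simp

lemma ip_span_left:
  assumes "u \<in> fv.span B" "\<And>b. b \<in> B \<Longrightarrow> ip b v = 0"
  shows "ip u v = 0"
  using assms(1)
proof (induction rule: fv.span_induct)
  case base
  show ?case
    by (auto simp: fv.subspace_def ip_add_left ip_scale_left)
qed (use assms(2) in auto)

lemma ip_span_right:
  assumes "u \<in> fv.span B" "\<And>b. b \<in> B \<Longrightarrow> ip v b = 0"
  shows "ip v u = 0"
proof -
  have "ip u v = 0"
    using assms(1)
  proof (rule ip_span_left)
    fix b assume "b \<in> B"
    then show "ip b v = 0"
      using assms(2)[of b] ip_commute[of b v] by simp
  qed
  then show ?thesis
    using ip_commute[of v u] by simp
qed

subsection \<open>Orthogonal bases and projections\<close>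

definition orthogonal_set :: "('a \<Rightarrow>\<^sub>0 complex) set \<Rightarrow> bool" where
  "orthogonal_set B \<longleftrightarrow> 0 \<notin> B \<and> (\<forall>x\<in>B. \<forall>y\<in>B. x \<noteq> y \<longrightarrow> ip x y = 0)"

lemma orthogonal_set_independent:
  assumes "finite B" "orthogonal_set B"
  shows "fv.independent B"
proof (rule fv.independent_if_scalars_zero[OF assms(1)])
  fix f x
  assume eq: "(\<Sum>x\<in>B. scalev (f x) x) = 0" and x: "x \<in> B"
  have "0 = ip (\<Sum>x\<in>B. scalev (f x) x) x"
    by (simp add: eq)
  also have "\<dots> = (\<Sum>y\<in>B. f y * ip y x)"
    by (simp add: ip_sum_left ip_scale_left)
  also have "\<dots> = (\<Sum>y\<in>{x}. f y * ip y x)"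
    using assms x by (intro sum.mono_neutral_right) (auto simp: orthogonal_set_def)
  finally have "f x * ip x x = 0"
    by simp
  moreover have "x \<noteq> 0"
    using assms x by (auto simp: orthogonal_set_def)
  ultimately show "f x = 0"
    by simp
qed

lemma orthogonal_set_projection:
  assumes "finite B" "orthogonal_set B"
  shows "\<exists>u\<in>fv.span B. \<forall>x\<in>fv.span B. ip (v - u) x = 0"
proof
  let ?u = "\<Sum>b\<in>B. scalev (ip v b / ip b b) b"
  show "?u \<in> fv.span B"
    by (intro fv.span_sum fv.span_scale fv.span_base)
  show "\<forall>x\<in>fv.span B. ip (v - ?u) x = 0"
  proof (rule ballI, erule ip_span_right)
    fix b assume b: "b \<in> B"
    have "ip ?u b = (\<Sum>c\<in>B. ip v c / ip c c * ip c b)"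
      by (simp add: ip_sum_left ip_scale_left)
    also have "\<dots> = (\<Sum>c\<in>{b}. ip v c / ip c c * ip c b)"
      using assms b by (intro sum.mono_neutral_right) (auto simp: orthogonal_set_def)
    also have "\<dots> = ip v b"
      using assms b by (auto simp: orthogonal_set_def)
    finally show "ip (v - ?u) b = 0"
      by (simp add: ip_diff_left)
  qed
qed

text \<open>The Gram--Schmidt process.\<close>

lemma orthogonal_basis_exists:
  assumes "finite B"
  shows "\<exists>C. finite C \<and> orthogonal_set C \<and> fv.span C = fv.span B"
  using assms
proof (induction B rule: finite_induct)
  case empty
  then show ?case
    by (intro exI[of _ "{}"]) (auto simp: orthogonal_set_def)
next
  case (insert b B)
  then obtain C where C: "finite C" "orthogonal_set C" "fv.span C = fv.span B"
    by blast
  obtain u where u: "u \<in> fv.span C" "\<And>x. x \<in> fv.span C \<Longrightarrow> ip (b - u) x = 0"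
    using orthogonal_set_projection[OF C(1,2)] by blast
  have sp: "fv.span (insert b B) = fv.span (insert (b - u) C)"
  proof
    have "b = (b - u) + u" by simp
    moreover have "b - u \<in> fv.span (insert (b - u) C)"
      by (rule fv.span_base) simp
    moreover have "fv.span C \<subseteq> fv.span (insert (b - u) C)"
      by (rule fv.span_mono) auto
    ultimately have "b \<in> fv.span (insert (b - u) C)"
      using u(1) fv.span_add by (metis subsetD)
    moreover have "B \<subseteq> fv.span (insert (b - u) C)"
      using C(3) fv.span_superset[of B] \<open>fv.span C \<subseteq> _\<close> by blast
    ultimately show "fv.span (insert b B) \<subseteq> fv.span (insert (b - u) C)"
      by (intro fv.span_minimal) auto
  next
    have B: "fv.span B \<subseteq> fv.span (insert b B)"
      by (rule fv.span_mono) auto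
    have "b \<in> fv.span (insert b B)"
      by (rule fv.span_base) simp
    then have "b - u \<in> fv.span (insert b B)"
      using u(1) C(3) B by (intro fv.span_diff) auto
    moreover have "C \<subseteq> fv.span (insert b B)"
      using B C(3) fv.span_superset[of C] by blast
    ultimately show "fv.span (insert (b - u) C) \<subseteq> fv.span (insert b B)"
      by (intro fv.span_minimal) auto
  qed
  show ?case
  proof (cases "b - u = 0")
    case True
    then have "fv.span (insert b B) = fv.span C"
      using sp fv.span_insert_0 by metis
    with C show ?thesis by blast
  next
    case False
    have "ip (b - u) x = 0 \<and> ip x (b - u) = 0" if "x \<in> C" for x
      using u(2)[of x] ip_commute[of x "b - u"] that fv.span_base[of x C] by simp
    with False C have "orthogonal_set (insert (b - u) C)"
      unfolding orthogonal_set_def by (auto simp del: right_minus_eq)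
    with C(1) sp show ?thesis
      by (intro exI[of _ "insert (b - u) C"]) simp
  qed
qed

definition fin_dim_subspace :: "('a \<Rightarrow>\<^sub>0 complex) set \<Rightarrow> bool" where
  "fin_dim_subspace U \<longleftrightarrow> (\<exists>B. finite B \<and> U = fv.span B)"

lemma fin_dim_subspace_subspace: "fin_dim_subspace U \<Longrightarrow> fv.subspace U"
  by (auto simp: fin_dim_subspace_def)

lemma subspace_of_fin_dim:
  assumes "fv.subspace U" "U \<subseteq> fv.span B" "finite B"
  shows "fin_dim_subspace U"
proof -
  obtain C where C: "C \<subseteq> U" "fv.independent C" "U \<subseteq> fv.span C" "card C = fv.dim U"
    by (rule fv.basis_exists)
  have "finite C"
    using fv.independent_span_bound[OF assms(3) C(2) subset_trans[OF C(1) assms(2)]] by simp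
  moreover have "U = fv.span C"
    using C(1,3) fv.span_minimal[OF C(1) assms(1)] by blast
  ultimately show ?thesis
    unfolding fin_dim_subspace_def by blast
qed

lemma dim_strict_mono:
  assumes "fv.subspace U" "fv.subspace W" "U \<subset> W" "W \<subseteq> fv.span B" "finite B"
  shows "fv.dim U < fv.dim W"
proof -
  obtain C where C: "C \<subseteq> U" "fv.independent C" "U \<subseteq> fv.span C" "card C = fv.dim U"
    using fv.basis_exists by blast
  obtain D where D: "D \<subseteq> W" "fv.independent D" "W \<subseteq> fv.span D" "card D = fv.dim W"
    using fv.basis_exists by blast
  have fin: "finite D"
    using fv.independent_span_bound[OF assms(5) D(2) subset_trans[OF D(1) assms(4)]] by simp
  obtain w where w: "w \<in> W" "w \<notin> U"
    using assms(3) by blast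
  have "fv.span C = U"
    using C(1,3) fv.span_minimal[OF C(1) assms(1)] by blast
  then have "w \<notin> fv.span C" "w \<notin> C"
    using w C(1) by auto
  then have "fv.independent (insert w C)"
    using C(2) by (intro fv.independent_insertI)
  moreover have "insert w C \<subseteq> fv.span D"
    using w C(1) D(3) assms(3) by blast
  ultimately have "finite (insert w C) \<and> card (insert w C) \<le> card D"
    by (rule fv.independent_span_bound[OF fin])
  then have "finite C" "card (insert w C) \<le> card D"
    by auto
  with \<open>w \<notin> C\<close> C(4) D(4) show ?thesis
    by simp
qed

definition orth_proj :: "('a \<Rightarrow>\<^sub>0 complex) set \<Rightarrow> ('a \<Rightarrow>\<^sub>0 complex) \<Rightarrow> ('a \<Rightarrow>\<^sub>0 complex)" where
  "orth_proj U v = (THE u. u \<in> U \<and> (\<forall>x\<in>U. ip (v - u) x = 0))"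

lemma orth_projI:
  assumes "fv.subspace U" "u \<in> U" "\<And>x. x \<in> U \<Longrightarrow> ip (v - u) x = 0"
  shows "orth_proj U v = u"
  unfolding orth_proj_def
proof (rule the_equality)
  fix u' assume u': "u' \<in> U \<and> (\<forall>x\<in>U. ip (v - u') x = 0)"
  then have d: "u' - u \<in> U"
    using assms fv.subspace_diff by blast
  have "ip (u' - u) (u' - u) = ip (v - u) (u' - u) - ip (v - u') (u' - u)"
    by (simp add: ip_diff_left)
  also have "\<dots> = 0"
    using assms(3)[OF d] u' d by simp
  finally show "u' = u"
    by simp
qed (use assms in auto)

lemma
  assumes "fin_dim_subspace U"
  shows orth_proj_mem: "orth_proj U v \<in> U"
    and orth_proj_orth: "x \<in> U \<Longrightarrow> ip (v - orth_proj U v) x = 0"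
proof -
  obtain B where B: "finite B" "U = fv.span B"
    using assms by (auto simp: fin_dim_subspace_def)
  obtain C where C: "finite C" "orthogonal_set C" "fv.span C = U"
    using orthogonal_basis_exists[OF B(1)] B(2) by auto
  obtain u where u: "u \<in> U" "\<And>x. x \<in> U \<Longrightarrow> ip (v - u) x = 0"
    using orthogonal_set_projection[OF C(1,2)] C(3) by blast
  have "orth_proj U v = u"
    by (rule orth_projI[OF fin_dim_subspace_subspace[OF assms] u])
  with u show "orth_proj U v \<in> U" "x \<in> U \<Longrightarrow> ip (v - orth_proj U v) x = 0"
    by auto
qed

lemma ip_orth_proj:
  assumes "fin_dim_subspace U" "x \<in> U"
  shows "ip (orth_proj U v) x = ip v x" "ip x (orth_proj U v) = ip x v"
  using orth_proj_orth[OF assms, of v] ip_commute[of x v] ip_commute[of x "orth_proj U v"]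
  by (simp_all add: ip_diff_left)

lemma orth_proj_eqI:
  assumes "fin_dim_subspace U" "u \<in> U" "\<And>x. x \<in> U \<Longrightarrow> ip u x = ip v x"
  shows "orth_proj U v = u"
  using assms by (intro orth_projI) (auto simp: fin_dim_subspace_subspace ip_diff_left)

lemma linear_orth_proj:
  assumes "fin_dim_subspace U"
  shows "Vector_Spaces.linear scalev scalev (orth_proj U)"
proof (rule linearI_scalev)
  fix u v :: "'a \<Rightarrow>\<^sub>0 complex" and c
  note S = fin_dim_subspace_subspace[OF assms]
  show "orth_proj U (u + v) = orth_proj U u + orth_proj U v"
    using fv.subspace_add[OF S]
    by (intro orth_proj_eqI[OF assms]) (auto simp: ip_add_left ip_orth_proj[OF assms] orth_proj_mem[OF assms])
  show "orth_proj U (scalev c u) = scalev c (orth_proj U u)"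
    using fv.subspace_scale[OF S]
    by (intro orth_proj_eqI[OF assms]) (auto simp: ip_scale_left ip_orth_proj[OF assms] orth_proj_mem[OF assms])
qed

lemma orth_proj_eq_0_iff:
  assumes "fin_dim_subspace U"
  shows "orth_proj U v = 0 \<longleftrightarrow> (\<forall>x\<in>U. ip v x = 0)"
proof
  assume "orth_proj U v = 0"
  then show "\<forall>x\<in>U. ip v x = 0"
    using ip_orth_proj(1)[OF assms, of _ v] by simp
next
  assume "\<forall>x\<in>U. ip v x = 0"
  then show "orth_proj U v = 0"
    using fv.subspace_0[OF fin_dim_subspace_subspace[OF assms]]
    by (intro orth_proj_eqI[OF assms]) auto
qed

section \<open>The symmetric group acting on words\<close>

(* Positions, rows and columns are numbered from 1, so the literal 1 is kept in simplified terms. *)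
declare One_nat_def [simp del]

text \<open>The notation \<open>inv\<close> already denotes inverses in a group structure.\<close>

abbreviation pinv :: "(nat \<Rightarrow> nat) \<Rightarrow> nat \<Rightarrow> nat" where
  "pinv \<equiv> inv_into UNIV"

lemma Sym_iff: "\<sigma> \<in> Sym n \<longleftrightarrow> \<sigma> permutes {1..n}"
  by (simp add: Sym_def)

lemma finite_Sym [simp]: "finite (Sym n)"
  by (simp add: Sym_def finite_permutations)

lemma card_Sym: "card (Sym n) = fact n"
  by (simp add: Sym_def card_permutations)

lemma id_Sym [simp]: "id \<in> Sym n" "(\<lambda>x. x) \<in> Sym n"
  using permutes_id by (auto simp: Sym_iff id_def)

lemma comp_Sym [simp]: "\<sigma> \<in> Sym n \<Longrightarrow> \<tau> \<in> Sym n \<Longrightarrow> \<sigma> \<circ> \<tau> \<in> Sym n"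
  by (simp add: Sym_iff permutes_compose)

lemma inv_Sym [simp]: "\<sigma> \<in> Sym n \<Longrightarrow> pinv \<sigma> \<in> Sym n"
  by (simp add: Sym_iff permutes_inv)

lemma Sym_mono: "\<sigma> \<in> Sym n \<Longrightarrow> n \<le> m \<Longrightarrow> \<sigma> \<in> Sym m"
  unfolding Sym_iff by (erule permutes_subset) auto

lemma Sym_of_injection:
  assumes "inj_on f {1..n}" "f ` {1..n} \<subseteq> {1..n}" "\<And>k. k \<notin> {1..n} \<Longrightarrow> f k = k"
  shows "f \<in> Sym n"
proof -
  have "bij_betw f {1..n} {1..n}"
    using assms(1,2) by (simp add: bij_betw_def endo_inj_surj)
  then show ?thesis
    unfolding Sym_iff using assms(3) by (rule bij_imp_permutes)
qed

lemma Sym_bij: "\<sigma> \<in> Sym n \<Longrightarrow> bij \<sigma>"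
  by (simp add: Sym_iff permutes_bij)

lemma Sym_in [simp]: "\<sigma> \<in> Sym n \<Longrightarrow> \<sigma> k \<in> {1..n} \<longleftrightarrow> k \<in> {1..n}"
  unfolding Sym_iff by (rule permutes_in_image)

lemma Sym_inv_simps [simp]:
  assumes "\<sigma> \<in> Sym n"
  shows "\<sigma> (pinv \<sigma> k) = k" "pinv \<sigma> (\<sigma> k) = k" "pinv (pinv \<sigma>) = \<sigma>"
    "\<sigma> \<circ> pinv \<sigma> = id" "pinv \<sigma> \<circ> \<sigma> = id"
  using assms permutes_inverses[of \<sigma> "{1..n}"] permutes_inv_o[of \<sigma> "{1..n}"] permutes_inv_inv[of \<sigma> "{1..n}"]
  by (auto simp: Sym_iff)

lemma inv_comp_Sym: "\<sigma> \<in> Sym n \<Longrightarrow> \<tau> \<in> Sym n \<Longrightarrow> pinv (\<sigma> \<circ> \<tau>) = pinv \<tau> \<circ> pinv \<sigma>"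
  by (simp add: Sym_bij o_inv_distrib)

lemma transpose_Sym [simp]:
  "a \<in> {1..n} \<Longrightarrow> b \<in> {1..n} \<Longrightarrow> Transposition.transpose a b \<in> Sym n"
  unfolding Sym_iff by (rule permutes_swap_id)

lemma sum_Sym_inv: "(\<Sum>\<sigma>\<in>Sym n. f (pinv \<sigma>)) = (\<Sum>\<sigma>\<in>Sym n. f \<sigma>)"
  by (rule sum.reindex_bij_witness[of _ pinv pinv]) auto

lemma sum_Sym_comp_right:
  assumes "\<tau> \<in> Sym n"
  shows "(\<Sum>\<sigma>\<in>Sym n. f (\<sigma> \<circ> \<tau>)) = (\<Sum>\<sigma>\<in>Sym n. f \<sigma>)"
  by (rule sum.reindex_bij_witness[of _ "\<lambda>\<sigma>. \<sigma> \<circ> pinv \<tau>" "\<lambda>\<sigma>. \<sigma> \<circ> \<tau>"])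
    (use assms in \<open>auto simp: comp_assoc\<close>)

lemma words_iff: "w \<in> words n \<longleftrightarrow> length w = n \<and> (\<forall>k\<in>{1..n}. w ! (k - 1) \<in> {1..n})"
proof -
  have "set w \<subseteq> A \<longleftrightarrow> (\<forall>k\<in>{1..length w}. w ! (k - 1) \<in> A)" for A :: "nat set"
  proof
    assume "set w \<subseteq> A"
    then show "\<forall>k\<in>{1..length w}. w ! (k - 1) \<in> A"
      by (auto simp: subset_iff)
  next
    assume *: "\<forall>k\<in>{1..length w}. w ! (k - 1) \<in> A"
    show "set w \<subseteq> A"
    proof
      fix x assume "x \<in> set w"
      then obtain i where "i < length w" "x = w ! i"
        by (auto simp: in_set_conv_nth)
      then show "x \<in> A"
        using *[rule_format, of "Suc i"] by simp
    qed
  qed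
  then show ?thesis
    by (auto simp: words_def)
qed

lemma length_words [simp]: "w \<in> words n \<Longrightarrow> length w = n"
  by (simp add: words_def)

lemma finite_words [simp]: "finite (words n)"
proof -
  have "words n = {w. set w \<subseteq> {1..n} \<and> length w = n}"
    unfolding words_def by (rule Collect_cong) (rule conj_commute)
  then show ?thesis
    by (simp only: finite_lists_length_eq finite_atLeastAtMost)
qed

lemma word_eqI:
  assumes "length w = n" "length w' = n" "\<And>k. k \<in> {1..n} \<Longrightarrow> w ! (k - 1) = w' ! (k - 1)"
  shows "w = w'"
proof (rule nth_equalityI)
  fix i assume "i < length w"
  then show "w ! i = w' ! i"
    using assms(1) assms(3)[of "Suc i"] by simp
qed (use assms in simp)

lemma length_act_word [simp]: "length (act_word \<sigma> w) = length w"
  by (simp add: act_word_def del: upt_Suc)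

lemma act_word_nth:
  assumes "length w = n" "k \<in> {1..n}"
  shows "act_word \<sigma> w ! (k - 1) = w ! (pinv \<sigma> k - 1)"
proof -
  have "[1..<n + 1] ! (k - 1) = k"
    using assms by (subst nth_upt) auto
  moreover have "k - 1 < length [1..<n + 1]"
    using assms by auto
  ultimately show ?thesis
    using assms by (simp add: act_word_def del: upt_Suc)
qed

lemma act_word_words [simp]: "\<sigma> \<in> Sym n \<Longrightarrow> w \<in> words n \<Longrightarrow> act_word \<sigma> w \<in> words n"
  unfolding words_iff by (auto simp: act_word_nth simp del: atLeastAtMost_iff One_nat_def)

lemma act_word_id: "act_word id w = w"
  by (rule word_eqI[of _ "length w"]) (auto simp: act_word_nth simp del: atLeastAtMost_iff One_nat_def)

lemma act_word_comp:
  assumes "\<sigma> \<in> Sym n" "\<tau> \<in> Sym n" "length w = n"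
  shows "act_word \<sigma> (act_word \<tau> w) = act_word (\<sigma> \<circ> \<tau>) w"
  by (rule word_eqI[of _ n])
    (use assms in \<open>auto simp: act_word_nth inv_comp_Sym simp del: atLeastAtMost_iff One_nat_def\<close>)

lemma act_word_inj:
  assumes "\<sigma> \<in> Sym n" "length w = n" "length w' = n"
  shows "act_word \<sigma> w = act_word \<sigma> w' \<longleftrightarrow> w = w'"
proof
  assume "act_word \<sigma> w = act_word \<sigma> w'"
  then have "act_word (pinv \<sigma>) (act_word \<sigma> w) = act_word (pinv \<sigma>) (act_word \<sigma> w')"
    by simp
  then show "w = w'"
    using assms by (simp add: act_word_comp[where n = n] act_word_id)
qed simp

subsection \<open>The module of words\<close>

lemma word_module_iff: "v \<in> word_module n \<longleftrightarrow> Poly_Mapping.keys v \<subseteq> words n"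
  by (simp add: word_module_def span_bvec)

lemma subspace_word_module [simp]: "fv.subspace (word_module n)"
  by (simp add: word_module_def)

lemma bvec_word_module [simp]: "w \<in> words n \<Longrightarrow> bvec w \<in> word_module n"
  by (simp add: word_module_iff)

lemma linear_act: "Vector_Spaces.linear scalev scalev (act \<sigma>)"
  unfolding act_def by (rule linear_lin_ext)

lemmas act_add = fv2.linear_add[OF linear_act]
  and act_scale = fv2.linear_scale[OF linear_act]
  and act_sum = fv2.linear_sum[OF linear_act]
  and act_0 [simp] = fv2.linear_0[OF linear_act]

lemma act_bvec [simp]: "act \<sigma> (bvec w) = bvec (act_word \<sigma> w)"
  by (simp add: act_def)

lemma word_module_induct [consumes 1, case_names zero step]:
  assumes "v \<in> word_module n" "R 0"
    "\<And>c w y. w \<in> words n \<Longrightarrow> y \<in> word_module n \<Longrightarrow> R y \<Longrightarrow> R (scalev c (bvec w) + y)"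
  shows "R v"
  using assms unfolding word_module_def by (rule span_image_induct)

lemma act_word_module [simp]:
  assumes "\<sigma> \<in> Sym n" "v \<in> word_module n"
  shows "act \<sigma> v \<in> word_module n"
  using assms(2)
  by (induction rule: word_module_induct)
    (auto simp: act_add act_scale assms(1) fv.subspace_0 intro!: fv.subspace_add fv.subspace_scale)

lemma act_act:
  assumes "\<sigma> \<in> Sym n" "\<tau> \<in> Sym n" "v \<in> word_module n"
  shows "act \<sigma> (act \<tau> v) = act (\<sigma> \<circ> \<tau>) v"
  using assms(3)
  by (induction rule: word_module_induct)
    (simp_all add: act_add act_scale act_word_comp[OF assms(1,2), unfolded o_def])

lemma act_id [simp]: "v \<in> word_module n \<Longrightarrow> act id v = v"
  by (induction rule: word_module_induct) (simp_all add: act_add act_scale act_word_id[unfolded id_def])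

lemma ip_act:
  assumes \<sigma>: "\<sigma> \<in> Sym n" and "u \<in> word_module n" and v: "v \<in> word_module n"
  shows "ip (act \<sigma> u) (act \<sigma> v) = ip u v"
  using assms(2)
proof (induction rule: word_module_induct)
  case (step c w y)
  have "ip (bvec (act_word \<sigma> w)) (act \<sigma> v) = ip (bvec w) v"
    using v
  proof (induction rule: word_module_induct)
    case (step d x z)
    then show ?case
      using \<open>w \<in> words n\<close> act_word_inj[OF \<sigma>, of w x]
      by (auto simp: act_add act_scale ip_add_right ip_scale_right ip_bvec_left lookup_single when_def)
  qed simp
  with step show ?case
    by (simp add: act_add act_scale ip_add_left ip_scale_left)
qed simp

lemma ip_act_left:
  assumes "\<sigma> \<in> Sym n" "u \<in> word_module n" "v \<in> word_module n"
  shows "ip (act \<sigma> u) v = ip u (act (pinv \<sigma>) v)"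
  using ip_act[of \<sigma> n u "act (pinv \<sigma>) v"] assms by (simp add: act_act)

lemma word_module_closed [simp]:
  "u \<in> word_module n \<Longrightarrow> v \<in> word_module n \<Longrightarrow> u + v \<in> word_module n"
  "u \<in> word_module n \<Longrightarrow> v \<in> word_module n \<Longrightarrow> u - v \<in> word_module n"
  "u \<in> word_module n \<Longrightarrow> scalev c u \<in> word_module n"
  "0 \<in> word_module n"
  by (auto intro: fv.subspace_add fv.subspace_diff fv.subspace_scale fv.subspace_0)

lemma word_module_sum [simp]: "(\<And>a. a \<in> A \<Longrightarrow> f a \<in> word_module n) \<Longrightarrow> sum f A \<in> word_module n"
  by (rule fv.subspace_sum) auto

subsection \<open>Words of given content\<close>

definition content_words :: "nat \<Rightarrow> (nat \<Rightarrow> nat) \<Rightarrow> nat list set" where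
  "content_words n lam = {w \<in> words n. \<forall>i\<in>{1..n}. count_list w i = lam i}"

lemma perm_module_iff: "v \<in> perm_module n lam \<longleftrightarrow> Poly_Mapping.keys v \<subseteq> content_words n lam"
  by (simp add: perm_module_def span_bvec content_words_def)

lemma subspace_perm_module [simp]: "fv.subspace (perm_module n lam)"
  by (simp add: perm_module_def)

lemma content_words_words: "w \<in> content_words n lam \<Longrightarrow> w \<in> words n"
  by (simp add: content_words_def)

lemma perm_module_word_module: "perm_module n lam \<subseteq> word_module n"
  by (auto simp: perm_module_iff word_module_iff content_words_def)

lemma bvec_perm_module [simp]: "w \<in> content_words n lam \<Longrightarrow> bvec w \<in> perm_module n lam"
  by (simp add: perm_module_iff)

lemma count_list_positions:
  assumes "length w = n"
  shows "count_list w i = card {k \<in> {1..n}. w ! (k - 1) = i}"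
proof -
  have "count_list w i = card {k. k < n \<and> w ! k = i}"
    using assms by (simp add: count_list_eq_length_filter length_filter_conv_card eq_commute)
  also have "\<dots> = card (Suc ` {k. k < n \<and> w ! k = i})"
    by (simp add: card_image)
  also have "Suc ` {k. k < n \<and> w ! k = i} = {k \<in> {1..n}. w ! (k - 1) = i}"
  proof -
    have "k \<in> Suc ` {k. k < n \<and> w ! k = i}" if "k \<in> {1..n}" "w ! (k - 1) = i" for k
      using that by (intro image_eqI[of _ _ "k - 1"]) auto
    then show ?thesis by auto
  qed
  finally show ?thesis .
qed

lemma act_word_content [simp]:
  assumes "\<sigma> \<in> Sym n" "w \<in> content_words n lam"
  shows "act_word \<sigma> w \<in> content_words n lam"
proof -
  have w: "length w = n" "w \<in> words n"
    using assms(2) by (auto simp: content_words_def)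
  have "count_list (act_word \<sigma> w) i = count_list w i" for i
  proof -
    have "bij_betw (pinv \<sigma>) {k \<in> {1..n}. w ! (pinv \<sigma> k - 1) = i} {k \<in> {1..n}. w ! (k - 1) = i}"
      by (rule bij_betw_byWitness[where f' = \<sigma>])
        (use assms(1) in \<open>auto simp del: atLeastAtMost_iff One_nat_def\<close>)
    moreover have "{k \<in> {1..n}. act_word \<sigma> w ! (k - 1) = i} = {k \<in> {1..n}. w ! (pinv \<sigma> k - 1) = i}"
      using act_word_nth[OF w(1)] by (intro Collect_cong conj_cong) simp_all
    ultimately show ?thesis
      using w by (simp add: count_list_positions[where n = n] bij_betw_same_card)
  qed
  then show ?thesis
    using assms by (simp add: content_words_def)
qed

lemma perm_module_induct [consumes 1, case_names zero step]:
  assumes "v \<in> perm_module n lam" "R 0"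
    "\<And>c w y. w \<in> content_words n lam \<Longrightarrow> y \<in> perm_module n lam \<Longrightarrow> R y \<Longrightarrow> R (scalev c (bvec w) + y)"
  shows "R v"
  using assms unfolding perm_module_def content_words_def[symmetric] by (rule span_image_induct)

lemma act_perm_module [simp]:
  assumes "\<sigma> \<in> Sym n" "v \<in> perm_module n lam"
  shows "act \<sigma> v \<in> perm_module n lam"
  using assms(2)
  by (induction rule: perm_module_induct)
    (auto simp: act_add act_scale assms(1) fv.subspace_0 intro!: fv.subspace_add fv.subspace_scale)

section \<open>Tableaux and their column groups\<close>

lemma partitions_of_decreasing:
  assumes "lam \<in> partitions_of n" "1 \<le> i" "i \<le> i'"
  shows "lam i' \<le> lam i"
  using assms(3,2)
proof (induction i' rule: dec_induct)
  case (step k)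
  then show ?case
    using assms(1) by (auto simp: partitions_of_def intro: order_trans)
qed simp

lemma diagram_row_le:
  assumes "lam \<in> partitions_of n" "(i, j) \<in> diagram lam"
  shows "i \<in> {1..n}"
  using assms by (force simp: partitions_of_def diagram_def not_le[symmetric])

lemma diagram_up:
  assumes "lam \<in> partitions_of n" "(i, j) \<in> diagram lam" "1 \<le> i'" "i' \<le> i"
  shows "(i', j) \<in> diagram lam"
  using assms partitions_of_decreasing[OF assms(1,3,4)] by (auto simp: diagram_def)

definition col_of :: "(nat \<times> nat \<Rightarrow> nat) \<Rightarrow> nat \<Rightarrow> nat" where
  "col_of T k = (THE j. \<exists>i. T (i, j) = k)"

lemma tableau_entry_in: "T \<in> tableaux n lam \<Longrightarrow> b \<in> diagram lam \<Longrightarrow> T b \<in> {1..n}"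
  unfolding tableaux_def by (auto dest: bij_betwE)

lemma tableau_outside: "T \<in> tableaux n lam \<Longrightarrow> b \<notin> diagram lam \<Longrightarrow> T b = 0"
  unfolding tableaux_def by blast

lemma tableau_pos_imp_diagram: "T \<in> tableaux n lam \<Longrightarrow> T b \<in> {1..n} \<Longrightarrow> b \<in> diagram lam"
proof (rule ccontr)
  assume T: "T \<in> tableaux n lam" "T b \<in> {1..n}" and b: "b \<notin> diagram lam"
  have "T b = 0"
    using tableau_outside T(1) b .
  with T(2) show False
    by simp
qed

lemma tableau_inj: "T \<in> tableaux n lam \<Longrightarrow> b \<in> diagram lam \<Longrightarrow> b' \<in> diagram lam \<Longrightarrow> T b = T b' \<Longrightarrow> b = b'"
  unfolding tableaux_def bij_betw_def by (auto dest: inj_onD)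

lemma tableau_box:
  assumes "T \<in> tableaux n lam" "k \<in> {1..n}"
  obtains i j where "(i, j) \<in> diagram lam" "T (i, j) = k"
proof -
  have "k \<in> T ` diagram lam"
    using assms by (auto simp: tableaux_def bij_betw_def)
  then show ?thesis
    using that by auto
qed

lemma row_col_of_entry:
  assumes T: "T \<in> tableaux n lam" and b: "(i, j) \<in> diagram lam"
  shows "row_of T (T (i, j)) = i" "col_of T (T (i, j)) = j"
proof -
  have "i' = i \<and> j' = j" if "T (i', j') = T (i, j)" for i' j'
  proof -
    have "(i', j') \<in> diagram lam"
      using tableau_entry_in[OF T b] that by (intro tableau_pos_imp_diagram[OF T]) simp
    then show ?thesis
      using tableau_inj[OF T _ b] that by blast
  qed
  then show "row_of T (T (i, j)) = i" "col_of T (T (i, j)) = j"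
    unfolding row_of_def col_of_def by (blast intro!: the_equality)+
qed

lemma box_of_entry:
  assumes T: "T \<in> tableaux n lam" and k: "k \<in> {1..n}"
  shows "(row_of T k, col_of T k) \<in> diagram lam" "T (row_of T k, col_of T k) = k"
proof -
  obtain i j where "(i, j) \<in> diagram lam" "T (i, j) = k"
    by (rule tableau_box[OF T k])
  then show "(row_of T k, col_of T k) \<in> diagram lam" "T (row_of T k, col_of T k) = k"
    using row_col_of_entry[OF T, of i j] by auto
qed

lemma comp_tableaux [simp]:
  assumes "\<sigma> \<in> Sym n" "T \<in> tableaux n lam"
  shows "\<sigma> \<circ> T \<in> tableaux n lam"
proof -
  have "bij_betw \<sigma> {1..n} {1..n}"
    using assms(1) by (auto simp: Sym_iff permutes_imp_bij)
  moreover have "\<sigma> 0 = 0"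
    using assms(1) by (auto simp: Sym_iff permutes_def)
  ultimately show ?thesis
    using assms(2) by (auto simp: tableaux_def intro: bij_betw_trans)
qed

lemma row_col_of_comp:
  assumes "\<sigma> \<in> Sym n" "T \<in> tableaux n lam" "k \<in> {1..n}"
  shows "row_of (\<sigma> \<circ> T) (\<sigma> k) = row_of T k" "col_of (\<sigma> \<circ> T) (\<sigma> k) = col_of T k"
  using row_col_of_entry[OF comp_tableaux[OF assms(1,2)] box_of_entry(1)[OF assms(2,3)]]
    box_of_entry(2)[OF assms(2,3)] by simp_all

lemma tableaux_transitive:
  assumes "T \<in> tableaux n lam" "T' \<in> tableaux n lam"
  obtains \<sigma> where "\<sigma> \<in> Sym n" "T' = \<sigma> \<circ> T"
proof -
  define f where "f = (\<lambda>k. if k \<in> {1..n} then T' (row_of T k, col_of T k) else k)"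
  have "inj_on f {1..n}"
  proof (rule inj_onI)
    fix k l assume kl: "k \<in> {1..n}" "l \<in> {1..n}" "f k = f l"
    then have "T' (row_of T k, col_of T k) = T' (row_of T l, col_of T l)"
      by (simp add: f_def)
    then have "(row_of T k, col_of T k) = (row_of T l, col_of T l)"
      by (intro tableau_inj[OF assms(2)] box_of_entry(1)[OF assms(1)]) (use kl in simp_all)
    then show "k = l"
      using kl box_of_entry(2)[OF assms(1)] by metis
  qed
  moreover have "f ` {1..n} \<subseteq> {1..n}"
    using tableau_entry_in[OF assms(2) box_of_entry(1)[OF assms(1)]] by (auto simp: f_def)
  ultimately have "f \<in> Sym n"
    by (rule Sym_of_injection) (auto simp: f_def)
  moreover have "T' = f \<circ> T"
  proof
    fix b :: "nat \<times> nat"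
    obtain i j where b: "b = (i, j)" by (cases b)
    show "T' b = (f \<circ> T) b"
    proof (cases "b \<in> diagram lam")
      case True
      then show ?thesis
        using b row_col_of_entry[OF assms(1), of i j] tableau_entry_in[OF assms(1), of b] by (auto simp: f_def)
    next
      case False
      then show ?thesis
        using tableau_outside[OF assms(1) False] tableau_outside[OF assms(2) False] by (simp add: f_def)
    qed
  qed
  ultimately show ?thesis
    by (rule that)
qed

text \<open>Recording the column of each entry, instead of the sets of entries of the columns, makes closure
  of the column group under composition and inverses immediate.\<close>

lemma column_group_iff:
  assumes T: "T \<in> tableaux n lam"
  shows "\<sigma> \<in> column_group n T \<longleftrightarrow> \<sigma> \<in> Sym n \<and> (\<forall>k\<in>{1..n}. col_of T (\<sigma> k) = col_of T k)"
proof -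
  have col: "{T (i, j) | i. T (i, j) \<noteq> 0} = {k \<in> {1..n}. col_of T k = j}" for j
  proof (intro Set.set_eqI iffI)
    fix k assume "k \<in> {T (i, j) | i. T (i, j) \<noteq> 0}"
    then obtain i where i: "k = T (i, j)" "T (i, j) \<noteq> 0" by blast
    then have "(i, j) \<in> diagram lam"
      using tableau_outside[OF T] by metis
    then show "k \<in> {k \<in> {1..n}. col_of T k = j}"
      using i tableau_entry_in[OF T] row_col_of_entry[OF T] by auto
  next
    fix k assume "k \<in> {k \<in> {1..n}. col_of T k = j}"
    then have "T (row_of T k, j) = k" "k \<noteq> 0"
      using box_of_entry(2)[OF T, of k] by auto
    then show "k \<in> {T (i, j) | i. T (i, j) \<noteq> 0}"
      by (intro CollectI exI[of _ "row_of T k"]) simp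
  qed
  show ?thesis
  proof (intro iffI conjI ballI)
    assume "\<sigma> \<in> column_group n T"
    then have s: "\<sigma> \<in> Sym n" "\<And>j. \<sigma> ` {k \<in> {1..n}. col_of T k = j} = {k \<in> {1..n}. col_of T k = j}"
      unfolding column_group_def mem_Collect_eq col by blast+
    show "\<sigma> \<in> Sym n" by fact
    fix k assume "k \<in> {1..n}"
    then have "\<sigma> k \<in> \<sigma> ` {l \<in> {1..n}. col_of T l = col_of T k}"
      by blast
    then show "col_of T (\<sigma> k) = col_of T k"
      unfolding s(2) by simp
  next
    assume s: "\<sigma> \<in> Sym n \<and> (\<forall>k\<in>{1..n}. col_of T (\<sigma> k) = col_of T k)"
    have "\<sigma> ` {k \<in> {1..n}. col_of T k = j} = {k \<in> {1..n}. col_of T k = j}" for j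
    proof (rule endo_inj_surj)
      show "inj_on \<sigma> {k \<in> {1..n}. col_of T k = j}"
        by (rule inj_on_subset[OF bij_is_inj[OF Sym_bij]]) (use s in auto)
    qed (use s in \<open>auto simp del: atLeastAtMost_iff\<close>)
    then show "\<sigma> \<in> column_group n T"
      unfolding column_group_def col using s by simp
  qed
qed

lemma column_group_Sym: "\<sigma> \<in> column_group n T \<Longrightarrow> \<sigma> \<in> Sym n"
  by (simp add: column_group_def)

lemma finite_column_group [simp]: "finite (column_group n T)"
  by (rule finite_subset[of _ "Sym n"]) (auto simp: column_group_def)

lemma column_group_closed:
  assumes T: "T \<in> tableaux n lam"
  shows "id \<in> column_group n T"
    and "\<sigma> \<in> column_group n T \<Longrightarrow> \<tau> \<in> column_group n T \<Longrightarrow> \<sigma> \<circ> \<tau> \<in> column_group n T"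
    and "\<sigma> \<in> column_group n T \<Longrightarrow> pinv \<sigma> \<in> column_group n T"
    and "p \<in> {1..n} \<Longrightarrow> q \<in> {1..n} \<Longrightarrow> col_of T p = col_of T q \<Longrightarrow>
      Transposition.transpose p q \<in> column_group n T"
proof -
  show "id \<in> column_group n T"
    by (simp add: column_group_iff[OF T])
  show "\<sigma> \<circ> \<tau> \<in> column_group n T" if "\<sigma> \<in> column_group n T" "\<tau> \<in> column_group n T"
    using that Sym_in[of \<tau> n] unfolding column_group_iff[OF T] by (simp del: atLeastAtMost_iff)
  show "pinv \<sigma> \<in> column_group n T" if s: "\<sigma> \<in> column_group n T"
  proof -
    have *: "\<sigma> \<in> Sym n" "\<forall>k\<in>{1..n}. col_of T (\<sigma> k) = col_of T k"
      using s by (auto simp: column_group_iff[OF T])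
    have "col_of T (pinv \<sigma> k) = col_of T k" if "k \<in> {1..n}" for k
      using *(2)[rule_format, of "pinv \<sigma> k"] *(1) that by (simp del: atLeastAtMost_iff)
    with * show ?thesis
      by (auto simp: column_group_iff[OF T])
  qed
  show "Transposition.transpose p q \<in> column_group n T"
    if "p \<in> {1..n}" "q \<in> {1..n}" "col_of T p = col_of T q"
    using that by (auto simp: column_group_iff[OF T] Transposition.transpose_def simp del: atLeastAtMost_iff)
qed

lemma column_group_comp:
  assumes T: "T \<in> tableaux n lam" and \<sigma>: "\<sigma> \<in> Sym n"
  shows "column_group n (\<sigma> \<circ> T) = (\<lambda>\<tau>. \<sigma> \<circ> \<tau> \<circ> pinv \<sigma>) ` column_group n T"
proof (intro Set.set_eqI iffI)
  fix \<rho> assume \<rho>: "\<rho> \<in> column_group n (\<sigma> \<circ> T)"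
  let ?\<tau> = "pinv \<sigma> \<circ> \<rho> \<circ> \<sigma>"
  have \<rho>S: "\<rho> \<in> Sym n" and col: "\<And>k. k \<in> {1..n} \<Longrightarrow> col_of (\<sigma> \<circ> T) (\<rho> k) = col_of (\<sigma> \<circ> T) k"
    using \<rho> column_group_iff[OF comp_tableaux[OF \<sigma> T]] by auto
  have "col_of T (?\<tau> k) = col_of T k" if k: "k \<in> {1..n}" for k
  proof -
    have "col_of T (?\<tau> k) = col_of (\<sigma> \<circ> T) (\<sigma> (?\<tau> k))"
      using row_col_of_comp(2)[OF \<sigma> T, of "?\<tau> k"] k \<sigma> \<rho>S by (simp del: atLeastAtMost_iff)
    also have "\<dots> = col_of T k"
      using col[of "\<sigma> k"] row_col_of_comp(2)[OF \<sigma> T k] k \<sigma> by (simp del: atLeastAtMost_iff)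
    finally show ?thesis .
  qed
  then have "?\<tau> \<in> column_group n T"
    using \<sigma> \<rho>S by (simp add: column_group_iff[OF T])
  moreover have "\<rho> = \<sigma> \<circ> ?\<tau> \<circ> pinv \<sigma>"
    using \<sigma> by (auto simp: fun_eq_iff)
  ultimately show "\<rho> \<in> (\<lambda>\<tau>. \<sigma> \<circ> \<tau> \<circ> pinv \<sigma>) ` column_group n T"
    by blast
next
  fix \<rho> assume "\<rho> \<in> (\<lambda>\<tau>. \<sigma> \<circ> \<tau> \<circ> pinv \<sigma>) ` column_group n T"
  then obtain \<tau> where \<tau>: "\<tau> \<in> column_group n T" "\<rho> = \<sigma> \<circ> \<tau> \<circ> pinv \<sigma>" by blast
  have \<tau>S: "\<tau> \<in> Sym n" and col: "\<And>k. k \<in> {1..n} \<Longrightarrow> col_of T (\<tau> k) = col_of T k"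
    using \<tau> column_group_iff[OF T] by auto
  have "col_of (\<sigma> \<circ> T) (\<rho> k) = col_of (\<sigma> \<circ> T) k" if k: "k \<in> {1..n}" for k
  proof -
    have "col_of (\<sigma> \<circ> T) (\<rho> k) = col_of T (\<tau> (pinv \<sigma> k))"
      unfolding \<tau> using row_col_of_comp(2)[OF \<sigma> T, of "\<tau> (pinv \<sigma> k)"] k \<sigma> \<tau>S by (simp del: atLeastAtMost_iff)
    also have "\<dots> = col_of T (pinv \<sigma> k)"
      using col[of "pinv \<sigma> k"] k \<sigma> by (simp del: atLeastAtMost_iff)
    also have "\<dots> = col_of (\<sigma> \<circ> T) k"
      using row_col_of_comp(2)[OF \<sigma> T, of "pinv \<sigma> k"] k \<sigma> by (simp del: atLeastAtMost_iff)
    finally show ?thesis .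
  qed
  then show "\<rho> \<in> column_group n (\<sigma> \<circ> T)"
    using \<sigma> \<tau>S \<tau>(2) by (simp add: column_group_iff[OF comp_tableaux[OF \<sigma> T]])
qed

lemma tableau_word_nth:
  assumes "k \<in> {1..n}"
  shows "tableau_word n T ! (k - 1) = row_of T k"
proof -
  have "[1..<n + 1] ! (k - 1) = k"
    using assms by (subst nth_upt) auto
  then show ?thesis
    unfolding tableau_word_def by (subst nth_map) (use assms in auto)
qed

lemma length_tableau_word [simp]: "length (tableau_word n T) = n"
  by (simp add: tableau_word_def)

lemma act_word_tableau_word:
  assumes "\<sigma> \<in> Sym n" "T \<in> tableaux n lam"
  shows "act_word \<sigma> (tableau_word n T) = tableau_word n (\<sigma> \<circ> T)"
proof (rule word_eqI[of _ n])
  fix k assume k: "k \<in> {1..n}"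
  then show "act_word \<sigma> (tableau_word n T) ! (k - 1) = tableau_word n (\<sigma> \<circ> T) ! (k - 1)"
    using row_col_of_comp(1)[OF assms, of "pinv \<sigma> k"] assms(1)
    by (simp add: act_word_nth tableau_word_nth del: atLeastAtMost_iff One_nat_def)
qed simp_all

lemma tableau_word_content [simp]:
  assumes lam: "lam \<in> partitions_of n" and T: "T \<in> tableaux n lam"
  shows "tableau_word n T \<in> content_words n lam"
proof -
  have "count_list (tableau_word n T) i = lam i" if "i \<in> {1..n}" for i
  proof -
    have "bij_betw (\<lambda>j. T (i, j)) {1..lam i} {k \<in> {1..n}. row_of T k = i}"
    proof (rule bij_betw_imageI)
      have d: "(i, j) \<in> diagram lam" if "j \<in> {1..lam i}" for j
        using that \<open>i \<in> {1..n}\<close> by (auto simp: diagram_def)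
      show "inj_on (\<lambda>j. T (i, j)) {1..lam i}"
        by (rule inj_onI) (use d tableau_inj[OF T] in blast)
      show "(\<lambda>j. T (i, j)) ` {1..lam i} = {k \<in> {1..n}. row_of T k = i}"
      proof (intro subset_antisym subsetI)
        fix k assume "k \<in> {k \<in> {1..n}. row_of T k = i}"
        then have k: "k \<in> {1..n}" "row_of T k = i" by auto
        have "col_of T k \<in> {1..lam i}"
          using box_of_entry(1)[OF T k(1)] k(2) by (auto simp: diagram_def)
        moreover have "T (i, col_of T k) = k"
          using box_of_entry(2)[OF T k(1)] k(2) by simp
        ultimately show "k \<in> (\<lambda>j. T (i, j)) ` {1..lam i}" by force
      qed (use d tableau_entry_in[OF T] row_col_of_entry[OF T] in fastforce)
    qed
    moreover have "{k \<in> {1..n}. tableau_word n T ! (k - 1) = i} = {k \<in> {1..n}. row_of T k = i}"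
      by (auto simp: tableau_word_nth simp del: atLeastAtMost_iff One_nat_def)
    ultimately show ?thesis
      using bij_betw_same_card by (fastforce simp: count_list_positions[where n = n])
  qed
  moreover have "tableau_word n T \<in> words n"
    using box_of_entry(1)[OF T] diagram_row_le[OF lam]
    by (auto simp: words_iff tableau_word_nth simp del: atLeastAtMost_iff One_nat_def)
  ultimately show ?thesis
    by (simp add: content_words_def)
qed

section \<open>Column antisymmetrizers and Specht modules\<close>

lemma sign_comp_Sym: "\<sigma> \<in> Sym n \<Longrightarrow> \<tau> \<in> Sym n \<Longrightarrow> sign (\<sigma> \<circ> \<tau>) = sign \<sigma> * sign \<tau>"
  by (rule sign_compose) (auto simp: Sym_iff intro: permutes_imp_permutation[of "{1..n}"])

lemma sign_inv_Sym: "\<sigma> \<in> Sym n \<Longrightarrow> sign (pinv \<sigma>) = sign \<sigma>"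
  by (rule sign_inverse) (auto simp: Sym_iff intro: permutes_imp_permutation[of "{1..n}"])

text \<open>The signed sum over the column group, one of the two factors of a Young symmetrizer.\<close>

definition col_antisym :: "nat \<Rightarrow> (nat \<times> nat \<Rightarrow> nat) \<Rightarrow> (nat list \<Rightarrow>\<^sub>0 complex) \<Rightarrow> (nat list \<Rightarrow>\<^sub>0 complex)" where
  "col_antisym n T y = (\<Sum>\<sigma>\<in>column_group n T. scalev (of_int (sign \<sigma>)) (act \<sigma> y))"

lemma linear_col_antisym: "Vector_Spaces.linear scalev scalev (col_antisym n T)"
proof (rule linearI_scalev)
  fix u v :: "nat list \<Rightarrow>\<^sub>0 complex" and c
  show "col_antisym n T (u + v) = col_antisym n T u + col_antisym n T v"
    by (simp add: col_antisym_def act_add fv.scale_right_distrib sum.distrib)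
  show "col_antisym n T (scalev c u) = scalev c (col_antisym n T u)"
    by (simp add: col_antisym_def act_scale fv.scale_sum_right mult.commute)
qed

lemmas col_antisym_add = fv2.linear_add[OF linear_col_antisym]
  and col_antisym_scale = fv2.linear_scale[OF linear_col_antisym]
  and col_antisym_sum = fv2.linear_sum[OF linear_col_antisym]
  and col_antisym_0 [simp] = fv2.linear_0[OF linear_col_antisym]

lemma col_antisym_perm_module [simp]: "y \<in> perm_module n lam \<Longrightarrow> col_antisym n T y \<in> perm_module n lam"
  unfolding col_antisym_def
  by (rule fv.subspace_sum) (auto simp: column_group_Sym intro: fv.subspace_scale)

lemma sum_column_group_inv:
  assumes "T \<in> tableaux n lam"
  shows "(\<Sum>\<sigma>\<in>column_group n T. f (pinv \<sigma>)) = (\<Sum>\<sigma>\<in>column_group n T. f \<sigma>)"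
  by (rule sum.reindex_bij_witness[of _ pinv pinv])
    (auto simp: column_group_closed[OF assms] dest: column_group_Sym)

lemma sum_column_group_comp:
  assumes T: "T \<in> tableaux n lam" and \<tau>: "\<tau> \<in> column_group n T"
  shows "(\<Sum>\<sigma>\<in>column_group n T. f (\<sigma> \<circ> \<tau>)) = (\<Sum>\<sigma>\<in>column_group n T. f \<sigma>)"
proof (rule sum.reindex_bij_witness[of _ "\<lambda>\<sigma>. \<sigma> \<circ> pinv \<tau>" "\<lambda>\<sigma>. \<sigma> \<circ> \<tau>"])
  have \<tau>': "\<tau> \<in> Sym n"
    using \<tau> by (rule column_group_Sym)
  fix \<sigma> assume \<sigma>: "\<sigma> \<in> column_group n T"
  show "\<sigma> \<circ> \<tau> \<circ> pinv \<tau> = \<sigma>" "\<sigma> \<circ> pinv \<tau> \<circ> \<tau> = \<sigma>"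
    using Sym_inv_simps(4,5)[OF \<tau>'] by (simp_all add: comp_assoc)
  show "\<sigma> \<circ> \<tau> \<in> column_group n T" "\<sigma> \<circ> pinv \<tau> \<in> column_group n T"
    using column_group_closed(2,3)[OF T] \<sigma> \<tau> by blast+
qed simp

text \<open>Invariant sesquilinear forms take the place of equivariant maps: a map \<open>A\<close> corresponds to the
  form \<open>\<langle>A u, v\<rangle>\<close>, and Schur's lemma becomes a statement about numbers.\<close>

definition invariant_form ::
    "nat \<Rightarrow> ((nat list \<Rightarrow>\<^sub>0 complex) \<Rightarrow> (nat list \<Rightarrow>\<^sub>0 complex) \<Rightarrow> complex) \<Rightarrow> bool" where
  "invariant_form n B \<longleftrightarrow>
    (\<forall>u u' v. B (u + u') v = B u v + B u' v) \<and> (\<forall>c u v. B (scalev c u) v = c * B u v) \<and>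
    (\<forall>u v v'. B u (v + v') = B u v + B u v') \<and> (\<forall>c u v. B u (scalev c v) = cnj c * B u v) \<and>
    (\<forall>\<sigma>\<in>Sym n. \<forall>u\<in>word_module n. \<forall>v\<in>word_module n. B (act \<sigma> u) (act \<sigma> v) = B u v)"

context
  fixes n :: nat and B :: "(nat list \<Rightarrow>\<^sub>0 complex) \<Rightarrow> (nat list \<Rightarrow>\<^sub>0 complex) \<Rightarrow> complex"
  assumes B: "invariant_form n B"
begin

lemma form_add_left: "B (u + u') v = B u v + B u' v"
  and form_scale_left: "B (scalev c u) v = c * B u v"
  and form_add_right: "B u (v + v') = B u v + B u v'"
  and form_scale_right: "B u (scalev c v) = cnj c * B u v"
  using B unfolding invariant_form_def by blast+

lemma form_act: "\<sigma> \<in> Sym n \<Longrightarrow> u \<in> word_module n \<Longrightarrow> v \<in> word_module n \<Longrightarrow> B (act \<sigma> u) (act \<sigma> v) = B u v"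
  using B unfolding invariant_form_def by blast

lemma form_zero_left: "B 0 v = 0"
  using form_scale_left[of 0 0 v] by simp

lemma form_zero_right: "B u 0 = 0"
  using form_scale_right[of u 0 0] by simp

lemma form_sum_left: "B (sum f A) v = (\<Sum>a\<in>A. B (f a) v)"
  by (induction A rule: infinite_finite_induct) (auto simp: form_add_left form_zero_left)

lemma form_sum_right: "B u (sum f A) = (\<Sum>a\<in>A. B u (f a))"
  by (induction A rule: infinite_finite_induct) (auto simp: form_add_right form_zero_right)

lemma form_act_left:
  assumes "\<sigma> \<in> Sym n" "u \<in> word_module n" "v \<in> word_module n"
  shows "B (act \<sigma> u) v = B u (act (pinv \<sigma>) v)"
  using form_act[of \<sigma> u "act (pinv \<sigma>) v"] assms by (simp add: act_act)

lemma form_col_antisym: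
  assumes T: "T \<in> tableaux n lam" and "u \<in> word_module n" "v \<in> word_module n"
  shows "B (col_antisym n T u) v = B u (col_antisym n T v)"
proof -
  have "B (col_antisym n T u) v = (\<Sum>\<sigma>\<in>column_group n T. of_int (sign \<sigma>) * B u (act (pinv \<sigma>) v))"
    unfolding col_antisym_def using assms
    by (auto simp: form_sum_left form_scale_left form_act_left dest!: column_group_Sym intro!: sum.cong)
  also have "\<dots> = (\<Sum>\<sigma>\<in>column_group n T. of_int (sign (pinv \<sigma>)) * B u (act (pinv \<sigma>) v))"
    by (intro sum.cong refl) (simp add: sign_inv_Sym[OF column_group_Sym])
  also have "\<dots> = (\<Sum>\<sigma>\<in>column_group n T. of_int (sign \<sigma>) * B u (act \<sigma> v))"
    by (rule sum_column_group_inv[OF T])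
  also have "\<dots> = B u (col_antisym n T v)"
    by (simp add: col_antisym_def form_sum_right form_scale_right)
  finally show ?thesis .
qed

end

lemma invariant_form_ip: "invariant_form n ip"
  unfolding invariant_form_def
  by (auto simp: ip_add_left ip_scale_left ip_add_right ip_scale_right ip_act)

lemmas col_antisym_adjoint = form_col_antisym[OF invariant_form_ip]

lemma col_antisym_act:
  assumes T: "T \<in> tableaux n lam" and \<tau>: "\<tau> \<in> column_group n T" and y: "y \<in> word_module n"
  shows "col_antisym n T (act \<tau> y) = scalev (of_int (sign \<tau>)) (col_antisym n T y)"
proof -
  have "col_antisym n T y = (\<Sum>\<sigma>\<in>column_group n T. scalev (of_int (sign (\<sigma> \<circ> \<tau>))) (act (\<sigma> \<circ> \<tau>) y))"
    unfolding col_antisym_def by (rule sum_column_group_comp[OF T \<tau>, symmetric])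
  also have "\<dots> = (\<Sum>\<sigma>\<in>column_group n T. scalev (of_int (sign \<tau>)) (scalev (of_int (sign \<sigma>)) (act \<sigma> (act \<tau> y))))"
    by (intro sum.cong refl)
      (simp add: sign_comp_Sym[OF column_group_Sym column_group_Sym[OF \<tau>]]
        act_act[OF column_group_Sym column_group_Sym[OF \<tau>] y] mult.commute del: o_apply)
  also have "\<dots> = scalev (of_int (sign \<tau>)) (col_antisym n T (act \<tau> y))"
    unfolding col_antisym_def fv.scale_sum_right ..
  finally have eq: "col_antisym n T y = scalev (of_int (sign \<tau>)) (col_antisym n T (act \<tau> y))" .
  show ?thesis
    by (subst eq) (simp add: fv.scale_scale flip: of_int_mult)
qed

lemma col_antisym_antisym:
  assumes T: "T \<in> tableaux n lam" and y: "y \<in> word_module n"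
  shows "col_antisym n T (col_antisym n T y) = scalev (of_nat (card (column_group n T))) (col_antisym n T y)"
proof -
  have "col_antisym n T (col_antisym n T y) =
      (\<Sum>\<sigma>\<in>column_group n T. scalev (of_int (sign \<sigma>)) (col_antisym n T (act \<sigma> y)))"
    by (subst (2) col_antisym_def) (simp add: col_antisym_sum col_antisym_scale)
  also have "\<dots> = (\<Sum>\<sigma>\<in>column_group n T. scalev 1 (col_antisym n T y))"
    by (intro sum.cong refl) (simp add: col_antisym_act[OF T _ y] flip: of_int_mult)
  also have "\<dots> = scalev (of_nat (card (column_group n T))) (col_antisym n T y)"
    unfolding fv.scale_sum_left[symmetric] by simp
  finally show ?thesis .
qed

text \<open>The transposition of the two positions fixes the word and changes the sign of its
  antisymmetrization.\<close>

lemma col_antisym_repeated_letter: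
  assumes T: "T \<in> tableaux n lam" and w: "w \<in> words n"
    and pq: "p \<in> {1..n}" "q \<in> {1..n}" "p \<noteq> q" "col_of T p = col_of T q" "w ! (p - 1) = w ! (q - 1)"
  shows "col_antisym n T (bvec w) = 0"
proof -
  let ?t = "Transposition.transpose p q"
  have t: "?t \<in> column_group n T"
    by (rule column_group_closed(4)[OF T pq(1,2,4)])
  have "act_word ?t w = w"
    by (rule word_eqI[of _ n])
      (use w pq in \<open>auto simp: act_word_nth Transposition.transpose_def simp del: atLeastAtMost_iff\<close>)
  then have "col_antisym n T (bvec w) = scalev (of_int (sign ?t)) (col_antisym n T (bvec w))"
    using col_antisym_act[OF T t, of "bvec w"] w by simp
  then have "col_antisym n T (bvec w) = - col_antisym n T (bvec w)"
    using pq(3) by (simp add: sign_swap_id)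
  then have "col_antisym n T (bvec w) + col_antisym n T (bvec w) = 0"
    by (metis add.right_inverse)
  then have "scalev 2 (col_antisym n T (bvec w)) = 0"
    using fv.scale_left_distrib[of 1 1 "col_antisym n T (bvec w)"] by simp
  then show ?thesis
    by simp
qed

lemma specht_vector_eq:
  assumes "T \<in> tableaux n lam"
  shows "specht_vector n T = col_antisym n T (bvec (tableau_word n T))"
  unfolding specht_vector_def col_antisym_def
  by (intro sum.cong refl) (simp add: act_word_tableau_word[OF column_group_Sym assms])

lemma act_col_antisym:
  assumes T: "T \<in> tableaux n lam" and \<sigma>: "\<sigma> \<in> Sym n" and y: "y \<in> word_module n"
  shows "act \<sigma> (col_antisym n T y) = col_antisym n (\<sigma> \<circ> T) (act \<sigma> y)"
proof -
  have inj: "inj_on (\<lambda>\<tau>. \<sigma> \<circ> \<tau> \<circ> pinv \<sigma>) (column_group n T)"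
  proof (rule inj_onI)
    fix \<tau> \<tau>' assume "\<sigma> \<circ> \<tau> \<circ> pinv \<sigma> = \<sigma> \<circ> \<tau>' \<circ> pinv \<sigma>"
    then have "pinv \<sigma> ((\<sigma> \<circ> \<tau> \<circ> pinv \<sigma>) (\<sigma> k)) = pinv \<sigma> ((\<sigma> \<circ> \<tau>' \<circ> pinv \<sigma>) (\<sigma> k))" for k
      by simp
    then show "\<tau> = \<tau>'"
      using \<sigma> by (intro ext) simp
  qed
  have "col_antisym n (\<sigma> \<circ> T) (act \<sigma> y) = (\<Sum>\<tau>\<in>column_group n T.
      scalev (of_int (sign (\<sigma> \<circ> \<tau> \<circ> pinv \<sigma>))) (act (\<sigma> \<circ> \<tau> \<circ> pinv \<sigma>) (act \<sigma> y)))"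
    unfolding col_antisym_def column_group_comp[OF T \<sigma>] sum.reindex[OF inj] by (simp only: o_def)
  also have "\<dots> = (\<Sum>\<tau>\<in>column_group n T. scalev (of_int (sign \<tau>)) (act \<sigma> (act \<tau> y)))"
  proof (intro sum.cong refl)
    fix \<tau> assume "\<tau> \<in> column_group n T"
    then have \<tau>: "\<tau> \<in> Sym n" by (rule column_group_Sym)
    have "sign (\<sigma> \<circ> \<tau> \<circ> pinv \<sigma>) = sign \<sigma> * sign \<tau> * sign \<sigma>"
      using sign_comp_Sym[OF comp_Sym[OF \<sigma> \<tau>] inv_Sym[OF \<sigma>]] sign_comp_Sym[OF \<sigma> \<tau>] sign_inv_Sym[OF \<sigma>]
      by simp
    then have s: "sign (\<sigma> \<circ> \<tau> \<circ> pinv \<sigma>) = sign \<tau>"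
      by (simp add: mult.commute mult.left_commute)
    have "\<sigma> \<circ> \<tau> \<circ> pinv \<sigma> \<circ> \<sigma> = \<sigma> \<circ> \<tau>"
      using Sym_inv_simps(5)[OF \<sigma>] by (simp add: comp_assoc)
    then have "act (\<sigma> \<circ> \<tau> \<circ> pinv \<sigma>) (act \<sigma> y) = act \<sigma> (act \<tau> y)"
      using act_act[of "\<sigma> \<circ> \<tau> \<circ> pinv \<sigma>" n \<sigma> y] act_act[OF \<sigma> \<tau> y] \<sigma> \<tau> y by simp
    with s show "scalev (of_int (sign (\<sigma> \<circ> \<tau> \<circ> pinv \<sigma>))) (act (\<sigma> \<circ> \<tau> \<circ> pinv \<sigma>) (act \<sigma> y)) =
        scalev (of_int (sign \<tau>)) (act \<sigma> (act \<tau> y))"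
      by simp
  qed
  also have "\<dots> = act \<sigma> (col_antisym n T y)"
    by (simp add: col_antisym_def act_sum act_scale)
  finally show ?thesis ..
qed

lemma specht_vector_perm_module:
  assumes "lam \<in> partitions_of n" "T \<in> tableaux n lam"
  shows "specht_vector n T \<in> perm_module n lam"
  using assms by (simp add: specht_vector_eq)

lemma tableau_word_words [simp]:
  "lam \<in> partitions_of n \<Longrightarrow> T \<in> tableaux n lam \<Longrightarrow> tableau_word n T \<in> words n"
  using tableau_word_content content_words_words by blast

lemma act_specht_vector:
  assumes "lam \<in> partitions_of n" "T \<in> tableaux n lam" "\<sigma> \<in> Sym n"
  shows "act \<sigma> (specht_vector n T) = specht_vector n (\<sigma> \<circ> T)"
  unfolding specht_vector_eq[OF assms(2)] specht_vector_eq[OF comp_tableaux[OF assms(3,2)]]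
  using assms by (simp add: act_col_antisym act_word_tableau_word)

subsection \<open>Dominance\<close>

definition dominates :: "(nat \<Rightarrow> nat) \<Rightarrow> (nat \<Rightarrow> nat) \<Rightarrow> bool" where
  "dominates lam mu \<longleftrightarrow> (\<forall>k. (\<Sum>i = 1..k. mu i) \<le> (\<Sum>i = 1..k. lam i))"

lemma dominates_antisym:
  assumes "lam \<in> partitions_of n" "mu \<in> partitions_of n" "dominates lam mu" "dominates mu lam"
  shows "lam = mu"
proof
  fix i
  have eq: "(\<Sum>i = 1..k. mu i) = (\<Sum>i = 1..k. lam i)" for k
    using assms(3,4) by (simp add: dominates_def le_antisym)
  show "lam i = mu i"
  proof (cases i)
    case 0
    then show ?thesis
      using assms(1,2) by (simp add: partitions_of_def)
  next
    case (Suc k)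
    then show ?thesis
      using eq[of k] eq[of "Suc k"] by simp
  qed
qed

text \<open>The partial sums in the definition of dominance count the small letters of a word.\<close>

lemma card_letters_le:
  assumes mu: "mu \<in> partitions_of n" and w: "w \<in> content_words n mu"
  shows "card {p \<in> {1..n}. w ! (p - 1) \<le> k} = (\<Sum>i = 1..k. mu i)"
proof -
  have ww: "w \<in> words n" "length w = n"
    using w by (auto simp: content_words_def)
  have "{p \<in> {1..n}. w ! (p - 1) \<le> k} = (\<Union>i\<in>{1..k}. {p \<in> {1..n}. w ! (p - 1) = i})"
    using ww(1) unfolding words_iff by force
  then have "card {p \<in> {1..n}. w ! (p - 1) \<le> k} = (\<Sum>i = 1..k. card {p \<in> {1..n}. w ! (p - 1) = i})"
    by (simp only:) (subst card_UN_disjoint, auto)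
  also have "\<dots> = (\<Sum>i = 1..k. mu i)"
  proof (intro sum.cong refl)
    fix i assume i: "i \<in> {1..k}"
    show "card {p \<in> {1..n}. w ! (p - 1) = i} = mu i"
    proof (cases "i \<le> n")
      case True
      then have "count_list w i = mu i"
        using w i by (simp add: content_words_def)
      then show ?thesis
        using count_list_positions[OF ww(2), of i] by simp
    next
      case False
      then have "{p \<in> {1..n}. w ! (p - 1) = i} = {}"
        using ww(1) unfolding words_iff by force
      moreover have "mu i = 0"
        using False mu by (simp add: partitions_of_def)
      ultimately show ?thesis
        by simp
    qed
  qed
  finally show ?thesis .
qed

text \<open>If no letter of \<open>w\<close> is repeated within a column of \<open>T\<close>, then each column has room for at most
  as many letters \<open>\<le> k\<close> as it has boxes in the first \<open>k\<close> rows.  Summing over the columns compares the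
  content of \<open>w\<close> with the shape of \<open>T\<close>.\<close>

lemma column_letters_le:
  assumes lam: "lam \<in> partitions_of n" and T: "T \<in> tableaux n lam" and w: "w \<in> words n"
    and inj: "\<And>p q. p \<in> {1..n} \<Longrightarrow> q \<in> {1..n} \<Longrightarrow> col_of T p = col_of T q \<Longrightarrow> w ! (p - 1) = w ! (q - 1) \<Longrightarrow> p = q"
  shows "card {p \<in> {1..n}. col_of T p = j \<and> w ! (p - 1) \<le> k} \<le>
    card {p \<in> {1..n}. col_of T p = j \<and> row_of T p \<le> k}" (is "card ?A \<le> card ?B")
proof (cases "\<exists>p\<in>{1..n}. col_of T p = j \<and> row_of T p > k")
  case False
  then have "?A \<subseteq> ?B"
    by (auto simp: not_less)
  then show ?thesis
    by (intro card_mono) auto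
next
  case True
  then obtain p where p: "p \<in> {1..n}" "col_of T p = j" "row_of T p > k"
    by blast
  have box: "(i, j) \<in> diagram lam" if "i \<in> {1..k}" for i
    using diagram_up[OF lam box_of_entry(1)[OF T p(1)], of i] p that by simp
  have "card ?A \<le> card {1..k}"
  proof (rule card_inj_on_le)
    show "inj_on (\<lambda>p. w ! (p - 1)) ?A"
      by (rule inj_onI) (auto intro!: inj)
    show "(\<lambda>p. w ! (p - 1)) ` ?A \<subseteq> {1..k}"
      using w unfolding words_iff by auto
  qed simp
  also have "\<dots> \<le> card ?B"
  proof (rule card_inj_on_le)
    show "inj_on (\<lambda>i. T (i, j)) {1..k}"
      by (rule inj_onI) (metis box prod.inject tableau_inj[OF T])
    show "(\<lambda>i. T (i, j)) ` {1..k} \<subseteq> ?B"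
    proof (rule image_subsetI)
      fix i assume i: "i \<in> {1..k}"
      show "T (i, j) \<in> ?B"
        using row_col_of_entry[OF T box[OF i]] tableau_entry_in[OF T box[OF i]] i by simp
    qed
  qed simp
  finally show ?thesis .
qed

lemma card_positions_by_column:
  "card {p \<in> {1..n}. R p} = (\<Sum>j\<in>col_of T ` {1..n}. card {p \<in> {1..n}. col_of T p = j \<and> R p})"
proof -
  have "{p \<in> {1..n}. R p} = (\<Union>j\<in>col_of T ` {1..n}. {p \<in> {1..n}. col_of T p = j \<and> R p})"
    by auto
  then show ?thesis
    by (simp only:) (subst card_UN_disjoint, auto)
qed

text \<open>If content and shape agree, the comparison of the columns is an equality in each of them.  For
  \<open>k\<close> the height of a column it says that all letters of the column are row numbers of its boxes; moving
  each entry to the box of its column whose row is its letter is then a column permutation.\<close>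

lemma column_distinct_word:
  assumes lam: "lam \<in> partitions_of n" and mu: "mu \<in> partitions_of n"
    and T: "T \<in> tableaux n lam" and w: "w \<in> content_words n mu"
    and inj: "\<And>p q. p \<in> {1..n} \<Longrightarrow> q \<in> {1..n} \<Longrightarrow> col_of T p = col_of T q \<Longrightarrow> w ! (p - 1) = w ! (q - 1) \<Longrightarrow> p = q"
  shows "dominates lam mu"
    and "mu = lam \<Longrightarrow> \<exists>\<sigma>\<in>column_group n T. w = act_word \<sigma> (tableau_word n T)"
proof -
  have ww: "w \<in> words n"
    using w by (rule content_words_words)
  have le: "card {p \<in> {1..n}. col_of T p = j \<and> w ! (p - 1) \<le> k} \<le>
    card {p \<in> {1..n}. col_of T p = j \<and> row_of T p \<le> k}" for j k
    by (rule column_letters_le[OF lam T ww]) (rule inj)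
  have row: "card {p \<in> {1..n}. row_of T p \<le> k} = (\<Sum>i = 1..k. lam i)" for k
  proof -
    have "{p \<in> {1..n}. row_of T p \<le> k} = {p \<in> {1..n}. tableau_word n T ! (p - 1) \<le> k}"
      by (intro Collect_cong conj_cong refl) (simp only: tableau_word_nth)
    then show ?thesis
      using card_letters_le[OF lam tableau_word_content[OF lam T]] by simp
  qed
  have letters: "(\<Sum>i = 1..k. mu i) =
      (\<Sum>j\<in>col_of T ` {1..n}. card {p \<in> {1..n}. col_of T p = j \<and> w ! (p - 1) \<le> k})" for k
    unfolding card_letters_le[OF mu w, symmetric] by (rule card_positions_by_column)
  have boxes: "(\<Sum>i = 1..k. lam i) =
      (\<Sum>j\<in>col_of T ` {1..n}. card {p \<in> {1..n}. col_of T p = j \<and> row_of T p \<le> k})" for k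
    unfolding row[symmetric] by (rule card_positions_by_column)
  show "dominates lam mu"
    unfolding dominates_def letters boxes by (intro allI sum_mono le)
  assume eq: "mu = lam"
  have same: "card {p \<in> {1..n}. col_of T p = j \<and> w ! (p - 1) \<le> k} =
      card {p \<in> {1..n}. col_of T p = j \<and> row_of T p \<le> k}" if j: "j \<in> col_of T ` {1..n}" for j k
  proof (rule ccontr)
    assume "card {p \<in> {1..n}. col_of T p = j \<and> w ! (p - 1) \<le> k} \<noteq>
      card {p \<in> {1..n}. col_of T p = j \<and> row_of T p \<le> k}"
    then have "card {p \<in> {1..n}. col_of T p = j \<and> w ! (p - 1) \<le> k} <
      card {p \<in> {1..n}. col_of T p = j \<and> row_of T p \<le> k}"
      by (rule le_neq_implies_less[OF le])
    then have "(\<Sum>j\<in>col_of T ` {1..n}. card {p \<in> {1..n}. col_of T p = j \<and> w ! (p - 1) \<le> k}) <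
       (\<Sum>j\<in>col_of T ` {1..n}. card {p \<in> {1..n}. col_of T p = j \<and> row_of T p \<le> k})"
    proof (intro sum_strict_mono_ex1 ballI)
      fix j show "card {p \<in> {1..n}. col_of T p = j \<and> w ! (p - 1) \<le> k} \<le>
        card {p \<in> {1..n}. col_of T p = j \<and> row_of T p \<le> k}"
        by (rule le)
    qed (use j in blast)+
    then show False
      unfolding letters[symmetric] boxes[symmetric] eq by simp
  qed
  have box: "(w ! (p - 1), col_of T p) \<in> diagram lam" if p: "p \<in> {1..n}" for p
  proof -
    \<comment> \<open>\<open>h\<close> is the height of the column of \<open>p\<close>.\<close>
    let ?C = "{q \<in> {1..n}. col_of T q = col_of T p}"
    define h where "h = Max (row_of T ` ?C)"
    have "h \<in> row_of T ` ?C"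
      unfolding h_def using p by (intro Max_in) auto
    then obtain q where q: "q \<in> ?C" "h = row_of T q"
      by blast
    have "?C = {q \<in> {1..n}. col_of T q = col_of T p \<and> row_of T q \<le> h}"
      unfolding h_def by (auto intro!: Max_ge)
    then have "card {q \<in> {1..n}. col_of T q = col_of T p \<and> w ! (q - 1) \<le> h} = card ?C"
      using same[of "col_of T p" h] p by simp
    then have "{q \<in> {1..n}. col_of T q = col_of T p \<and> w ! (q - 1) \<le> h} = ?C"
      by (intro card_subset_eq) auto
    then have "w ! (p - 1) \<le> h"
      using p by blast
    moreover have "w ! (p - 1) \<ge> 1"
      using ww p unfolding words_iff by auto
    moreover have "(h, col_of T p) \<in> diagram lam"
      using box_of_entry(1)[OF T, of q] q by simp
    ultimately show ?thesis
      using diagram_up[OF lam] by blast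
  qed
  define \<rho> where "\<rho> = (\<lambda>p. if p \<in> {1..n} then T (w ! (p - 1), col_of T p) else p)"
  have "inj_on \<rho> {1..n}"
  proof (rule inj_onI)
    fix p q assume pq: "p \<in> {1..n}" "q \<in> {1..n}" "\<rho> p = \<rho> q"
    then have "(w ! (p - 1), col_of T p) = (w ! (q - 1), col_of T q)"
      by (intro tableau_inj[OF T] box) (simp_all add: \<rho>_def)
    then show "p = q"
      by (intro inj[OF pq(1,2)]) simp_all
  qed
  moreover have "\<rho> ` {1..n} \<subseteq> {1..n}"
  proof (rule image_subsetI)
    fix p assume "p \<in> {1..n}"
    then show "\<rho> p \<in> {1..n}"
      using tableau_entry_in[OF T box, of p] by (simp add: \<rho>_def)
  qed
  ultimately have \<rho>: "\<rho> \<in> Sym n"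
    by (rule Sym_of_injection) (auto simp: \<rho>_def)
  have rc: "row_of T (\<rho> p) = w ! (p - 1)" "col_of T (\<rho> p) = col_of T p" if "p \<in> {1..n}" for p
    using row_col_of_entry[OF T box[OF that]] that by (simp_all add: \<rho>_def)
  have "\<rho> \<in> column_group n T"
    unfolding column_group_iff[OF T] using \<rho> rc(2) by blast
  then have "pinv \<rho> \<in> column_group n T"
    by (rule column_group_closed(3)[OF T])
  moreover have "w = act_word (pinv \<rho>) (tableau_word n T)"
  proof (rule word_eqI[of _ n])
    fix k assume k: "k \<in> {1..n}"
    then have "\<rho> k \<in> {1..n}"
      using \<rho> by (simp del: atLeastAtMost_iff)
    then show "w ! (k - 1) = act_word (pinv \<rho>) (tableau_word n T) ! (k - 1)"
      using k \<rho> rc(1)[OF k] tableau_word_nth[of "\<rho> k" n T]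
      by (simp add: act_word_nth del: atLeastAtMost_iff)
  qed (use ww in simp_all)
  ultimately show "\<exists>\<sigma>\<in>column_group n T. w = act_word \<sigma> (tableau_word n T)"
    by blast
qed

lemma col_antisym_not_dominated:
  assumes lam: "lam \<in> partitions_of n" and mu: "mu \<in> partitions_of n"
    and T: "T \<in> tableaux n lam" and dom: "\<not> dominates lam mu" and y: "y \<in> perm_module n mu"
  shows "col_antisym n T y = 0"
  using y
proof (induction rule: perm_module_induct)
  case (step c w y)
  have "col_antisym n T (bvec w) = 0"
  proof (rule ccontr)
    assume "col_antisym n T (bvec w) \<noteq> 0"
    then have "\<And>p q. p \<in> {1..n} \<Longrightarrow> q \<in> {1..n} \<Longrightarrow> col_of T p = col_of T q \<Longrightarrow> w ! (p - 1) = w ! (q - 1) \<Longrightarrow> p = q"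
      using col_antisym_repeated_letter[OF T content_words_words[OF step(1)]] by blast
    then show False
      using column_distinct_word(1)[OF lam mu T step(1)] dom by blast
  qed
  with step show ?case
    by (simp add: col_antisym_add col_antisym_scale)
qed simp

text \<open>A column permutation that also preserves rows is trivial, so the word of \<open>T\<close> occurs in the
  polytabloid of \<open>T\<close> just once.\<close>

lemma ip_specht_vector_word:
  assumes lam: "lam \<in> partitions_of n" and T: "T \<in> tableaux n lam"
  shows "ip (specht_vector n T) (bvec (tableau_word n T)) = 1"
proof -
  have only_id: "\<sigma> = id" if \<sigma>: "\<sigma> \<in> column_group n T" and eq: "tableau_word n (\<sigma> \<circ> T) = tableau_word n T" for \<sigma>
  proof
    fix k
    have \<sigma>': "\<sigma> \<in> Sym n" "\<And>k. k \<in> {1..n} \<Longrightarrow> col_of T (\<sigma> k) = col_of T k"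
      using \<sigma> unfolding column_group_iff[OF T] by blast+
    show "\<sigma> k = id k"
    proof (cases "k \<in> {1..n}")
      case True
      then have \<sigma>k: "\<sigma> k \<in> {1..n}"
        using \<sigma>'(1) by (simp del: atLeastAtMost_iff)
      have "row_of T (\<sigma> k) = row_of (\<sigma> \<circ> T) (\<sigma> k)"
        using tableau_word_nth[OF \<sigma>k] eq by metis
      also have "\<dots> = row_of T k"
        by (rule row_col_of_comp(1)[OF \<sigma>'(1) T True])
      finally show ?thesis
        using box_of_entry(2)[OF T True] box_of_entry(2)[OF T \<sigma>k] \<sigma>'(2)[OF True] by simp
    next
      case False
      then show ?thesis
        using \<sigma>'(1) by (simp add: Sym_iff permutes_def)
    qed
  qed
  have "ip (specht_vector n T) (bvec (tableau_word n T)) =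
      (\<Sum>\<sigma>\<in>column_group n T. of_int (sign \<sigma>) * (1 when tableau_word n (\<sigma> \<circ> T) = tableau_word n T))"
    by (simp add: specht_vector_def ip_sum_left ip_scale_left ip_bvec_right lookup_single lookup_sum)
  also have "\<dots> = (\<Sum>\<sigma>\<in>{id}. of_int (sign \<sigma>) * (1 when tableau_word n (\<sigma> \<circ> T) = tableau_word n T))"
    using only_id column_group_closed(1)[OF T]
    by (intro sum.mono_neutral_right) (auto simp: when_def)
  finally show ?thesis
    by (simp add: sign_id)
qed

text \<open>On \<open>M\<^sup>\<lambda>\<close> the antisymmetrizer of a tableau of shape \<open>\<lambda>\<close> has rank one.  A word with a letter
  repeated in some column is killed and is orthogonal to the polytabloid; every other word is a column
  permutation of the word of \<open>T\<close>, whose sign is both its coefficient in the polytabloid and the factor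
  by which its antisymmetrization differs from the polytabloid.\<close>

lemma col_antisym_perm_module_eq:
  assumes lam: "lam \<in> partitions_of n" and T: "T \<in> tableaux n lam" and y: "y \<in> perm_module n lam"
  shows "col_antisym n T y = scalev (ip y (specht_vector n T)) (specht_vector n T)"
  using y
proof (induction rule: perm_module_induct)
  case (step c w y)
  note w = content_words_words[OF step(1)]
  let ?t = "bvec (tableau_word n T)"
  have t: "?t \<in> word_module n"
    using lam T by simp
  note s = specht_vector_eq[OF T]
  have "col_antisym n T (bvec w) = scalev (ip (bvec w) (specht_vector n T)) (specht_vector n T)"
  proof (cases "\<exists>p q. p \<in> {1..n} \<and> q \<in> {1..n} \<and> p \<noteq> q \<and> col_of T p = col_of T q \<and> w ! (p - 1) = w ! (q - 1)")
    case True
    then have 0: "col_antisym n T (bvec w) = 0"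
      using col_antisym_repeated_letter[OF T w] by blast
    have "ip (bvec w) (specht_vector n T) = ip (col_antisym n T (bvec w)) ?t"
      unfolding s using col_antisym_adjoint[OF T _ t] w by simp
    with 0 show ?thesis
      by simp
  next
    case False
    then obtain \<sigma> where \<sigma>: "\<sigma> \<in> column_group n T" "w = act_word \<sigma> (tableau_word n T)"
      using column_distinct_word(2)[OF lam lam T step(1)] by blast
    have a: "col_antisym n T (bvec w) = scalev (of_int (sign \<sigma>)) (specht_vector n T)"
      using col_antisym_act[OF T \<sigma>(1) t] s \<sigma>(2) by simp
    have "ip (bvec w) (specht_vector n T) = ip (col_antisym n T (bvec w)) ?t"
      unfolding s using col_antisym_adjoint[OF T _ t] w by simp
    also have "\<dots> = of_int (sign \<sigma>)"
      unfolding a by (simp add: ip_scale_left ip_specht_vector_word[OF lam T])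
    finally show ?thesis
      using a by simp
  qed
  with step show ?case
    by (simp add: col_antisym_add col_antisym_scale ip_add_left ip_scale_left fv.scale_left_distrib)
qed simp

subsection \<open>The span of all polytabloids\<close>

text \<open>All tableaux are admitted here, which makes the invariance under permutations evident.  That
  the standard ones suffice is \<open>specht_eq_full_specht\<close> below.\<close>

definition full_specht :: "nat \<Rightarrow> (nat \<Rightarrow> nat) \<Rightarrow> (nat list \<Rightarrow>\<^sub>0 complex) set" where
  "full_specht n lam = fv.span (specht_vector n ` tableaux n lam)"

lemma subspace_full_specht [simp]: "fv.subspace (full_specht n lam)"
  by (simp add: full_specht_def)

lemma specht_vector_full_specht [simp]: "T \<in> tableaux n lam \<Longrightarrow> specht_vector n T \<in> full_specht n lam"
  unfolding full_specht_def by (intro fv.span_base imageI)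

lemma full_specht_perm_module:
  assumes "lam \<in> partitions_of n"
  shows "full_specht n lam \<subseteq> perm_module n lam"
  unfolding full_specht_def
  by (intro fv.span_minimal) (auto simp: specht_vector_perm_module[OF assms])

lemma full_specht_word_module:
  assumes "lam \<in> partitions_of n" "x \<in> full_specht n lam"
  shows "x \<in> word_module n"
  using full_specht_perm_module[OF assms(1)] perm_module_word_module assms(2) by blast

lemma fin_dim_word_submodule:
  assumes "fv.subspace U" "U \<subseteq> word_module n"
  shows "fin_dim_subspace U"
  by (rule subspace_of_fin_dim[OF assms(1) assms(2)[unfolded word_module_def]]) simp

lemma fin_dim_full_specht [simp]:
  assumes "lam \<in> partitions_of n"
  shows "fin_dim_subspace (full_specht n lam)"
  using full_specht_word_module[OF assms] by (intro fin_dim_word_submodule[of _ n]) auto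

lemma full_specht_induct [consumes 1, case_names zero step]:
  assumes "v \<in> full_specht n lam" "R 0"
    "\<And>c T y. T \<in> tableaux n lam \<Longrightarrow> y \<in> full_specht n lam \<Longrightarrow> R y \<Longrightarrow> R (scalev c (specht_vector n T) + y)"
  shows "R v"
  using assms unfolding full_specht_def by (rule span_image_induct)

lemma act_full_specht [simp]:
  assumes lam: "lam \<in> partitions_of n" and \<sigma>: "\<sigma> \<in> Sym n" and v: "v \<in> full_specht n lam"
  shows "act \<sigma> v \<in> full_specht n lam"
  using v
proof (induction rule: full_specht_induct)
  case zero
  then show ?case
    by (simp add: fv.subspace_0)
next
  case (step c T y)
  have "act \<sigma> (specht_vector n T) \<in> full_specht n lam"
    unfolding act_specht_vector[OF lam step(1) \<sigma>] using step(1) \<sigma> by simp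
  with step show ?case
    by (auto simp: act_add act_scale intro!: fv.subspace_add fv.subspace_scale)
qed

lemma full_specht_separated:
  assumes "x \<in> full_specht n lam" "x \<noteq> 0"
  obtains T where "T \<in> tableaux n lam" "ip x (specht_vector n T) \<noteq> 0"
proof -
  have "\<exists>T\<in>tableaux n lam. ip x (specht_vector n T) \<noteq> 0"
  proof (rule ccontr)
    assume *: "\<not> (\<exists>T\<in>tableaux n lam. ip x (specht_vector n T) \<noteq> 0)"
    have "ip x x = 0"
      using assms(1) unfolding full_specht_def by (rule ip_span_right) (use * in auto)
    with assms(2) show False
      by simp
  qed
  with that show ?thesis
    by blast
qed

lemma specht_vector_nonzero:
  assumes "lam \<in> partitions_of n" "T \<in> tableaux n lam"
  shows "specht_vector n T \<noteq> 0"
  using ip_specht_vector_word[OF assms] by auto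

section \<open>Schur orthogonality\<close>

context
  fixes n :: nat and B :: "(nat list \<Rightarrow>\<^sub>0 complex) \<Rightarrow> (nat list \<Rightarrow>\<^sub>0 complex) \<Rightarrow> complex"
  assumes B: "invariant_form n B"
begin

text \<open>A polytabloid is an antisymmetrized word, and the antisymmetrizer can be moved to the other
  argument of the form, which it kills unless its own shape dominates the other one.  Different shapes
  cannot dominate each other in both directions.\<close>

lemma form_different_shapes:
  assumes lam: "lam \<in> partitions_of n" and mu: "mu \<in> partitions_of n" and ne: "lam \<noteq> mu"
    and x: "x \<in> full_specht n lam" and y: "y \<in> full_specht n mu"
  shows "B x y = 0"
proof (cases "dominates lam mu")
  case False
  have "B (specht_vector n T) y = 0" if T: "T \<in> tableaux n lam" for T
    unfolding specht_vector_eq[OF T]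
    using form_col_antisym[OF B T, of "bvec (tableau_word n T)" y] T lam
      full_specht_word_module[OF mu y] full_specht_perm_module[OF mu] y
      col_antisym_not_dominated[OF lam mu T False, of y] by (auto simp: form_zero_right[OF B])
  with x show ?thesis
    by (induction rule: full_specht_induct) (auto simp: form_zero_left[OF B] form_add_left[OF B] form_scale_left[OF B])
next
  case True
  then have dom: "\<not> dominates mu lam"
    using dominates_antisym[OF lam mu] ne by blast
  have "B x (specht_vector n T) = 0" if T: "T \<in> tableaux n mu" for T
    unfolding specht_vector_eq[OF T]
    using form_col_antisym[OF B T, of x "bvec (tableau_word n T)"] T mu
      full_specht_word_module[OF lam x] full_specht_perm_module[OF lam] x
      col_antisym_not_dominated[OF mu lam T dom, of x] by (auto simp: form_zero_left[OF B])
  with y show ?thesis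
    by (induction rule: full_specht_induct) (auto simp: form_zero_right[OF B] form_add_right[OF B] form_scale_right[OF B])
qed

text \<open>Moving the antisymmetrizer of \<open>s(T)\<close> to the other argument \<open>y\<close> turns \<open>y\<close> into the multiple
  \<open>\<langle>y, s(T)\<rangle> s(T)\<close>.  The remaining factor, the value of the form on the word of \<open>T\<close> and \<open>s(T)\<close>, is the same
  for all \<open>T\<close>, because permutations act transitively on the tableaux of a shape.\<close>

lemma form_same_shape:
  assumes lam: "lam \<in> partitions_of n"
  obtains K where "\<And>x y. x \<in> full_specht n lam \<Longrightarrow> y \<in> full_specht n lam \<Longrightarrow> B x y = K * ip x y"
proof (cases "tableaux n lam = {}")
  case True
  then have "full_specht n lam = {0}"
    by (simp add: full_specht_def)
  then show ?thesis
    using that[of 0] by (simp add: form_zero_left[OF B])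
next
  case False
  then obtain T0 where T0: "T0 \<in> tableaux n lam"
    by blast
  define K where "K = B (bvec (tableau_word n T0)) (specht_vector n T0)"
  have K: "B (bvec (tableau_word n T)) (specht_vector n T) = K" if T: "T \<in> tableaux n lam" for T
  proof -
    obtain \<sigma> where \<sigma>: "\<sigma> \<in> Sym n" "T = \<sigma> \<circ> T0"
      using tableaux_transitive[OF T0 T] .
    have "bvec (tableau_word n T) = act \<sigma> (bvec (tableau_word n T0))"
      "specht_vector n T = act \<sigma> (specht_vector n T0)"
      unfolding \<sigma>(2) act_specht_vector[OF lam T0 \<sigma>(1)] by (simp_all add: act_word_tableau_word[OF \<sigma>(1) T0])
    then show ?thesis
      unfolding K_def
      using form_act[OF B \<sigma>(1), of "bvec (tableau_word n T0)" "specht_vector n T0"] lam T0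
        full_specht_word_module[OF lam specht_vector_full_specht[OF T0]] by simp
  qed
  have gen: "B (specht_vector n T) y = K * ip (specht_vector n T) y"
    if T: "T \<in> tableaux n lam" and y: "y \<in> full_specht n lam" for T y
  proof -
    have y': "y \<in> word_module n" "y \<in> perm_module n lam"
      using full_specht_word_module[OF lam y] full_specht_perm_module[OF lam] y by auto
    have "B (specht_vector n T) y = B (bvec (tableau_word n T)) (col_antisym n T y)"
      using form_col_antisym[OF B T, of "bvec (tableau_word n T)" y] y'(1) lam T
      by (simp add: specht_vector_eq[OF T])
    also have "\<dots> = cnj (ip y (specht_vector n T)) * K"
      unfolding col_antisym_perm_module_eq[OF lam T y'(2)] form_scale_right[OF B] K[OF T] ..
    also have "\<dots> = K * ip (specht_vector n T) y"
      by (subst ip_commute[of "specht_vector n T"]) simp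
    finally show ?thesis .
  qed
  have "B x y = K * ip x y" if "x \<in> full_specht n lam" "y \<in> full_specht n lam" for x y
    using that(1)
    by (induction rule: full_specht_induct)
      (auto simp: form_zero_left[OF B] form_add_left[OF B] form_scale_left[OF B] ip_add_left ip_scale_left gen that(2) algebra_simps)
  then show ?thesis
    by (rule that)
qed

end

subsection \<open>Matrix coefficients\<close>

text \<open>Matrix coefficients are vectors of the free space over the permutations, so that its inner product
  and its dimension are at hand.\<close>

definition mcoef :: "nat \<Rightarrow> (nat list \<Rightarrow>\<^sub>0 complex) \<Rightarrow> (nat list \<Rightarrow>\<^sub>0 complex) \<Rightarrow> ((nat \<Rightarrow> nat) \<Rightarrow>\<^sub>0 complex)" where
  "mcoef n x v = (\<Sum>\<sigma>\<in>Sym n. scalev (ip (act \<sigma> x) v) (bvec \<sigma>))"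

lemma lookup_mcoef: "Poly_Mapping.lookup (mcoef n x v) \<sigma> = (if \<sigma> \<in> Sym n then ip (act \<sigma> x) v else 0)"
proof -
  have "Poly_Mapping.lookup (mcoef n x v) \<sigma> = (\<Sum>\<tau>\<in>Sym n. if \<tau> = \<sigma> then ip (act \<tau> x) v else 0)"
    by (simp add: mcoef_def lookup_sum lookup_single when_def if_distrib cong: if_cong)
  then show ?thesis
    by simp
qed

lemma ip_mcoef: "ip (mcoef n x v) (mcoef n y v') = (\<Sum>\<sigma>\<in>Sym n. ip (act \<sigma> x) v * cnj (ip (act \<sigma> y) v'))"
proof -
  have "Poly_Mapping.keys (mcoef n x v) \<subseteq> Sym n"
    by (auto simp: in_keys_iff lookup_mcoef split: if_splits)
  then show ?thesis
    by (simp add: ip_superset[where A = "Sym n"] lookup_mcoef)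
qed

lemma invariant_form_mcoef: "invariant_form n (\<lambda>x y. ip (mcoef n x v) (mcoef n y v'))"
  unfolding invariant_form_def ip_mcoef
proof (intro conjI allI ballI)
  fix \<tau> x y assume a: "\<tau> \<in> Sym n" "x \<in> word_module n" "y \<in> word_module n"
  have "(\<Sum>\<sigma>\<in>Sym n. ip (act \<sigma> (act \<tau> x)) v * cnj (ip (act \<sigma> (act \<tau> y)) v')) =
      (\<Sum>\<sigma>\<in>Sym n. ip (act (\<sigma> \<circ> \<tau>) x) v * cnj (ip (act (\<sigma> \<circ> \<tau>) y) v'))"
    by (intro sum.cong refl) (simp add: act_act[OF _ a(1,2)] act_act[OF _ a(1,3)])
  also have "\<dots> = (\<Sum>\<sigma>\<in>Sym n. ip (act \<sigma> x) v * cnj (ip (act \<sigma> y) v'))"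
    by (rule sum_Sym_comp_right[OF a(1)])
  finally show "(\<Sum>\<sigma>\<in>Sym n. ip (act \<sigma> (act \<tau> x)) v * cnj (ip (act \<sigma> (act \<tau> y)) v')) =
      (\<Sum>\<sigma>\<in>Sym n. ip (act \<sigma> x) v * cnj (ip (act \<sigma> y) v'))" .
qed (simp_all add: act_add act_scale ip_add_left ip_scale_left distrib_left distrib_right sum.distrib
    sum_distrib_left mult.assoc mult.left_commute)

text \<open>Substituting \<open>\<sigma>\<inverse>\<close> for \<open>\<sigma>\<close> exchanges the roles of the two arguments, so that orthogonality in the
  second argument follows from orthogonality in the first.\<close>

lemma mcoef_swap:
  assumes "x \<in> word_module n" "v \<in> word_module n" "y \<in> word_module n" "v' \<in> word_module n"
  shows "ip (mcoef n x v) (mcoef n y v') = ip (mcoef n v' y) (mcoef n v x)"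
proof -
  have *: "ip (act \<sigma> a) b = cnj (ip (act (pinv \<sigma>) b) a)"
    if "\<sigma> \<in> Sym n" "a \<in> word_module n" "b \<in> word_module n" for \<sigma> a b
    unfolding ip_act_left[OF that] by (rule ip_commute)
  have "ip (mcoef n x v) (mcoef n y v') =
      (\<Sum>\<sigma>\<in>Sym n. ip (act (pinv \<sigma>) v') y * cnj (ip (act (pinv \<sigma>) v) x))"
    unfolding ip_mcoef
  proof (intro sum.cong refl)
    fix \<sigma> assume "\<sigma> \<in> Sym n"
    then show "ip (act \<sigma> x) v * cnj (ip (act \<sigma> y) v') = ip (act (pinv \<sigma>) v') y * cnj (ip (act (pinv \<sigma>) v) x)"
      using *[of \<sigma> x v] *[of \<sigma> y v'] assms by simp
  qed
  also have "\<dots> = ip (mcoef n v' y) (mcoef n v x)"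
    unfolding ip_mcoef by (rule sum_Sym_inv)
  finally show ?thesis .
qed

lemma mcoef_different_shapes:
  assumes "lam \<in> partitions_of n" "mu \<in> partitions_of n" "lam \<noteq> mu"
    "x \<in> full_specht n lam" "y \<in> full_specht n mu"
  shows "ip (mcoef n x v) (mcoef n y v') = 0"
  by (rule form_different_shapes[OF invariant_form_mcoef assms])

lemma mcoef_orthogonal_left:
  assumes lam: "lam \<in> partitions_of n" and "x \<in> full_specht n lam" "y \<in> full_specht n lam" "ip x y = 0"
  shows "ip (mcoef n x v) (mcoef n y v') = 0"
proof -
  obtain K where "\<And>x y. x \<in> full_specht n lam \<Longrightarrow> y \<in> full_specht n lam \<Longrightarrow>
      ip (mcoef n x v) (mcoef n y v') = K * ip x y"
    using form_same_shape[OF invariant_form_mcoef lam] by metis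
  with assms show ?thesis
    by simp
qed

lemma mcoef_orthogonal_right:
  assumes lam: "lam \<in> partitions_of n" and "x \<in> full_specht n lam" "y \<in> full_specht n lam"
    and "v \<in> full_specht n lam" "v' \<in> full_specht n lam" "ip v v' = 0"
  shows "ip (mcoef n x v) (mcoef n y v') = 0"
proof -
  have "ip v' v = 0"
    using assms(6) ip_commute[of v' v] by simp
  then have "ip (mcoef n v' y) (mcoef n v x) = 0"
    using assms by (intro mcoef_orthogonal_left[OF lam]) auto
  then show ?thesis
    using assms full_specht_word_module[OF lam] by (simp add: mcoef_swap)
qed

lemma mcoef_orthogonal:
  assumes P: "lam \<in> partitions_of n" "mu \<in> partitions_of n"
    and F: "x \<in> full_specht n lam" "v \<in> full_specht n lam" "y \<in> full_specht n mu" "v' \<in> full_specht n mu"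
    and o: "lam = mu \<Longrightarrow> ip x y = 0 \<or> ip v v' = 0"
  shows "ip (mcoef n x v) (mcoef n y v') = 0"
proof (cases "lam = mu")
  case True
  from o[OF True] show ?thesis
  proof
    assume "ip x y = 0"
    then show ?thesis
      using F True by (intro mcoef_orthogonal_left[OF P(1)]) auto
  next
    assume "ip v v' = 0"
    then show ?thesis
      using F True by (intro mcoef_orthogonal_right[OF P(1)]) auto
  qed
qed (rule mcoef_different_shapes[OF P _ F(1,3)])

text \<open>If all \<open>\<langle>\<sigma> x, v\<rangle>\<close> vanish, then so do their signed sums over cosets of a column group.  By the
  rank-one property these are multiples of \<open>\<langle>s(T), v\<rangle>\<close>, with a factor that is nonzero for a suitable
  tableau, so \<open>v\<close> is orthogonal to all polytabloids.\<close>

lemma mcoef_nonzero: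
  assumes lam: "lam \<in> partitions_of n" and x: "x \<in> full_specht n lam" "x \<noteq> 0"
    and v: "v \<in> full_specht n lam" "v \<noteq> 0"
  shows "mcoef n x v \<noteq> 0"
proof
  assume "mcoef n x v = 0"
  then have 0: "ip (act \<sigma> x) v = 0" if "\<sigma> \<in> Sym n" for \<sigma>
    using lookup_mcoef[of n x v \<sigma>] that by simp
  note xw = full_specht_word_module[OF lam x(1)] and vw = full_specht_word_module[OF lam v(1)]
  obtain T0 where T0: "T0 \<in> tableaux n lam" "ip x (specht_vector n T0) \<noteq> 0"
    using full_specht_separated[OF x] .
  obtain T where T: "T \<in> tableaux n lam" "ip v (specht_vector n T) \<noteq> 0"
    using full_specht_separated[OF v] .
  obtain \<tau> where \<tau>: "\<tau> \<in> Sym n" "T = \<tau> \<circ> T0"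
    using tableaux_transitive[OF T0(1) T(1)] .
  have "ip (act \<tau> (col_antisym n T0 x)) v = 0"
    unfolding col_antisym_def act_sum act_scale ip_sum_left ip_scale_left
    by (rule sum.neutral) (auto simp: act_act[OF \<tau>(1) column_group_Sym xw] 0 \<tau>(1) column_group_Sym)
  moreover have "col_antisym n T0 x = scalev (ip x (specht_vector n T0)) (specht_vector n T0)"
    using x(1) full_specht_perm_module[OF lam] by (intro col_antisym_perm_module_eq[OF lam T0(1)]) auto
  ultimately have "ip (specht_vector n T) v = 0"
    using T0(2) act_specht_vector[OF lam T0(1) \<tau>(1)] by (simp add: act_scale ip_scale_left \<tau>(2))
  then show False
    using T(2) ip_commute[of v "specht_vector n T"] by simp
qed

text \<open>The matrix coefficients of the pairs in \<open>C lam\<close>, for all \<open>lam\<close>, are pairwise orthogonal and lie in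
  a space of dimension \<open>n!\<close>.\<close>

lemma mcoef_family_card:
  fixes C :: "(nat \<Rightarrow> nat) \<Rightarrow> (nat list \<Rightarrow>\<^sub>0 complex) set"
  assumes "finite L" "L \<subseteq> partitions_of n"
    and C: "\<And>lam. lam \<in> L \<Longrightarrow> finite (C lam)" "\<And>lam. lam \<in> L \<Longrightarrow> orthogonal_set (C lam)"
      "\<And>lam. lam \<in> L \<Longrightarrow> C lam \<subseteq> full_specht n lam"
  shows "(\<Sum>lam\<in>L. (card (C lam))\<^sup>2) \<le> fact n"
proof -
  define E where "E = (SIGMA lam:L. C lam \<times> C lam)"
  define f where "f = (\<lambda>(lam :: nat \<Rightarrow> nat, x, v). mcoef n x v)"
  have finE: "finite E"
    unfolding E_def using assms(1) C(1) by (intro finite_SigmaI) auto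
  have nz: "f e \<noteq> 0" if "e \<in> E" for e
  proof -
    obtain lam x v where e: "e = (lam, x, v)" by (cases e)
    show ?thesis
      unfolding e f_def prod.case
      by (rule mcoef_nonzero[of lam])
        (use that e assms(2) C(2,3)[of lam] in \<open>auto simp: E_def orthogonal_set_def\<close>)
  qed
  have orth: "ip (f e) (f e') = 0" if e: "e \<in> E" "e' \<in> E" "e \<noteq> e'" for e e'
  proof -
    obtain lam x v where e1: "e = (lam, x, v)" by (cases e)
    obtain mu y v' where e2: "e' = (mu, y, v')" by (cases e')
    have m: "lam \<in> L" "mu \<in> L" "x \<in> C lam" "v \<in> C lam" "y \<in> C mu" "v' \<in> C mu"
      using e e1 e2 by (auto simp: E_def)
    have P: "lam \<in> partitions_of n" "mu \<in> partitions_of n"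
      using m assms(2) by auto
    have F: "x \<in> full_specht n lam" "v \<in> full_specht n lam" "y \<in> full_specht n mu" "v' \<in> full_specht n mu"
      using m C(3) by blast+
    have "ip (mcoef n x v) (mcoef n y v') = 0"
    proof (rule mcoef_orthogonal[OF P F])
      assume "lam = mu"
      then show "ip x y = 0 \<or> ip v v' = 0"
        using C(2)[OF m(1)] m e(3) e1 e2 by (auto simp: orthogonal_set_def)
    qed
    then show ?thesis
      by (simp add: f_def e1 e2)
  qed
  have inj: "inj_on f E"
  proof (rule inj_onI, rule ccontr)
    fix e e' assume "e \<in> E" "e' \<in> E" "f e = f e'" "e \<noteq> e'"
    then have "ip (f e) (f e) = 0"
      using orth[of e e'] by simp
    then show False
      using nz[OF \<open>e \<in> E\<close>] by simp
  qed
  have "orthogonal_set (f ` E)"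
    unfolding orthogonal_set_def
  proof (intro conjI ballI impI)
    show "0 \<notin> f ` E"
      using nz by (metis imageE)
    fix x y assume "x \<in> f ` E" "y \<in> f ` E" and ne: "x \<noteq> y"
    then obtain e e' where "e \<in> E" "x = f e" "e' \<in> E" "y = f e'"
      by blast
    then show "ip x y = 0"
      using orth[of e e'] ne by blast
  qed
  then have ind: "fv.independent (f ` E)"
    using finE by (intro orthogonal_set_independent) auto
  have "f ` E \<subseteq> fv.span (bvec ` Sym n)"
    unfolding span_bvec
    by (auto simp: f_def in_keys_iff lookup_mcoef split: if_splits)
  then have "card (f ` E) \<le> card (bvec ` Sym n :: ((nat \<Rightarrow> nat) \<Rightarrow>\<^sub>0 complex) set)"
    using fv.independent_span_bound[OF finite_imageI[OF finite_Sym] ind] by blast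
  also have "\<dots> \<le> fact n"
    using card_image_le[OF finite_Sym, of bvec n] by (simp add: card_Sym)
  also have "card (f ` E) = card E"
    by (rule card_image[OF inj])
  also have "\<dots> = (\<Sum>lam\<in>L. (card (C lam))\<^sup>2)"
    unfolding E_def using assms(1) C(1) by (subst card_SigmaI) (auto simp: card_cartesian_product power2_eq_square)
  finally show ?thesis .
qed

section \<open>Young's lattice and the number of pairs of standard tableaux\<close>

lemma finite_diagram:
  assumes "lam \<in> partitions_of n"
  shows "finite (diagram lam)"
proof (rule finite_subset)
  show "diagram lam \<subseteq> (SIGMA i:{1..n}. {1..lam i})"
    using diagram_row_le[OF assms] by (auto simp: diagram_def)
qed simp

lemma finite_tableaux:
  assumes "lam \<in> partitions_of n"
  shows "finite (tableaux n lam)"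
proof (rule finite_subset)
  show "tableaux n lam \<subseteq> {T. \<forall>b. (b \<in> diagram lam \<longrightarrow> T b \<in> {1..n}) \<and> (b \<notin> diagram lam \<longrightarrow> T b = 0)}"
    using tableau_entry_in tableau_outside by blast
  show "finite {T. \<forall>b. (b \<in> diagram lam \<longrightarrow> T b \<in> {1..n}) \<and> (b \<notin> diagram lam \<longrightarrow> T b = (0::nat))}"
    by (rule finite_set_of_finite_funs) (auto simp: finite_diagram[OF assms])
qed

lemma SYT_tableaux: "T \<in> SYT n lam \<Longrightarrow> T \<in> tableaux n lam"
  by (simp add: SYT_def)

lemma finite_SYT: "lam \<in> partitions_of n \<Longrightarrow> finite (SYT n lam)"
  by (rule finite_subset[OF _ finite_tableaux]) (auto simp: SYT_def)

text \<open>The number \<open>n\<close>, as a bound for the rows, can be replaced by any larger number.  This puts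
  partitions of \<open>n\<close> and of \<open>n + 1\<close> on an equal footing.\<close>

lemma partitions_of_alt:
  assumes "n \<le> N"
  shows "lam \<in> partitions_of n \<longleftrightarrow> lam 0 = 0 \<and> (\<forall>i\<ge>1. lam (Suc i) \<le> lam i) \<and> (\<forall>i>N. lam i = 0) \<and>
    (\<Sum>i = 1..N. lam i) = n" (is "_ \<longleftrightarrow> ?R")
proof
  assume lam: "lam \<in> partitions_of n"
  then have "(\<Sum>i = 1..n. lam i) = (\<Sum>i = 1..N. lam i)"
    using assms by (intro sum.mono_neutral_left) (auto simp: partitions_of_def)
  with lam assms show ?R
    by (simp add: partitions_of_def)
next
  assume R: ?R
  have dec: "lam i' \<le> lam i" if "1 \<le> i" "i \<le> i'" for i i'
    using that(2,1)
  proof (induction i' rule: dec_induct)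
    case (step k)
    then show ?case
      using R by (auto intro: order_trans)
  qed simp
  have zero: "lam i = 0" if i: "i > n" for i
  proof (rule ccontr)
    assume "lam i \<noteq> 0"
    then have iN: "i \<le> N"
      using R not_less by blast
    have "i = (\<Sum>k = 1..i. 1)"
      by simp
    also have "\<dots> \<le> (\<Sum>k = 1..i. lam k)"
      using dec[of _ i] \<open>lam i \<noteq> 0\<close> by (intro sum_mono) (fastforce simp: Suc_le_eq)
    also have "\<dots> \<le> (\<Sum>k = 1..N. lam k)"
      using iN by (intro sum_mono2) auto
    also have "\<dots> = n"
      using R by simp
    finally show False
      using i by simp
  qed
  then have "(\<Sum>i = 1..n. lam i) = (\<Sum>i = 1..N. lam i)"
    using assms by (intro sum.mono_neutral_left) auto
  with R zero show "lam \<in> partitions_of n"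
    by (simp add: partitions_of_def)
qed

lemma finite_partitions_of: "finite (partitions_of n)"
proof (rule finite_subset)
  show "partitions_of n \<subseteq> {lam. \<forall>i. (i \<in> {1..n} \<longrightarrow> lam i \<in> {0..n}) \<and> (i \<notin> {1..n} \<longrightarrow> lam i = 0)}"
  proof (intro subsetI CollectI allI)
    fix lam i assume lam: "lam \<in> partitions_of n"
    have "lam i \<le> n" if "i \<in> {1..n}"
    proof -
      have "lam i \<le> (\<Sum>i = 1..n. lam i)"
        using that by (intro member_le_sum) auto
      with lam show ?thesis
        by (simp add: partitions_of_def)
    qed
    moreover have "lam i = 0" if "i \<notin> {1..n}"
      using that lam by (cases "i = 0") (auto simp: partitions_of_def not_le Suc_le_eq)
    ultimately show "(i \<in> {1..n} \<longrightarrow> lam i \<in> {0..n}) \<and> (i \<notin> {1..n} \<longrightarrow> lam i = 0)"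
      by simp
  qed
  show "finite {lam. \<forall>i. (i \<in> {1..n} \<longrightarrow> lam i \<in> {0..n}) \<and> (i \<notin> {1..n} \<longrightarrow> lam i = (0::nat))}"
    by (rule finite_set_of_finite_funs) auto
qed

subsection \<open>Adding and removing boxes\<close>

definition addable :: "(nat \<Rightarrow> nat) \<Rightarrow> nat set" where
  "addable lam = {a. a \<ge> 1 \<and> (a = 1 \<or> lam a < lam (a - 1))}"

definition removable :: "(nat \<Rightarrow> nat) \<Rightarrow> nat set" where
  "removable lam = {a. a \<ge> 1 \<and> lam (Suc a) < lam a}"

definition add_box :: "(nat \<Rightarrow> nat) \<Rightarrow> nat \<Rightarrow> (nat \<Rightarrow> nat)" where
  "add_box lam a = lam(a := lam a + 1)"

definition remove_box :: "(nat \<Rightarrow> nat) \<Rightarrow> nat \<Rightarrow> (nat \<Rightarrow> nat)" where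
  "remove_box lam a = lam(a := lam a - 1)"

lemma partitions_of_zero: "lam \<in> partitions_of n \<Longrightarrow> lam i \<noteq> 0 \<Longrightarrow> i \<le> n"
  by (rule ccontr) (simp add: partitions_of_def not_le)

lemma removable_le:
  assumes "lam \<in> partitions_of n" "a \<in> removable lam"
  shows "a \<in> {1..n}"
proof -
  have "lam a \<noteq> 0" "1 \<le> a"
    using assms(2) by (auto simp: removable_def)
  then show ?thesis
    using partitions_of_zero[OF assms(1)] by simp
qed

lemma addable_le:
  assumes "lam \<in> partitions_of n" "a \<in> addable lam"
  shows "a \<in> {1..Suc n}"
proof -
  have "lam (a - 1) \<noteq> 0 \<or> a = 1" "1 \<le> a"
    using assms(2) by (auto simp: addable_def)
  moreover have "a - 1 \<le> n" if "lam (a - 1) \<noteq> 0"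
    using partitions_of_zero[OF assms(1) that] .
  ultimately show ?thesis
    by auto
qed

lemma finite_removable [simp]: "lam \<in> partitions_of n \<Longrightarrow> finite (removable lam)"
  using finite_subset[OF subsetI[OF removable_le] finite_atLeastAtMost] .

lemma addable_eq: "addable lam = insert 1 (Suc ` removable lam)"
proof (intro Set.set_eqI iffI)
  fix a assume "a \<in> addable lam"
  then have a: "a = 1 \<or> (a > 1 \<and> lam a < lam (a - 1))"
    by (auto simp: addable_def)
  show "a \<in> insert 1 (Suc ` removable lam)"
  proof (cases "a = 1")
    case False
    with a have "a = Suc (a - 1)" "a - 1 \<in> removable lam"
      by (auto simp: removable_def)
    then show ?thesis
      by blast
  qed simp
qed (auto simp: addable_def removable_def)

lemma finite_addable [simp]: "lam \<in> partitions_of n \<Longrightarrow> finite (addable lam)"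
  by (simp add: addable_eq)

lemma card_addable:
  assumes "lam \<in> partitions_of n"
  shows "card (addable lam) = Suc (card (removable lam))"
proof -
  have "1 \<notin> Suc ` removable lam"
    by (auto simp: removable_def)
  then show ?thesis
    using assms by (simp add: addable_eq card_image)
qed

lemma sum_fun_upd_nat:
  fixes f :: "nat \<Rightarrow> nat"
  assumes "finite A" "a \<in> A"
  shows "sum (f(a := x)) A + f a = sum f A + x"
  using assms by (simp add: sum.remove[of A a] sum.cong[of "A - {a}" _ "f(a := x)" f])

lemma add_box_partition:
  assumes lam: "lam \<in> partitions_of n" and a: "a \<in> addable lam"
  shows "add_box lam a \<in> partitions_of (Suc n)"
proof -
  have L: "lam 0 = 0" "\<And>i. i \<ge> 1 \<Longrightarrow> lam (Suc i) \<le> lam i" "\<And>i. i > Suc n \<Longrightarrow> lam i = 0"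
    "(\<Sum>i = 1..Suc n. lam i) = n"
    using lam[unfolded partitions_of_alt[of n "Suc n" lam, OF le_SucI[OF le_refl]]] by auto
  have aN: "a \<in> {1..Suc n}"
    using addable_le[OF lam a] .
  have "sum (add_box lam a) {1..Suc n} = Suc n"
    using sum_fun_upd_nat[OF finite_atLeastAtMost aN, of lam "lam a + 1"] L(4) by (simp add: add_box_def)
  moreover have "add_box lam a (Suc i) \<le> add_box lam a i" if "i \<ge> 1" for i
    using L(2)[OF that] a that by (auto simp: add_box_def addable_def)
  ultimately show ?thesis
    using L(1,3) aN by (auto simp: partitions_of_alt[of "Suc n" "Suc n"] add_box_def)
qed

lemma remove_box_partition:
  assumes mu: "mu \<in> partitions_of (Suc n)" and a: "a \<in> removable mu"
  shows "remove_box mu a \<in> partitions_of n"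
proof -
  have L: "mu 0 = 0" "\<And>i. i \<ge> 1 \<Longrightarrow> mu (Suc i) \<le> mu i" "\<And>i. i > Suc n \<Longrightarrow> mu i = 0"
    "(\<Sum>i = 1..Suc n. mu i) = Suc n"
    using mu by (auto simp: partitions_of_def)
  have aN: "a \<in> {1..Suc n}"
    using removable_le[OF mu a] .
  have "mu a > 0"
    using a by (simp add: removable_def)
  then have "sum (remove_box mu a) {1..Suc n} = n"
    using sum_fun_upd_nat[OF finite_atLeastAtMost aN, of mu "mu a - 1"] L(4) by (simp add: remove_box_def)
  moreover have "remove_box mu a (Suc i) \<le> remove_box mu a i" if "i \<ge> 1" for i
    using L(2)[OF that] a that by (auto simp: remove_box_def removable_def)
  ultimately show ?thesis
    using L(1,3) aN by (auto simp: partitions_of_alt[of n "Suc n"] remove_box_def)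
qed

lemma removable_add_box: "lam \<in> partitions_of n \<Longrightarrow> a \<in> addable lam \<Longrightarrow> a \<in> removable (add_box lam a)"
  by (auto simp: removable_def add_box_def addable_def partitions_of_def less_Suc_eq_le)

lemma addable_remove_box: "lam \<in> partitions_of n \<Longrightarrow> a \<in> removable lam \<Longrightarrow> a \<in> addable (remove_box lam a)"
proof -
  assume lam: "lam \<in> partitions_of n" and a: "a \<in> removable lam"
  have "lam a \<le> lam (a - 1)" if "a \<noteq> 1"
  proof (rule partitions_of_decreasing[OF lam])
    show "1 \<le> a - 1"
      using a that unfolding removable_def by auto
  qed simp
  with a show ?thesis
    by (cases "a = 1") (auto simp: removable_def addable_def remove_box_def)
qed

lemma remove_add_box [simp]: "remove_box (add_box lam a) a = lam"
  by (simp add: remove_box_def add_box_def)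

lemma add_remove_box: "a \<in> removable lam \<Longrightarrow> add_box (remove_box lam a) a = lam"
  by (auto simp: remove_box_def add_box_def removable_def)

lemma add_remove_commute: "a \<noteq> b \<Longrightarrow> remove_box (add_box lam a) b = add_box (remove_box lam b) a"
  by (simp add: remove_box_def add_box_def fun_upd_twist)

lemma add_remove_exchange:
  assumes lam: "lam \<in> partitions_of n" and ne: "a \<noteq> b"
  shows "a \<in> addable lam \<and> b \<in> removable (add_box lam a) \<longleftrightarrow>
    b \<in> removable lam \<and> a \<in> addable (remove_box lam b)"
proof (cases a)
  case 0
  then show ?thesis
    by (simp add: addable_def)
next
  case (Suc c)
  then show ?thesis
    using ne by (cases "b = c")
      (auto simp: addable_def removable_def add_box_def remove_box_def One_nat_def)
qed

lemma diagram_add_box: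
  assumes "a \<ge> 1"
  shows "diagram (add_box lam a) = insert (a, Suc (lam a)) (diagram lam)" "(a, Suc (lam a)) \<notin> diagram lam"
  using assms by (auto simp: diagram_def add_box_def split: if_splits)

lemma tableaux_extend:
  assumes a1: "a \<ge> 1" and T: "T \<in> tableaux n lam"
  shows "T((a, Suc (lam a)) := Suc n) \<in> tableaux (Suc n) (add_box lam a)"
proof -
  note D = diagram_add_box[OF a1, of lam]
  let ?T = "T((a, Suc (lam a)) := Suc n)"
  have bij: "bij_betw T (diagram lam) {1..n}" and out: "\<And>b. b \<notin> diagram lam \<Longrightarrow> T b = 0"
    using T unfolding tableaux_def by blast+
  have "bij_betw ?T (diagram lam) {1..n} \<longleftrightarrow> bij_betw T (diagram lam) {1..n}"
    by (rule bij_betw_cong) (use D(2) in auto)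
  with bij have "bij_betw ?T (diagram lam) {1..n}"
    by blast
  then have "bij_betw ?T (insert (a, Suc (lam a)) (diagram lam)) (insert (Suc n) {1..n})"
    using D(2) notIn_Un_bij_betw[of "(a, Suc (lam a))" "diagram lam" ?T "{1..n}"] by simp
  then show "?T \<in> tableaux (Suc n) (add_box lam a)"
    using out by (auto simp: tableaux_def D(1) atLeastAtMostSuc_conv)
qed

lemma SYT_extend:
  assumes lam: "lam \<in> partitions_of n" and a: "a \<in> addable lam" and T: "T \<in> SYT n lam"
  shows "T((a, Suc (lam a)) := Suc n) \<in> SYT (Suc n) (add_box lam a)"
proof -
  have a1: "a \<ge> 1"
    using a by (simp add: addable_def)
  note D = diagram_add_box[OF a1, of lam]
  let ?T = "T((a, Suc (lam a)) := Suc n)"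
  have tab: "?T \<in> tableaux (Suc n) (add_box lam a)"
    by (rule tableaux_extend[OF a1 SYT_tableaux[OF T]])
  have le: "T b < Suc n" if "b \<in> diagram lam" for b
    using tableau_entry_in[OF SYT_tableaux[OF T] that] by simp
  have rows: "T (i, j) < T (i, j')" if "(i, j) \<in> diagram lam" "(i, j') \<in> diagram lam" "j < j'" for i j j'
    using T that unfolding SYT_def by blast
  have cols: "T (i, j) < T (i', j)" if "(i, j) \<in> diagram lam" "(i', j) \<in> diagram lam" "i < i'" for i i' j
    using T that unfolding SYT_def by blast
  have rlast: "\<not> Suc (lam a) < j" if "(a, j) \<in> diagram (add_box lam a)" for j
    using that by (simp add: diagram_def add_box_def)
  have clast: "\<not> a < i" if "(i, Suc (lam a)) \<in> diagram (add_box lam a)" for i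
    using that partitions_of_decreasing[OF lam a1, of i] by (auto simp: diagram_def add_box_def)
  have "?T (i, j) < ?T (i, j')"
    if b: "(i, j) \<in> diagram (add_box lam a)" "(i, j') \<in> diagram (add_box lam a)" "j < j'" for i j j'
  proof -
    have "(i, j) \<noteq> (a, Suc (lam a))"
      using rlast[of j'] b by auto
    then show ?thesis
      using b rows[of i j j'] le[of "(i, j)"] unfolding D(1) by (cases "(i, j') = (a, Suc (lam a))") auto
  qed
  moreover have "?T (i, j) < ?T (i', j)"
    if b: "(i, j) \<in> diagram (add_box lam a)" "(i', j) \<in> diagram (add_box lam a)" "i < i'" for i i' j
  proof -
    have "(i, j) \<noteq> (a, Suc (lam a))"
      using clast[of i'] b by auto
    then show ?thesis
      using b cols[of i j i'] le[of "(i, j)"] unfolding D(1) by (cases "(i', j) = (a, Suc (lam a))") auto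
  qed
  ultimately show ?thesis
    using tab unfolding SYT_def by blast
qed

text \<open>A box to the right of the largest entry, or below it, would have to contain a still larger one.\<close>

lemma SYT_last_box:
  assumes mu: "mu \<in> partitions_of (Suc n)" and T: "T \<in> SYT (Suc n) mu"
  defines "a \<equiv> row_of T (Suc n)"
  shows "a \<in> removable mu" "T (a, mu a) = Suc n" "(a, mu a) \<in> diagram mu"
proof -
  note T' = SYT_tableaux[OF T]
  define j where "j = col_of T (Suc n)"
  have b: "(a, j) \<in> diagram mu" "T (a, j) = Suc n"
    using box_of_entry[OF T', of "Suc n"] by (simp_all add: a_def j_def)
  have le: "T b \<le> Suc n" if "b \<in> diagram mu" for b
    using tableau_entry_in[OF T' that] by simp
  have "j = mu a"
  proof (rule ccontr)
    assume "j \<noteq> mu a"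
    then have "(a, Suc j) \<in> diagram mu"
      using b(1) by (auto simp: diagram_def)
    moreover from this have "T (a, j) < T (a, Suc j)"
      using T b(1) unfolding SYT_def by blast
    ultimately show False
      using b(2) le[of "(a, Suc j)"] by simp
  qed
  then show bx: "(a, mu a) \<in> diagram mu" and "T (a, mu a) = Suc n"
    using b by simp_all
  have "(Suc a, mu a) \<notin> diagram mu"
  proof
    assume d: "(Suc a, mu a) \<in> diagram mu"
    then have "T (a, mu a) < T (Suc a, mu a)"
      using T bx unfolding SYT_def by blast
    then show False
      using b(2) \<open>j = mu a\<close> le[OF d] by simp
  qed
  then show "a \<in> removable mu"
    using bx by (auto simp: diagram_def removable_def)
qed

lemma SYT_restrict:
  assumes mu: "mu \<in> partitions_of (Suc n)" and T: "T \<in> SYT (Suc n) mu"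
  defines "a \<equiv> row_of T (Suc n)"
  shows "T((a, mu a) := 0) \<in> SYT n (remove_box mu a)"
proof -
  note T' = SYT_tableaux[OF T]
  note last = SYT_last_box[OF mu T, folded a_def]
  let ?lam = "remove_box mu a"
  have a1: "a \<ge> 1" and mua: "Suc (?lam a) = mu a"
    using last(1) by (auto simp: removable_def remove_box_def)
  have D: "diagram mu = insert (a, mu a) (diagram ?lam)" "(a, mu a) \<notin> diagram ?lam"
    using diagram_add_box[OF a1, of ?lam] add_remove_box[OF last(1)] mua by simp_all
  let ?T = "T((a, mu a) := 0)"
  have "bij_betw T (diagram mu) {1..Suc n}"
    using T' by (simp add: tableaux_def)
  then have "bij_betw T (diagram mu - {(a, mu a)}) ({1..Suc n} - {T (a, mu a)})"
    using last(3) by (intro bij_betw_DiffI) (auto simp: bij_betw_def)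
  moreover have "diagram mu - {(a, mu a)} = diagram ?lam" "{1..Suc n} - {T (a, mu a)} = {1..n}"
    using D last(2) by auto
  ultimately have "bij_betw T (diagram ?lam) {1..n}"
    by simp
  moreover have "bij_betw ?T (diagram ?lam) {1..n} \<longleftrightarrow> bij_betw T (diagram ?lam) {1..n}"
    by (rule bij_betw_cong) (use D(2) in auto)
  ultimately have "bij_betw ?T (diagram ?lam) {1..n}"
    by blast
  moreover have "?T b = 0" if "b \<notin> diagram ?lam" for b
    using tableau_outside[OF T', of b] that D(1) by auto
  ultimately have tab: "?T \<in> tableaux n ?lam"
    unfolding tableaux_def by blast
  have same: "?T b = T b" "b \<in> diagram mu" if "b \<in> diagram ?lam" for b
    using that D by auto
  have "?T (i, j) < ?T (i, j')"
    if b: "(i, j) \<in> diagram ?lam" "(i, j') \<in> diagram ?lam" "j < j'" for i j j'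
    unfolding same(1)[OF b(1)] same(1)[OF b(2)]
    using T same(2)[OF b(1)] same(2)[OF b(2)] b(3) unfolding SYT_def by blast
  moreover have "?T (i, j) < ?T (i', j)"
    if b: "(i, j) \<in> diagram ?lam" "(i', j) \<in> diagram ?lam" "i < i'" for i i' j
    unfolding same(1)[OF b(1)] same(1)[OF b(2)]
    using T same(2)[OF b(1)] same(2)[OF b(2)] b(3) unfolding SYT_def by blast
  ultimately show ?thesis
    using tab unfolding SYT_def by blast
qed

lemma card_SYT_remove:
  assumes mu: "mu \<in> partitions_of (Suc n)"
  shows "card (SYT (Suc n) mu) = (\<Sum>a\<in>removable mu. card (SYT n (remove_box mu a)))"
proof -
  have "card (SYT (Suc n) mu) = card (SIGMA a:removable mu. SYT n (remove_box mu a))"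
  proof (rule bij_betw_same_card[OF bij_betw_byWitness])
    let ?f = "\<lambda>T. (row_of T (Suc n), T((row_of T (Suc n), mu (row_of T (Suc n))) := 0))"
    let ?g = "\<lambda>(a, T :: nat \<times> nat \<Rightarrow> nat). T((a, mu a) := Suc n)"
    show "\<forall>T\<in>SYT (Suc n) mu. ?g (?f T) = T"
      by (auto simp: fun_eq_iff SYT_last_box(2)[OF mu])
    show "?f ` SYT (Suc n) mu \<subseteq> (SIGMA a:removable mu. SYT n (remove_box mu a))"
      using SYT_last_box(1)[OF mu] SYT_restrict[OF mu] by auto
    have g: "?g (a, T) \<in> SYT (Suc n) mu \<and> ?f (?g (a, T)) = (a, T)"
      if a: "a \<in> removable mu" and T: "T \<in> SYT n (remove_box mu a)" for a T
    proof -
      let ?lam = "remove_box mu a"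
      have lam: "?lam \<in> partitions_of n" and aa: "a \<in> addable ?lam"
        using remove_box_partition[OF mu a] addable_remove_box[OF mu a] .
      have mua: "Suc (?lam a) = mu a" and a1: "a \<ge> 1"
        using a by (auto simp: removable_def remove_box_def)
      have S: "?g (a, T) \<in> SYT (Suc n) mu"
        using SYT_extend[OF lam aa T] mua add_remove_box[OF a] by simp
      have "(a, mu a) \<in> diagram mu"
        using a1 mua by (auto simp: diagram_def)
      then have "row_of (?g (a, T)) (?g (a, T) (a, mu a)) = a"
        by (rule row_col_of_entry(1)[OF SYT_tableaux[OF S]])
      then have r: "row_of (?g (a, T)) (Suc n) = a"
        by simp
      have "T (a, mu a) = 0"
        using tableau_outside[OF SYT_tableaux[OF T]] diagram_add_box(2)[OF a1, of ?lam] mua by simp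
      with r S show ?thesis
        by (auto simp: fun_eq_iff)
    qed
    show "\<forall>p\<in>(SIGMA a:removable mu. SYT n (remove_box mu a)). ?f (?g p) = p"
    proof
      fix p assume "p \<in> (SIGMA a:removable mu. SYT n (remove_box mu a))"
      then obtain a T where "p = (a, T)" "a \<in> removable mu" "T \<in> SYT n (remove_box mu a)"
        by blast
      then show "?f (?g p) = p"
        using g by blast
    qed
    show "?g ` (SIGMA a:removable mu. SYT n (remove_box mu a)) \<subseteq> SYT (Suc n) mu"
    proof (rule image_subsetI)
      fix p assume "p \<in> (SIGMA a:removable mu. SYT n (remove_box mu a))"
      then obtain a T where "p = (a, T)" "a \<in> removable mu" "T \<in> SYT n (remove_box mu a)"
        by blast
      then show "?g p \<in> SYT (Suc n) mu"
        using g by blast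
    qed
  qed
  also have "\<dots> = (\<Sum>a\<in>removable mu. card (SYT n (remove_box mu a)))"
    using mu finite_SYT[OF remove_box_partition[OF mu]] by (subst card_SigmaI) auto
  finally show ?thesis .
qed

text \<open>For \<open>a \<noteq> b\<close>, the box \<open>b\<close> can be removed after adding \<open>a\<close> exactly when \<open>a\<close> can be added after
  removing \<open>b\<close>, so the sums run over the same partitions.\<close>

lemma sum_add_remove_exchange:
  assumes lam: "lam \<in> partitions_of n"
  shows "(\<Sum>a\<in>addable lam. \<Sum>b\<in>removable (add_box lam a) - {a}. f (remove_box (add_box lam a) b)) =
    (\<Sum>b\<in>removable lam. \<Sum>a\<in>addable (remove_box lam b) - {b}. f (add_box (remove_box lam b) a))"
proof -
  have fin: "finite (addable lam)" "finite (removable lam)"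
    using lam by auto
  have fin1: "finite (removable (add_box lam a) - {a})" if "a \<in> addable lam" for a
    using add_box_partition[OF lam that] by simp
  have fin2: "finite (addable (remove_box lam b) - {b})" for b
  proof (rule finite_subset)
    show "addable (remove_box lam b) - {b} \<subseteq> insert (Suc b) (addable lam)"
      by (auto simp: addable_def remove_box_def split: if_splits)
  qed (use fin in simp)
  have "(\<Sum>a\<in>addable lam. \<Sum>b\<in>removable (add_box lam a) - {a}. f (remove_box (add_box lam a) b)) =
      (\<Sum>(a, b)\<in>(SIGMA a:addable lam. removable (add_box lam a) - {a}). f (remove_box (add_box lam a) b))"
    using fin fin1 by (intro sum.Sigma) auto
  also have "\<dots> = (\<Sum>(b, a)\<in>(SIGMA b:removable lam. addable (remove_box lam b) - {b}).
      f (add_box (remove_box lam b) a))"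
  proof (rule sum.reindex_bij_witness[of _ prod.swap prod.swap])
    fix p assume p: "p \<in> (SIGMA a:addable lam. removable (add_box lam a) - {a})"
    obtain a b where ab: "p = (a, b)" by (cases p)
    show "prod.swap p \<in> (SIGMA b:removable lam. addable (remove_box lam b) - {b})"
      using p add_remove_exchange[OF lam, of a b] by (auto simp: ab)
    show "(case prod.swap p of (b, a) \<Rightarrow> f (add_box (remove_box lam b) a)) =
        (case p of (a, b) \<Rightarrow> f (remove_box (add_box lam a) b))"
      using p add_remove_commute[of a b lam] by (auto simp: ab)
  next
    fix p assume p: "p \<in> (SIGMA b:removable lam. addable (remove_box lam b) - {b})"
    obtain b a where ab: "p = (b, a)" by (cases p)
    show "prod.swap p \<in> (SIGMA a:addable lam. removable (add_box lam a) - {a})"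
      using p add_remove_exchange[OF lam, of a b] by (auto simp: ab)
  qed auto
  also have "\<dots> = (\<Sum>b\<in>removable lam. \<Sum>a\<in>addable (remove_box lam b) - {b}. f (add_box (remove_box lam b) a))"
    using fin fin2 by (intro sum.Sigma[symmetric]) auto
  finally show ?thesis .
qed

text \<open>The commutation relation between adding and removing boxes, applied to the numbers of standard
  tableaux: there is one more way to add and remove the same box than to remove and add it.\<close>

lemma card_SYT_add:
  assumes "lam \<in> partitions_of n"
  shows "(\<Sum>a\<in>addable lam. card (SYT (Suc n) (add_box lam a))) = Suc n * card (SYT n lam)"
proof -
  define f where "f = (\<lambda>n lam. card (SYT n lam))"
  \<comment> \<open>\<open>Y\<close> collects the two-step paths that move a box to a different place.\<close>
  define Y where "Y = (\<lambda>n lam. \<Sum>b\<in>removable lam. \<Sum>a\<in>addable (remove_box lam b) - {b}. f n (add_box (remove_box lam b) a))"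
  have up: "(\<Sum>a\<in>addable lam. f (Suc n) (add_box lam a)) = card (addable lam) * f n lam + Y n lam"
    if lam: "lam \<in> partitions_of n" for n lam
  proof -
    have "(\<Sum>a\<in>addable lam. f (Suc n) (add_box lam a)) =
        (\<Sum>a\<in>addable lam. f n lam + (\<Sum>b\<in>removable (add_box lam a) - {a}. f n (remove_box (add_box lam a) b)))"
    proof (rule sum.cong[OF refl])
      fix a assume a: "a \<in> addable lam"
      note mu = add_box_partition[OF lam a]
      show "f (Suc n) (add_box lam a) =
          f n lam + (\<Sum>b\<in>removable (add_box lam a) - {a}. f n (remove_box (add_box lam a) b))"
        unfolding f_def card_SYT_remove[OF mu]
        using removable_add_box[OF lam a] finite_removable[OF mu] by (subst sum.remove[of _ a]) auto
    qed
    then show ?thesis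
      unfolding Y_def by (simp add: sum.distrib sum_add_remove_exchange[OF lam, of "f n"])
  qed
  have down: "n * f n lam = card (removable lam) * f n lam + Y n lam \<and>
      (\<Sum>a\<in>addable lam. f (Suc n) (add_box lam a)) = Suc n * f n lam"
    if "lam \<in> partitions_of n" for n lam
    using that
  proof (induction n arbitrary: lam)
    case (0 lam)
    then have "removable lam = {}"
      using removable_le[of lam 0] by auto
    then have "0 * f 0 lam = card (removable lam) * f 0 lam + Y 0 lam"
      by (simp add: Y_def)
    then show ?case
      using up[OF 0] card_addable[OF 0] by simp
  next
    case (Suc n lam)
    have "Suc n * f (Suc n) lam = (\<Sum>b\<in>removable lam. Suc n * f n (remove_box lam b))"
      unfolding f_def card_SYT_remove[OF Suc(2)] by (rule sum_distrib_left)
    also have "\<dots> = (\<Sum>b\<in>removable lam. \<Sum>a\<in>addable (remove_box lam b). f (Suc n) (add_box (remove_box lam b) a))"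
      using Suc(1) remove_box_partition[OF Suc(2)] by (intro sum.cong refl) simp
    also have "\<dots> = (\<Sum>b\<in>removable lam. f (Suc n) lam +
        (\<Sum>a\<in>addable (remove_box lam b) - {b}. f (Suc n) (add_box (remove_box lam b) a)))"
    proof (rule sum.cong[OF refl])
      fix b assume b: "b \<in> removable lam"
      show "(\<Sum>a\<in>addable (remove_box lam b). f (Suc n) (add_box (remove_box lam b) a)) = f (Suc n) lam +
        (\<Sum>a\<in>addable (remove_box lam b) - {b}. f (Suc n) (add_box (remove_box lam b) a))"
        using finite_addable[OF remove_box_partition[OF Suc(2) b]] addable_remove_box[OF Suc(2) b] add_remove_box[OF b]
        by (subst sum.remove[of _ b]) auto
    qed
    also have "\<dots> = card (removable lam) * f (Suc n) lam + Y (Suc n) lam"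
      by (simp add: sum.distrib Y_def)
    finally show ?case
      using up[OF Suc(2)] card_addable[OF Suc(2)] by simp
  qed
  show ?thesis
    using down[OF assms] by (simp add: f_def)
qed

theorem sum_card_SYT_squared: "(\<Sum>lam\<in>partitions_of n. (card (SYT n lam))\<^sup>2) = fact n"
proof (induction n)
  case 0
  have P: "partitions_of 0 = {\<lambda>_. 0}"
  proof (intro subset_antisym subsetI)
    fix lam assume "lam \<in> partitions_of 0"
    then have "lam i = 0" for i
      by (cases "i = 0") (auto simp: partitions_of_def)
    then show "lam \<in> {\<lambda>_. 0}"
      by auto
  qed (simp add: partitions_of_def)
  have "diagram (\<lambda>_. 0) = {}"
    by (auto simp: diagram_def)
  then have "SYT 0 (\<lambda>_. 0) = {\<lambda>_. 0}"
    by (auto simp: SYT_def tableaux_def fun_eq_iff bij_betw_def)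
  then show ?case
    by (simp add: P)
next
  case (Suc n)
  let ?f = "\<lambda>n lam. card (SYT n lam)"
  have "(\<Sum>mu\<in>partitions_of (Suc n). (?f (Suc n) mu)\<^sup>2) =
      (\<Sum>mu\<in>partitions_of (Suc n). \<Sum>a\<in>removable mu. ?f (Suc n) mu * ?f n (remove_box mu a))"
  proof (rule sum.cong[OF refl])
    fix mu assume "mu \<in> partitions_of (Suc n)"
    from card_SYT_remove[OF this]
    show "(?f (Suc n) mu)\<^sup>2 = (\<Sum>a\<in>removable mu. ?f (Suc n) mu * ?f n (remove_box mu a))"
      by (simp add: power2_eq_square sum_distrib_left[symmetric])
  qed
  also have "\<dots> = (\<Sum>(mu, a)\<in>(SIGMA mu:partitions_of (Suc n). removable mu).
      ?f (Suc n) mu * ?f n (remove_box mu a))"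
    by (intro sum.Sigma) (auto simp: finite_partitions_of)
  also have "\<dots> = (\<Sum>(lam, a)\<in>(SIGMA lam:partitions_of n. addable lam).
      ?f (Suc n) (add_box lam a) * ?f n lam)"
    by (rule sum.reindex_bij_witness[of _ "\<lambda>(lam, a). (add_box lam a, a)" "\<lambda>(mu, a). (remove_box mu a, a)"])
      (auto simp: add_remove_box remove_box_partition addable_remove_box add_box_partition removable_add_box)
  also have "\<dots> = (\<Sum>lam\<in>partitions_of n. \<Sum>a\<in>addable lam. ?f (Suc n) (add_box lam a) * ?f n lam)"
    by (intro sum.Sigma[symmetric]) (auto simp: finite_partitions_of)
  also have "\<dots> = (\<Sum>lam\<in>partitions_of n. Suc n * (?f n lam)\<^sup>2)"
    by (intro sum.cong refl)
      (simp add: sum_distrib_right[symmetric] card_SYT_add power2_eq_square mult.assoc del: mult_Suc)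
  also have "\<dots> = Suc n * fact n"
    using Suc by (simp add: sum_distrib_left[symmetric] del: mult_Suc)
  finally show ?case
    by simp
qed

section \<open>Standard polytabloids form a basis of the Specht module\<close>

text \<open>The words of the two tableaux are compared lexicographically, read from right to left.\<close>

definition word_before :: "nat \<Rightarrow> (nat \<times> nat \<Rightarrow> nat) \<Rightarrow> (nat \<times> nat \<Rightarrow> nat) \<Rightarrow> bool" where
  "word_before n T T' \<longleftrightarrow>
    (\<exists>k\<in>{1..n}. row_of T k < row_of T' k \<and> (\<forall>l\<in>{k<..n}. row_of T l = row_of T' l))"

lemma word_before_trans:
  assumes "word_before n T T'" "word_before n T' T''"
  shows "word_before n T T''"
proof -
  obtain k where k: "k \<in> {1..n}" "row_of T k < row_of T' k" "\<And>l. l \<in> {k<..n} \<Longrightarrow> row_of T l = row_of T' l"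
    using assms(1) unfolding word_before_def by blast
  obtain m where m: "m \<in> {1..n}" "row_of T' m < row_of T'' m" "\<And>l. l \<in> {m<..n} \<Longrightarrow> row_of T' l = row_of T'' l"
    using assms(2) unfolding word_before_def by blast
  have "row_of T (max k m) < row_of T'' (max k m)"
    using k(1,2) m(1,2) k(3)[of m] m(3)[of k]
    by (cases rule: linorder_cases[of k m]) auto
  moreover have "row_of T l = row_of T'' l" if "l \<in> {max k m<..n}" for l
    using k(3)[of l] m(3)[of l] that by simp
  ultimately show ?thesis
    unfolding word_before_def using k(1) m(1) by (intro bexI[of _ "max k m"]) auto
qed

lemma word_before_irrefl: "\<not> word_before n T T"
  by (simp add: word_before_def)

text \<open>Let \<open>k\<close> be the largest entry that the column permutation moves.  The entry \<open>m\<close> which takes its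
  place in the word is smaller and lies in the same column, hence in a higher row, because the columns
  of \<open>T\<close> increase.\<close>

lemma column_group_word_before:
  assumes T: "T \<in> SYT n lam" and \<sigma>: "\<sigma> \<in> column_group n T" and ne: "\<sigma> \<noteq> id"
  shows "word_before n (\<sigma> \<circ> T) T"
proof -
  note T' = SYT_tableaux[OF T]
  have \<sigma>S: "\<sigma> \<in> Sym n"
    using \<sigma> by (rule column_group_Sym)
  have cols: "m < k" if "m \<in> {1..n}" "k \<in> {1..n}" "col_of T m = col_of T k" "row_of T m < row_of T k" for m k
  proof -
    have "T (row_of T m, col_of T m) < T (row_of T k, col_of T m)"
      using T box_of_entry(1)[OF T' that(1)] box_of_entry(1)[OF T' that(2)] that(3,4)
      unfolding SYT_def by auto
    then show ?thesis
      using box_of_entry(2)[OF T' that(1)] box_of_entry(2)[OF T' that(2)] that(3) by simp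
  qed
  have row: "row_of (\<sigma> \<circ> T) k = row_of T (pinv \<sigma> k)" and col: "col_of T (pinv \<sigma> k) = col_of T k"
    and inn: "pinv \<sigma> k \<in> {1..n}" if k: "k \<in> {1..n}" for k
  proof -
    show inn: "pinv \<sigma> k \<in> {1..n}"
      using \<sigma>S k by (simp del: atLeastAtMost_iff)
    show "row_of (\<sigma> \<circ> T) k = row_of T (pinv \<sigma> k)"
      using row_col_of_comp(1)[OF \<sigma>S T' inn] \<sigma>S by simp
    show "col_of T (pinv \<sigma> k) = col_of T k"
      using \<sigma> inn unfolding column_group_iff[OF T'] using Sym_inv_simps(1)[OF \<sigma>S] by metis
  qed
  have fixed: "pinv \<sigma> k = k" if k: "k \<in> {1..n}" "row_of (\<sigma> \<circ> T) k = row_of T k" for k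
  proof -
    have "row_of T (pinv \<sigma> k) = row_of T k"
      using row[OF k(1)] k(2) by simp
    then have "T (row_of T (pinv \<sigma> k), col_of T (pinv \<sigma> k)) = T (row_of T k, col_of T k)"
      using col[OF k(1)] by simp
    then show ?thesis
      unfolding box_of_entry(2)[OF T' k(1)] box_of_entry(2)[OF T' inn[OF k(1)]] .
  qed
  let ?D = "{k \<in> {1..n}. pinv \<sigma> k \<noteq> k}"
  have "?D \<noteq> {}"
  proof
    assume e: "?D = {}"
    have "\<sigma> k = k" for k
    proof (cases "k \<in> {1..n}")
      case True
      then have "pinv \<sigma> k = k"
        using e by blast
      then show ?thesis
        using Sym_inv_simps(1)[OF \<sigma>S, of k] by simp
    next
      case False
      then show ?thesis
        using \<sigma>S by (simp add: Sym_iff permutes_def)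
    qed
    with ne show False
      by auto
  qed
  moreover define k where "k = Max ?D"
  ultimately have "k \<in> ?D"
    unfolding k_def by (intro Max_in) auto
  then have kD: "k \<in> {1..n}" "pinv \<sigma> k \<noteq> k"
    by auto
  have above: "pinv \<sigma> l = l" if "l \<in> {k<..n}" for l
  proof (rule ccontr)
    assume "pinv \<sigma> l \<noteq> l"
    then have "l \<in> ?D"
      using that by auto
    then have "l \<le> k"
      unfolding k_def by (intro Max_ge) auto
    with that show False
      by simp
  qed
  \<comment> \<open>Entries above \<open>k\<close> are fixed, so what takes the place of \<open>k\<close> is smaller.\<close>
  define m where "m = pinv \<sigma> k"
  have "m < k"
  proof (rule ccontr)
    assume "\<not> m < k"
    then have "m \<in> {k<..n}"
      using kD inn[OF kD(1)] by (auto simp: m_def)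
    then have "pinv \<sigma> m = pinv \<sigma> k"
      using above[of m] by (simp add: m_def)
    then have "m = k"
      using Sym_inv_simps(1)[OF \<sigma>S] by metis
    with kD show False
      by (simp add: m_def)
  qed
  moreover have "col_of T m = col_of T k" "m \<in> {1..n}"
    using col[OF kD(1)] inn[OF kD(1)] by (simp_all add: m_def)
  ultimately have "row_of T m < row_of T k"
    using cols[OF kD(1), of m] fixed[OF kD(1)] row[OF kD(1)] kD(2)
    by (cases rule: linorder_cases[of "row_of T m" "row_of T k"]) (auto simp: m_def)
  then have "row_of (\<sigma> \<circ> T) k < row_of T k"
    using row[OF kD(1)] by (simp add: m_def)
  moreover have "row_of (\<sigma> \<circ> T) l = row_of T l" if "l \<in> {k<..n}" for l
    using row[of l] above[OF that] that kD(1) by simp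
  ultimately show ?thesis
    unfolding word_before_def using kD(1) by blast
qed

text \<open>The largest entry occupies the last box of its row; removing it gives an induction.\<close>

lemma SYT_determined_by_rows:
  assumes lam: "lam \<in> partitions_of n" and T: "T \<in> SYT n lam" and U: "U \<in> SYT n lam"
    and rows: "\<And>k. k \<in> {1..n} \<Longrightarrow> row_of T k = row_of U k"
  shows "T = U"
  using assms
proof (induction n arbitrary: lam T U)
  case (0 lam T U)
  have zero: "V b = 0" if "V \<in> SYT 0 lam" for V b
    using tableau_outside[OF SYT_tableaux[OF that], of b] tableau_entry_in[OF SYT_tableaux[OF that], of b] by fastforce
  show ?case
    using zero[OF 0(2)] zero[OF 0(3)] by (intro ext) simp
next
  case (Suc n lam T U)
  define a where "a = row_of T (Suc n)"
  have aU: "a = row_of U (Suc n)"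
    unfolding a_def by (rule Suc.prems(4)) simp
  note last = SYT_last_box[OF Suc.prems(1,2), folded a_def] SYT_last_box[OF Suc.prems(1,3), folded aU]
  let ?T = "T((a, lam a) := 0)" and ?U = "U((a, lam a) := 0)"
  have T': "?T \<in> SYT n (remove_box lam a)" and U': "?U \<in> SYT n (remove_box lam a)"
    using SYT_restrict[OF Suc.prems(1,2)] SYT_restrict[OF Suc.prems(1,3)] by (simp_all add: a_def[symmetric] aU[symmetric])
  have same: "row_of (V((a, lam a) := 0)) k = row_of V k"
    if V: "V \<in> SYT (Suc n) lam" "V((a, lam a) := 0) \<in> SYT n (remove_box lam a)" and k: "k \<in> {1..n}" for V k
  proof -
    let ?V = "V((a, lam a) := 0)"
    obtain i j where b: "(i, j) \<in> diagram (remove_box lam a)" "?V (i, j) = k"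
      using tableau_box[OF SYT_tableaux[OF V(2)] k] .
    have "(i, j) \<noteq> (a, lam a)"
      using b(2) k by auto
    then have "V (i, j) = k"
      using b(2) by auto
    moreover from this have "(i, j) \<in> diagram lam"
      using tableau_pos_imp_diagram[OF SYT_tableaux[OF V(1)], of "(i, j)"] k by simp
    ultimately show ?thesis
      using row_col_of_entry(1)[OF SYT_tableaux[OF V(1)]] row_col_of_entry(1)[OF SYT_tableaux[OF V(2)] b(1)] b(2) by metis
  qed
  have "?T = ?U"
  proof (rule Suc.IH[OF remove_box_partition[OF Suc.prems(1) last(1)] T' U'])
    fix k assume k: "k \<in> {1..n}"
    show "row_of ?T k = row_of ?U k"
      unfolding same[OF Suc.prems(2) T' k] same[OF Suc.prems(3) U' k] using k by (intro Suc.prems(4)) simp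
  qed
  then show ?case
    using last(2,5) by (metis fun_upd_triv fun_upd_upd)
qed

lemma tableau_word_eq_iff:
  "tableau_word n T = tableau_word n U \<longleftrightarrow> (\<forall>k\<in>{1..n}. row_of T k = row_of U k)"
proof
  assume eq: "tableau_word n T = tableau_word n U"
  show "\<forall>k\<in>{1..n}. row_of T k = row_of U k"
  proof
    fix k assume "k \<in> {1..n}"
    then show "row_of T k = row_of U k"
      using tableau_word_nth[of k n T] tableau_word_nth[of k n U] eq by simp
  qed
next
  assume "\<forall>k\<in>{1..n}. row_of T k = row_of U k"
  then show "tableau_word n T = tableau_word n U"
    by (intro word_eqI[of _ n]) (simp_all add: tableau_word_nth)
qed

text \<open>The word of a standard tableau is the last one in its polytabloid.\<close>

lemma lookup_specht_vector_other:
  assumes lam: "lam \<in> partitions_of n" and T: "T \<in> SYT n lam" and U: "U \<in> SYT n lam"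
    and ne: "T \<noteq> U" and nb: "\<not> word_before n U T"
  shows "Poly_Mapping.lookup (specht_vector n T) (tableau_word n U) = 0"
proof -
  have "tableau_word n (\<sigma> \<circ> T) \<noteq> tableau_word n U" if \<sigma>: "\<sigma> \<in> column_group n T" for \<sigma>
  proof
    assume "tableau_word n (\<sigma> \<circ> T) = tableau_word n U"
    then have eq: "\<And>k. k \<in> {1..n} \<Longrightarrow> row_of (\<sigma> \<circ> T) k = row_of U k"
      by (simp add: tableau_word_eq_iff)
    show False
    proof (cases "\<sigma> = id")
      case True
      then show False
        using SYT_determined_by_rows[OF lam T U] eq ne by simp
    next
      case False
      have "word_before n (\<sigma> \<circ> T) T"
        by (rule column_group_word_before[OF T \<sigma> False])
      then have "word_before n U T"
        unfolding word_before_def using eq by fastforce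
      with nb show False ..
    qed
  qed
  then show ?thesis
    by (auto simp: specht_vector_def lookup_sum lookup_single when_def intro!: sum.neutral)
qed

text \<open>In a linear relation, consider a tableau with nonzero coefficient whose word is maximal: this
  word occurs in no other polytabloid of the relation.\<close>

lemma standard_polytabloids_independent:
  assumes lam: "lam \<in> partitions_of n" and sum0: "(\<Sum>T\<in>SYT n lam. scalev (f T) (specht_vector n T)) = 0"
    and T: "T \<in> SYT n lam"
  shows "f T = 0"
proof (rule ccontr)
  assume "f T \<noteq> 0"
  let ?A = "{T \<in> SYT n lam. f T \<noteq> 0}"
  have "finite ?A" "?A \<noteq> {}"
    using finite_SYT[OF lam] T \<open>f T \<noteq> 0\<close> by auto
  then obtain U where U: "U \<in> ?A" "\<forall>V\<in>?A. V \<noteq> U \<longrightarrow> \<not> word_before n U V"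
    using Finite_Set.bex_max_element[of ?A "word_before n"] word_before_trans word_before_irrefl
    by (metis (no_types, lifting) asymp_onI transp_onI)
  have "0 = (\<Sum>T\<in>SYT n lam. f T * Poly_Mapping.lookup (specht_vector n T) (tableau_word n U))"
    using arg_cong[OF sum0, of "\<lambda>v. Poly_Mapping.lookup v (tableau_word n U)"] by (simp add: lookup_sum)
  also have "\<dots> = (\<Sum>T\<in>{U}. f T * Poly_Mapping.lookup (specht_vector n T) (tableau_word n U))"
  proof (rule sum.mono_neutral_right)
    show "\<forall>V\<in>SYT n lam - {U}. f V * Poly_Mapping.lookup (specht_vector n V) (tableau_word n U) = 0"
    proof
      fix V assume V: "V \<in> SYT n lam - {U}"
      show "f V * Poly_Mapping.lookup (specht_vector n V) (tableau_word n U) = 0"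
      proof (cases "f V = 0")
        case False
        then show ?thesis
          using lookup_specht_vector_other[OF lam, of V U] U V by auto
      qed simp
    qed
  qed (use finite_SYT[OF lam] U in auto)
  also have "\<dots> = f U"
    using ip_specht_vector_word[OF lam, of U] U SYT_tableaux[of U n lam] by (simp add: ip_bvec_right)
  finally show False
    using U by simp
qed

lemma standard_polytabloids_basis:
  assumes lam: "lam \<in> partitions_of n"
  shows "inj_on (specht_vector n) (SYT n lam)" "fv.independent (specht_vector n ` SYT n lam)"
proof -
  show inj: "inj_on (specht_vector n) (SYT n lam)"
  proof (rule inj_onI, rule ccontr)
    fix T U assume TU: "T \<in> SYT n lam" "U \<in> SYT n lam" "specht_vector n T = specht_vector n U" "T \<noteq> U"
    define f where "f = (\<lambda>V. if V = T then 1 else if V = U then -1 else 0 :: complex)"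
    have "(\<Sum>V\<in>SYT n lam. scalev (f V) (specht_vector n V)) = (\<Sum>V\<in>{T, U}. scalev (f V) (specht_vector n V))"
      using finite_SYT[OF lam] TU by (intro sum.mono_neutral_right) (auto simp: f_def)
    also have "\<dots> = 0"
      using TU by (simp add: f_def fv.scale_minus_left)
    finally have "f T = 0"
      using standard_polytabloids_independent[OF lam _ TU(1)] by blast
    then show False
      by (simp add: f_def)
  qed
  show "fv.independent (specht_vector n ` SYT n lam)"
  proof (rule fv.independent_if_scalars_zero)
    fix f x assume s: "(\<Sum>x\<in>specht_vector n ` SYT n lam. scalev (f x) x) = 0" and x: "x \<in> specht_vector n ` SYT n lam"
    have "(\<Sum>T\<in>SYT n lam. scalev (f (specht_vector n T)) (specht_vector n T)) = 0"
      using s by (simp add: sum.reindex[OF inj])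
    moreover obtain T where T: "T \<in> SYT n lam" "x = specht_vector n T"
      using x by blast
    ultimately show "f x = 0"
      using standard_polytabloids_independent[OF lam, of "\<lambda>T. f (specht_vector n T)" T] by simp
  qed (use finite_SYT[OF lam] in simp)
qed

text \<open>A dimension count.  The independent standard polytabloids show that the dimensions are at least \<open>d\<^sub>\<lambda>\<close>.
  The squares of the dimensions sum up to at most \<open>n!\<close>, but the squares of the \<open>d\<^sub>\<lambda>\<close> sum up to \<open>n!\<close>
  already.\<close>

lemma specht_eq_full_specht:
  assumes lam: "lam \<in> partitions_of n"
  shows "specht n lam = full_specht n lam" and "fv.dim (full_specht n lam) = card (SYT n lam)"
proof -
  have "\<exists>C. finite C \<and> orthogonal_set C \<and> fv.span C = full_specht n mu" if mu: "mu \<in> partitions_of n" for mu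
    unfolding full_specht_def using finite_tableaux[OF mu] by (intro orthogonal_basis_exists) simp
  then obtain C where C: "\<And>mu. mu \<in> partitions_of n \<Longrightarrow> finite (C mu)"
    "\<And>mu. mu \<in> partitions_of n \<Longrightarrow> orthogonal_set (C mu)"
    "\<And>mu. mu \<in> partitions_of n \<Longrightarrow> fv.span (C mu) = full_specht n mu"
    by metis
  have sub: "specht_vector n ` SYT n mu \<subseteq> full_specht n mu" for mu
    using SYT_tableaux by auto
  have le: "card (SYT n mu) \<le> card (C mu)" if mu: "mu \<in> partitions_of n" for mu
  proof -
    have "card (specht_vector n ` SYT n mu) \<le> card (C mu)"
      using fv.independent_span_bound[OF C(1)[OF mu] standard_polytabloids_basis(2)[OF mu]] sub[of mu]
      by (simp add: C(3)[OF mu])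
    then show ?thesis
      by (simp add: card_image[OF standard_polytabloids_basis(1)[OF mu]])
  qed
  have "(\<Sum>mu\<in>partitions_of n. (card (C mu))\<^sup>2) \<le> (\<Sum>mu\<in>partitions_of n. (card (SYT n mu))\<^sup>2)"
    unfolding sum_card_SYT_squared
  proof (rule mcoef_family_card[OF finite_partitions_of order_refl])
    show "C mu \<subseteq> full_specht n mu" if "mu \<in> partitions_of n" for mu
      using C(3)[OF that] fv.span_superset by blast
  qed (use C in auto)
  then have "\<not> (\<exists>mu\<in>partitions_of n. (card (SYT n mu))\<^sup>2 < (card (C mu))\<^sup>2)"
    using sum_strict_mono_ex1[OF finite_partitions_of, of n "\<lambda>mu. (card (SYT n mu))\<^sup>2" "\<lambda>mu. (card (C mu))\<^sup>2"] le
    by (auto simp: not_le[symmetric] power_mono)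
  then have card: "card (C lam) = card (SYT n lam)"
    using le[OF lam] lam by (meson le_antisym not_le power_strict_mono zero_less_numeral le0 linorder_neqE_nat)
  have dimC: "fv.dim (full_specht n lam) = card (C lam)"
    using fv.dim_span_eq_card_independent[OF orthogonal_set_independent[OF C(1,2)[OF lam]]] C(3)[OF lam] by simp
  with card show dim: "fv.dim (full_specht n lam) = card (SYT n lam)"
    by simp
  have dimS: "fv.dim (specht n lam) = card (SYT n lam)"
    unfolding specht_def using fv.dim_span_eq_card_independent[OF standard_polytabloids_basis(2)[OF lam]]
    by (simp add: card_image[OF standard_polytabloids_basis(1)[OF lam]])
  show "specht n lam = full_specht n lam"
  proof (rule ccontr)
    assume "specht n lam \<noteq> full_specht n lam"
    moreover have "specht n lam \<subseteq> full_specht n lam"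
      unfolding specht_def by (rule fv.span_minimal[OF sub subspace_full_specht])
    ultimately have "fv.dim (specht n lam) < fv.dim (full_specht n lam)"
      using C(1,3)[OF lam] by (intro dim_strict_mono[of _ _ "C lam"]) (auto simp: specht_def)
    with dim dimS show False
      by simp
  qed
qed

section \<open>The isotypic projection is the orthogonal projection\<close>

lemma submoduleD:
  assumes "submodule n V"
  shows "V \<subseteq> word_module n" "fv.subspace V" "\<And>\<sigma> v. \<sigma> \<in> Sym n \<Longrightarrow> v \<in> V \<Longrightarrow> act \<sigma> v \<in> V"
  using assms by (auto simp: submodule_def)

lemma submodule_full_specht:
  assumes "lam \<in> partitions_of n"
  shows "submodule n (full_specht n lam)"
  unfolding submodule_def using assms full_specht_word_module[OF assms] by auto

lemma submodule_col_antisym: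
  assumes "submodule n V" "v \<in> V"
  shows "col_antisym n T v \<in> V"
  unfolding col_antisym_def using submoduleD[OF assms(1)] assms(2)
  by (intro fv.subspace_sum fv.subspace_scale) (auto dest: column_group_Sym)

text \<open>James' submodule theorem.  If some vector \<open>v\<close> of \<open>V\<close> is not orthogonal to \<open>s(T)\<close>, then its
  antisymmetrization lies in \<open>V\<close> and is a nonzero multiple of \<open>s(T)\<close>, and permutations of \<open>s(T)\<close> give all
  polytabloids.\<close>

lemma submodule_dichotomy:
  assumes lam: "lam \<in> partitions_of n" and V: "submodule n V" "V \<subseteq> perm_module n lam"
  shows "full_specht n lam \<subseteq> V \<or> (\<forall>v\<in>V. \<forall>x\<in>full_specht n lam. ip v x = 0)"
proof (cases "\<exists>v\<in>V. \<exists>T\<in>tableaux n lam. ip v (specht_vector n T) \<noteq> 0")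
  case True
  then obtain v T where v: "v \<in> V" "T \<in> tableaux n lam" "ip v (specht_vector n T) \<noteq> 0"
    by blast
  note VD = submoduleD[OF V(1)]
  have "scalev (ip v (specht_vector n T)) (specht_vector n T) \<in> V"
    using submodule_col_antisym[OF V(1) v(1), of T] col_antisym_perm_module_eq[OF lam v(2), of v] v(1) V(2) by auto
  then have "scalev (inverse (ip v (specht_vector n T))) (scalev (ip v (specht_vector n T)) (specht_vector n T)) \<in> V"
    by (rule fv.subspace_scale[OF VD(2)])
  then have T: "specht_vector n T \<in> V"
    using v(3) by (simp add: fv.scale_scale)
  have "specht_vector n U \<in> V" if U: "U \<in> tableaux n lam" for U
  proof -
    obtain \<sigma> where \<sigma>: "\<sigma> \<in> Sym n" "U = \<sigma> \<circ> T"
      using tableaux_transitive[OF v(2) U] .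
    show ?thesis
      unfolding \<sigma>(2) act_specht_vector[OF lam v(2) \<sigma>(1), symmetric] by (rule VD(3)[OF \<sigma>(1) T])
  qed
  then have "full_specht n lam \<subseteq> V"
    unfolding full_specht_def by (intro fv.span_minimal VD(2)) auto
  then show ?thesis ..
next
  case False
  have "ip v x = 0" if "v \<in> V" "x \<in> full_specht n lam" for v x
    using that(2) unfolding full_specht_def by (rule ip_span_right) (use False that(1) in auto)
  then show ?thesis
    by blast
qed

context
  fixes n :: nat and lam :: "nat \<Rightarrow> nat"
  assumes lam: "lam \<in> partitions_of n" and nonempty: "tableaux n lam \<noteq> {}"
begin

lemma full_specht_nonzero: "full_specht n lam \<noteq> {0}"
proof -
  obtain T where T: "T \<in> tableaux n lam"
    using nonempty by blast
  then show ?thesis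
    using specht_vector_nonzero[OF lam T] specht_vector_full_specht[OF T] by blast
qed

lemma simple_full_specht: "simple n (full_specht n lam)"
  unfolding simple_def
proof (intro conjI allI impI)
  fix U assume U: "submodule n U \<and> U \<subseteq> full_specht n lam"
  then have UM: "U \<subseteq> perm_module n lam"
    using full_specht_perm_module[OF lam] by blast
  have "U = {0}" if o: "\<forall>v\<in>U. \<forall>x\<in>full_specht n lam. ip v x = 0"
  proof -
    have "v = 0" if "v \<in> U" for v
      using o that U ip_self_eq_0_iff[of v] by blast
    moreover have "0 \<in> U"
      using U submoduleD(2) fv.subspace_0 by blast
    ultimately show ?thesis
      by blast
  qed
  then show "U = {0} \<or> U = full_specht n lam"
    using submodule_dichotomy[OF lam _ UM] U by blast
qed (use submodule_full_specht[OF lam] full_specht_nonzero in auto)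

lemma simple_cases:
  assumes "simple n V" "V \<subseteq> perm_module n lam"
  shows "V = full_specht n lam \<or> (\<forall>v\<in>V. \<forall>x\<in>full_specht n lam. ip v x = 0)"
proof -
  have "submodule n V"
    using assms(1) by (simp add: simple_def)
  from submodule_dichotomy[OF lam this assms(2)] show ?thesis
  proof
    assume "full_specht n lam \<subseteq> V"
    then have "full_specht n lam = {0} \<or> full_specht n lam = V"
      using assms(1) submodule_full_specht[OF lam] unfolding simple_def by blast
    then show ?thesis
      using full_specht_nonzero by blast
  qed blast
qed

lemma isomorphic_self: "isomorphic n V V"
  unfolding isomorphic_def by (intro exI[of _ id]) (simp add: fv.linear_id)

text \<open>A submodule orthogonal to the Specht module is killed by all antisymmetrizers, which an
  isomorphism would carry over to the Specht module.\<close>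

lemma isomorphic_not_orthogonal:
  assumes V: "submodule n V" "V \<subseteq> perm_module n lam" and iso: "isomorphic n V (full_specht n lam)"
  shows "\<not> (\<forall>v\<in>V. \<forall>x\<in>full_specht n lam. ip v x = 0)"
proof
  assume o: "\<forall>v\<in>V. \<forall>x\<in>full_specht n lam. ip v x = 0"
  obtain f where f: "Vector_Spaces.linear scalev scalev f" "bij_betw f V (full_specht n lam)"
    "\<And>\<sigma> v. \<sigma> \<in> Sym n \<Longrightarrow> v \<in> V \<Longrightarrow> f (act \<sigma> v) = act \<sigma> (f v)"
    using iso unfolding isomorphic_def by blast
  obtain T where T: "T \<in> tableaux n lam"
    using nonempty by blast
  obtain v where v: "v \<in> V" "f v = specht_vector n T"
    using f(2) specht_vector_full_specht[OF T] unfolding bij_betw_def by (metis imageE)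
  have "col_antisym n T v = 0"
    using col_antisym_perm_module_eq[OF lam T, of v] o v(1) V(2) specht_vector_full_specht[OF T] by auto
  moreover have "f (col_antisym n T v) = col_antisym n T (f v)"
    unfolding col_antisym_def fv2.linear_sum[OF f(1)] fv2.linear_scale[OF f(1)]
    by (intro sum.cong refl) (simp add: f(3)[OF column_group_Sym v(1)])
  ultimately have "col_antisym n T (specht_vector n T) = 0"
    using fv2.linear_0[OF f(1)] v(2) by simp
  moreover have "col_antisym n T (specht_vector n T) = scalev (of_nat (card (column_group n T))) (specht_vector n T)"
    unfolding specht_vector_eq[OF T] using lam T by (intro col_antisym_antisym[OF T]) simp
  moreover have "card (column_group n T) \<noteq> 0"
    using column_group_closed(1)[OF T] by auto
  ultimately show False
    using specht_vector_nonzero[OF lam T] by simp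
qed

text \<open>A copy of the Specht module in \<open>M\<^sup>\<lambda>\<close> cannot be orthogonal to it, so it contains it and, being
  simple, equals it.\<close>

lemma isotypic_eq: "isotypic n lam = full_specht n lam"
proof -
  have "V = full_specht n lam"
    if "simple n V" "V \<subseteq> perm_module n lam" "isomorphic n V (specht n lam)" for V
    using simple_cases[OF that(1,2)] isomorphic_not_orthogonal[of V] that
    unfolding specht_eq_full_specht(1)[OF lam] simple_def by blast
  then have "{V. simple n V \<and> V \<subseteq> perm_module n lam \<and> isomorphic n V (specht n lam)} = {full_specht n lam}"
    using simple_full_specht full_specht_perm_module[OF lam] isomorphic_self[of "full_specht n lam"]
    unfolding specht_eq_full_specht(1)[OF lam] by blast
  then show ?thesis
    by (simp add: isotypic_def)
qed

lemma co_isotypic_orthogonal: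
  assumes "u \<in> co_isotypic n lam" "x \<in> full_specht n lam"
  shows "ip u x = 0"
  using assms(1) unfolding co_isotypic_def
proof (rule ip_span_left)
  fix b assume "b \<in> \<Union>{V. simple n V \<and> V \<subseteq> perm_module n lam \<and> \<not> isomorphic n V (specht n lam)}"
  then obtain V where V: "simple n V" "V \<subseteq> perm_module n lam" "\<not> isomorphic n V (specht n lam)" "b \<in> V"
    by blast
  have "V \<noteq> full_specht n lam"
    using V(3) isomorphic_self unfolding specht_eq_full_specht(1)[OF lam] by blast
  then show "ip b x = 0"
    using simple_cases[OF V(1,2)] V(4) assms(2) by blast
qed

lemma submodule_co_isotypic: "submodule n (co_isotypic n lam)" "co_isotypic n lam \<subseteq> perm_module n lam"
proof -
  let ?B = "\<Union>{V. simple n V \<and> V \<subseteq> perm_module n lam \<and> \<not> isomorphic n V (specht n lam)}"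
  have B: "?B \<subseteq> perm_module n lam"
    by blast
  show sub: "co_isotypic n lam \<subseteq> perm_module n lam"
    unfolding co_isotypic_def by (rule fv.span_minimal[OF B subspace_perm_module])
  have "act \<sigma> v \<in> fv.span ?B" if \<sigma>: "\<sigma> \<in> Sym n" and v: "v \<in> fv.span ?B" for \<sigma> v
    using v
  proof (induction rule: fv.span_induct_alt)
    case base
    then show ?case
      by (simp add: fv.span_zero)
  next
    case (step c x y)
    obtain V where V: "simple n V" "V \<subseteq> perm_module n lam" "\<not> isomorphic n V (specht n lam)" "x \<in> V"
      using step(1) by (elim UnionE CollectE conjE)
    then have "act \<sigma> x \<in> V"
      using \<sigma> submoduleD(3)[of n V \<sigma> x] by (simp add: simple_def)
    with V have "act \<sigma> x \<in> ?B"
      by (intro UnionI[of V]) simp_all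
    then have "act \<sigma> x \<in> fv.span ?B"
      by (rule fv.span_base)
    then show ?case
      unfolding act_add act_scale using step(2) by (intro fv.span_add fv.span_scale)
  qed
  then have "\<forall>\<sigma>\<in>Sym n. \<forall>v\<in>co_isotypic n lam. act \<sigma> v \<in> co_isotypic n lam"
    unfolding co_isotypic_def by blast
  moreover have "fv.subspace (co_isotypic n lam)"
    unfolding co_isotypic_def by (rule fv.subspace_span)
  ultimately show "submodule n (co_isotypic n lam)"
    unfolding submodule_def using sub perm_module_word_module[of n lam] by blast
qed

end

text \<open>A nonzero submodule of minimal dimension is simple.\<close>

lemma simple_submodule_exists:
  assumes Y: "submodule n Y" "Y \<noteq> {0}"
  obtains V where "simple n V" "V \<subseteq> Y"
proof -
  define R where "R = (\<lambda>V. submodule n V \<and> V \<noteq> {0} \<and> V \<subseteq> Y)"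
  have "R Y"
    using Y by (simp add: R_def)
  then obtain V where V: "R V" "\<And>W. R W \<Longrightarrow> fv.dim V \<le> fv.dim W"
    using ex_has_least_nat[of R Y fv.dim] by blast
  have "U = {0} \<or> U = V" if U: "submodule n U" "U \<subseteq> V" for U
  proof (rule ccontr)
    assume ne: "\<not> (U = {0} \<or> U = V)"
    then have "R U"
      using U V(1) by (auto simp: R_def)
    moreover have "fv.dim U < fv.dim V"
    proof (rule dim_strict_mono)
      show "V \<subseteq> fv.span (bvec ` words n)"
        using V(1) submoduleD(1) unfolding R_def word_module_def by blast
    qed (use V(1) U ne in \<open>auto simp: R_def submoduleD(2)\<close>)
    ultimately show False
      using V(2)[of U] by simp
  qed
  then have "simple n V"
    using V(1) by (simp add: simple_def R_def)
  then show ?thesis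
    using that V(1) by (simp add: R_def)
qed

lemma submodule_orthogonal_complement:
  assumes M: "submodule n M" and U: "submodule n U"
  shows "submodule n {v \<in> M. \<forall>x\<in>U. ip v x = 0}"
proof -
  note MD = submoduleD[OF M] and UD = submoduleD[OF U]
  show ?thesis
    unfolding submodule_def
  proof (intro conjI ballI)
    show "{v \<in> M. \<forall>x\<in>U. ip v x = 0} \<subseteq> word_module n"
      using MD(1) by blast
    show "fv.subspace {v \<in> M. \<forall>x\<in>U. ip v x = 0}"
      using fv.subspace_0[OF MD(2)] fv.subspace_add[OF MD(2)] fv.subspace_scale[OF MD(2)]
      by (intro fv.subspaceI) (auto simp: ip_add_left ip_scale_left)
    fix \<sigma> v assume \<sigma>: "\<sigma> \<in> Sym n" and v: "v \<in> {v \<in> M. \<forall>x\<in>U. ip v x = 0}"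
    have "ip (act \<sigma> v) x = 0" if "x \<in> U" for x
      using ip_act_left[OF \<sigma>, of v x] v MD(1) UD(1) UD(3)[OF inv_Sym[OF \<sigma>] that] that by auto
    then show "act \<sigma> v \<in> {v \<in> M. \<forall>x\<in>U. ip v x = 0}"
      using v MD(3)[OF \<sigma>] by simp
  qed
qed

lemma submodule_perm_module: "submodule n (perm_module n lam)"
  unfolding submodule_def using perm_module_word_module by auto

text \<open>By complete reducibility, \<open>M\<^sup>\<lambda>\<close> is the orthogonal sum of the Specht module and its other simple
  submodules: the part orthogonal to all of them would contain a further simple submodule.\<close>

lemma co_isotypic_complement:
  assumes lam: "lam \<in> partitions_of n" and ne: "tableaux n lam \<noteq> {}"
    and v: "v \<in> perm_module n lam" and o: "\<And>x. x \<in> full_specht n lam \<Longrightarrow> ip v x = 0"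
  shows "v \<in> co_isotypic n lam"
proof -
  let ?U = "co_isotypic n lam" and ?F = "full_specht n lam"
  note sub = submodule_co_isotypic[OF lam ne]
  define Y where "Y = {v \<in> {v \<in> perm_module n lam. \<forall>x\<in>?F. ip v x = 0}. \<forall>x\<in>?U. ip v x = 0}"
  have Y: "submodule n Y"
    unfolding Y_def
    by (intro submodule_orthogonal_complement submodule_perm_module submodule_full_specht[OF lam] sub(1))
  have "Y = {0}"
  proof (rule ccontr)
    assume "Y \<noteq> {0}"
    then obtain V where V: "simple n V" "V \<subseteq> Y"
      using simple_submodule_exists[OF Y] by blast
    have VM: "V \<subseteq> perm_module n lam"
      using V(2) by (auto simp: Y_def)
    have "\<not> isomorphic n V (specht n lam)"
      using isomorphic_not_orthogonal[OF lam ne _ VM] V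
      unfolding specht_eq_full_specht(1)[OF lam] simple_def Y_def by blast
    then have "V \<subseteq> ?U"
      unfolding co_isotypic_def using V(1) VM by (intro subsetI fv.span_base) blast
    then have "x = 0" if "x \<in> V" for x
      using V(2) that ip_self_eq_0_iff[of x] unfolding Y_def by blast
    moreover have "0 \<in> V" "V \<noteq> {0}"
      using V(1) submoduleD(2) fv.subspace_0 unfolding simple_def by blast+
    ultimately show False
      by blast
  qed
  \<comment> \<open>The component of \<open>v\<close> orthogonal to \<open>?U\<close> lies in \<open>Y\<close>, so \<open>v\<close> is its own projection.\<close>
  define q where "q = orth_proj ?U v"
  have fd: "fin_dim_subspace ?U"
    by (rule fin_dim_word_submodule[OF submoduleD(2,1)[OF sub(1)]])
  have q: "q \<in> ?U"
    unfolding q_def by (rule orth_proj_mem[OF fd])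
  have "v - q \<in> Y"
    unfolding Y_def
  proof (intro CollectI conjI ballI)
    show "v - q \<in> perm_module n lam"
      using q sub(2) v by (intro fv.subspace_diff) auto
    show "ip (v - q) x = 0" if "x \<in> ?F" for x
      using o[OF that] co_isotypic_orthogonal[OF lam ne q that] by (simp add: ip_diff_left)
    show "ip (v - q) x = 0" if "x \<in> ?U" for x
      unfolding q_def by (rule orth_proj_orth[OF fd that])
  qed
  with \<open>Y = {0}\<close> q show ?thesis
    by simp
qed

lemma isotypic_proj_eq_orth_proj:
  assumes lam: "lam \<in> partitions_of n" and ne: "tableaux n lam \<noteq> {}" and v: "v \<in> perm_module n lam"
  shows "isotypic_proj n lam v = orth_proj (full_specht n lam) v"
  unfolding isotypic_proj_def isotypic_eq[OF lam ne]
proof (rule the_equality)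
  let ?F = "full_specht n lam"
  note fd = fin_dim_full_specht[OF lam]
  have mem: "orth_proj ?F v \<in> ?F"
    by (rule orth_proj_mem[OF fd])
  have "v - orth_proj ?F v \<in> co_isotypic n lam"
  proof (rule co_isotypic_complement[OF lam ne])
    show "v - orth_proj ?F v \<in> perm_module n lam"
      using mem full_specht_perm_module[OF lam] v by (intro fv.subspace_diff) auto
  qed (rule orth_proj_orth[OF fd])
  with mem show "orth_proj ?F v \<in> ?F \<and> v - orth_proj ?F v \<in> co_isotypic n lam" ..
  fix u assume u: "u \<in> ?F \<and> v - u \<in> co_isotypic n lam"
  have "orth_proj ?F v = u"
    by (rule orth_projI) (use u co_isotypic_orthogonal[OF lam ne] in auto)
  then show "u = orth_proj ?F v" ..
qed

section \<open>Replacing and appending letters\<close>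

lemma linear_append_letter: "Vector_Spaces.linear scalev scalev (append_letter a)"
  unfolding append_letter_def by (rule linear_lin_ext)

lemmas append_letter_add = fv2.linear_add[OF linear_append_letter]
  and append_letter_scale = fv2.linear_scale[OF linear_append_letter]
  and append_letter_sum = fv2.linear_sum[OF linear_append_letter]
  and append_letter_0 [simp] = fv2.linear_0[OF linear_append_letter]

lemma append_letter_bvec [simp]: "append_letter a (bvec w) = bvec (w @ [a])"
  by (simp add: append_letter_def)

lemma append_words [simp]: "w \<in> words n \<Longrightarrow> a \<in> {1..Suc n} \<Longrightarrow> w @ [a] \<in> words (Suc n)"
proof -
  assume w: "w \<in> words n" and a: "a \<in> {1..Suc n}"
  have "length w = n" "set w \<subseteq> {1..n}"
    using w unfolding words_def by blast+
  then have "length (w @ [a]) = Suc n" "set (w @ [a]) \<subseteq> {1..Suc n}"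
    using a by auto
  then show "w @ [a] \<in> words (Suc n)"
    unfolding words_def by blast
qed

lemma append_letter_word_module [simp]:
  assumes "v \<in> word_module n" "a \<in> {1..Suc n}"
  shows "append_letter a v \<in> word_module (Suc n)"
  using assms(1)
proof (induction rule: word_module_induct)
  case (step c w y)
  then show ?case
    using append_words[OF step(1) assms(2)] by (simp add: append_letter_add append_letter_scale)
qed simp

lemma append_letter_perm_module:
  assumes v: "v \<in> perm_module n lam" and lam: "lam \<in> partitions_of n" and a: "a \<in> {1..Suc n}"
  shows "append_letter a v \<in> perm_module (Suc n) (add_box lam a)"
  using v
proof (induction rule: perm_module_induct)
  case zero
  then show ?case
    by (simp add: fv.subspace_0)
next
  case (step c w y)
  have "count_list (w @ [a]) i = add_box lam a i" if i: "i \<in> {1..Suc n}" for i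
  proof -
    have "count_list w i = lam i"
    proof (cases "i \<in> {1..n}")
      case True
      then show ?thesis
        using step(1) unfolding content_words_def by blast
    next
      case False
      then have "i = Suc n"
        using i by simp
      moreover have "Suc n \<notin> set w"
        using step(1) unfolding content_words_def words_def by auto
      ultimately show ?thesis
        using lam partitions_of_zero[OF lam, of "Suc n"] by (auto simp: count_list_0_iff)
    qed
    then show ?thesis
      by (simp add: add_box_def)
  qed
  then have "w @ [a] \<in> content_words (Suc n) (add_box lam a)"
    unfolding content_words_def using append_words[OF content_words_words[OF step(1)] a] by blast
  with step show ?case
    by (simp add: append_letter_add append_letter_scale fv.subspace_add fv.subspace_scale)
qed

lemma act_append_letter:
  assumes \<sigma>: "\<sigma> \<in> Sym n" and v: "v \<in> word_module n"
  shows "act \<sigma> (append_letter a v) = append_letter a (act \<sigma> v)"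
  using v
proof (induction rule: word_module_induct)
  case (step c w y)
  have w: "length w = n"
    using step(1) by simp
  have "act_word \<sigma> (w @ [a]) = act_word \<sigma> w @ [a]"
  proof (rule word_eqI[of _ "Suc n"])
    fix k assume k: "k \<in> {1..Suc n}"
    show "act_word \<sigma> (w @ [a]) ! (k - 1) = (act_word \<sigma> w @ [a]) ! (k - 1)"
    proof (cases "k = Suc n")
      case True
      have "pinv \<sigma> (Suc n) = Suc n"
        using inv_Sym[OF \<sigma>] by (simp add: Sym_iff permutes_def)
      then show ?thesis
        using True w act_word_nth[of "w @ [a]" "Suc n" k \<sigma>] k by (simp add: nth_append)
    next
      case False
      then have kn: "k \<in> {1..n}"
        using k by auto
      then have "pinv \<sigma> k \<in> {1..n}"
        using \<sigma> by (simp del: atLeastAtMost_iff)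
      then have "pinv \<sigma> k - 1 < n" "k - 1 < n"
        using kn by auto
      then show ?thesis
        using w k kn act_word_nth[of "w @ [a]" "Suc n" k \<sigma>] act_word_nth[of w n k \<sigma>]
        by (simp add: nth_append del: atLeastAtMost_iff)
    qed
  qed (use w in simp_all)
  with step show ?case
    by (simp add: append_letter_add append_letter_scale act_add act_scale)
qed simp

text \<open>The sum over all ways of replacing one occurrence of \<open>b\<close> by \<open>a\<close>: the action of a matrix unit of
  \<open>gl\<^sub>n\<close> on tensors, which commutes with permutations of the positions.\<close>

definition replace_letter :: "nat \<Rightarrow> nat \<Rightarrow> (nat list \<Rightarrow>\<^sub>0 complex) \<Rightarrow> (nat list \<Rightarrow>\<^sub>0 complex)" where
  "replace_letter b a = lin_ext (\<lambda>w. \<Sum>p\<in>{p \<in> {1..length w}. w ! (p - 1) = b}. bvec (w[p - 1 := a]))"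

lemma linear_replace_letter: "Vector_Spaces.linear scalev scalev (replace_letter b a)"
  unfolding replace_letter_def by (rule linear_lin_ext)

lemmas replace_letter_add = fv2.linear_add[OF linear_replace_letter]
  and replace_letter_scale = fv2.linear_scale[OF linear_replace_letter]
  and replace_letter_sum = fv2.linear_sum[OF linear_replace_letter]
  and replace_letter_0 [simp] = fv2.linear_0[OF linear_replace_letter]

lemma replace_letter_bvec:
  assumes "length w = n"
  shows "replace_letter b a (bvec w) = (\<Sum>p\<in>{p \<in> {1..n}. w ! (p - 1) = b}. bvec (w[p - 1 := a]))"
  using assms by (simp add: replace_letter_def)

lemma update_words [simp]: "w \<in> words n \<Longrightarrow> a \<in> {1..n} \<Longrightarrow> w[p := a] \<in> words n"
  using set_update_subset_insert[of w p a] unfolding words_def by auto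

lemma nth_update_position:
  assumes "length w = n" "p \<in> {1..n}" "k \<in> {1..n}"
  shows "w[p - 1 := a] ! (k - 1) = (if k = p then a else w ! (k - 1))"
proof -
  have "p - 1 = k - 1 \<longleftrightarrow> k = p"
    using assms(2,3) by auto
  moreover have "p - 1 < length w"
    using assms(1,2) by auto
  ultimately show ?thesis
    by (simp add: nth_list_update)
qed

lemma replace_letter_act:
  assumes \<sigma>: "\<sigma> \<in> Sym n" and v: "v \<in> word_module n"
  shows "replace_letter b a (act \<sigma> v) = act \<sigma> (replace_letter b a v)"
  using v
proof (induction rule: word_module_induct)
  case (step c w y)
  have w: "length w = n"
    using step(1) by simp
  have "replace_letter b a (bvec (act_word \<sigma> w)) =
      (\<Sum>p\<in>{p \<in> {1..n}. w ! (pinv \<sigma> p - 1) = b}. bvec ((act_word \<sigma> w)[p - 1 := a]))"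
    using w by (subst replace_letter_bvec[of _ n])
      (auto simp: act_word_nth simp del: atLeastAtMost_iff intro!: sum.cong)
  also have "\<dots> = (\<Sum>p\<in>{p \<in> {1..n}. w ! (p - 1) = b}. bvec (act_word \<sigma> (w[p - 1 := a])))"
  proof (rule sum.reindex_bij_witness[of _ \<sigma> "pinv \<sigma>"])
    fix p assume p: "p \<in> {p \<in> {1..n}. w ! (pinv \<sigma> p - 1) = b}"
    then have pn: "p \<in> {1..n}" "pinv \<sigma> p \<in> {1..n}"
      using \<sigma> by (auto simp del: atLeastAtMost_iff)
    show "bvec (act_word \<sigma> (w[pinv \<sigma> p - 1 := a])) = bvec ((act_word \<sigma> w)[p - 1 := a])"
    proof (rule arg_cong[where f = bvec], rule word_eqI[of _ n])
      fix k assume k: "k \<in> {1..n}"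
      then have ki: "pinv \<sigma> k \<in> {1..n}"
        using \<sigma> by (simp del: atLeastAtMost_iff)
      have "pinv \<sigma> k = pinv \<sigma> p \<longleftrightarrow> k = p"
        using Sym_inv_simps(1)[OF \<sigma>] by metis
      then show "act_word \<sigma> (w[pinv \<sigma> p - 1 := a]) ! (k - 1) = (act_word \<sigma> w)[p - 1 := a] ! (k - 1)"
        using w k ki pn by (simp add: act_word_nth[of _ n] nth_update_position[of _ n] del: atLeastAtMost_iff)
    qed (use w in simp_all)
  qed (use \<sigma> in \<open>auto simp del: atLeastAtMost_iff\<close>)
  also have "\<dots> = act \<sigma> (replace_letter b a (bvec w))"
    by (simp add: replace_letter_bvec[OF w] act_sum)
  finally show ?case
    using step by (simp add: replace_letter_add replace_letter_scale act_add act_scale)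
qed simp

lemma replace_letter_col_antisym:
  assumes "v \<in> word_module n"
  shows "replace_letter b a (col_antisym n T v) = col_antisym n T (replace_letter b a v)"
  unfolding col_antisym_def replace_letter_sum replace_letter_scale
  by (intro sum.cong refl) (simp add: replace_letter_act[OF column_group_Sym assms])

lemma replace_letter_adjoint:
  assumes u: "u \<in> word_module n" and v: "v \<in> word_module n"
  shows "ip (replace_letter b a u) v = ip u (replace_letter a b v)"
  using u
proof (induction rule: word_module_induct)
  case (step c x y)
  have x: "length x = n"
    using step(1) by simp
  have "ip (replace_letter b a (bvec x)) v = ip (bvec x) (replace_letter a b v)"
    using v
  proof (induction rule: word_module_induct)
    case (step d z v)
    have z: "length z = n"
      using step(1) by simp
    have iff: "x ! (p - 1) = b \<and> x[p - 1 := a] = z \<longleftrightarrow> z ! (p - 1) = a \<and> z[p - 1 := b] = x"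
      if p: "p \<in> {1..n}" for p
    proof -
      have "p - 1 < n"
        using p by auto
      with x z show ?thesis
        by auto
    qed
    have "ip (replace_letter b a (bvec x)) (bvec z) =
        (\<Sum>p\<in>{1..n}. if x ! (p - 1) = b \<and> x[p - 1 := a] = z then 1 else 0)"
      unfolding replace_letter_bvec[OF x] ip_sum_left ip_bvec_left
      by (simp add: lookup_single when_def sum.inter_filter[symmetric] eq_commute[of z] if_distrib cong: if_cong)
    also have "\<dots> = (\<Sum>p\<in>{1..n}. if z ! (p - 1) = a \<and> z[p - 1 := b] = x then 1 else 0)"
      using iff by (intro sum.cong refl) (simp del: atLeastAtMost_iff)
    also have "\<dots> = ip (bvec x) (replace_letter a b (bvec z))"
      unfolding replace_letter_bvec[OF z] ip_sum_right ip_bvec_left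
      by (simp add: lookup_single when_def sum.inter_filter[symmetric] if_distrib cong: if_cong)
    finally show ?case
      using step by (simp add: replace_letter_add replace_letter_scale ip_add_right ip_scale_right)
  qed simp
  with step show ?case
    by (simp add: replace_letter_add replace_letter_scale ip_add_left ip_scale_left)
qed simp

text \<open>Moving a letter to a higher row of the tableau produces a repetition in its column.\<close>

lemma raising_full_specht:
  assumes lam: "lam \<in> partitions_of n" and ab: "1 \<le> a" "a < b" and v: "v \<in> full_specht n lam"
  shows "replace_letter b a v = 0"
  using v
proof (induction rule: full_specht_induct)
  case (step c T y)
  note T = step(1)
  let ?w = "tableau_word n T"
  have ww: "?w \<in> words n"
    using lam T by simp
  have "col_antisym n T (replace_letter b a (bvec ?w)) = 0"
    unfolding replace_letter_bvec[OF length_tableau_word] col_antisym_sum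
  proof (rule sum.neutral, rule ballI)
    fix p assume p: "p \<in> {p \<in> {1..n}. ?w ! (p - 1) = b}"
    then have pn: "p \<in> {1..n}" "row_of T p = b"
      using tableau_word_nth by auto
    define q where "q = T (a, col_of T p)"
    have bx: "(a, col_of T p) \<in> diagram lam"
      using diagram_up[OF lam box_of_entry(1)[OF T pn(1)]] ab pn(2) by simp
    have q: "q \<in> {1..n}" "row_of T q = a" "col_of T q = col_of T p"
      using tableau_entry_in[OF T bx] row_col_of_entry[OF T bx] by (simp_all add: q_def)
    have "p \<noteq> q"
      using q(2) pn(2) ab by auto
    have an: "a \<in> {1..n}"
      by (rule diagram_row_le[OF lam bx])
    show "col_antisym n T (bvec (?w[p - 1 := a])) = 0"
    proof (rule col_antisym_repeated_letter[OF T _ pn(1) q(1) \<open>p \<noteq> q\<close>])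
      show "?w[p - 1 := a] ! (p - 1) = ?w[p - 1 := a] ! (q - 1)"
        using pn(1) q \<open>p \<noteq> q\<close> by (simp add: nth_update_position[of _ n] tableau_word_nth del: atLeastAtMost_iff)
    qed (use ww an q in simp_all)
  qed
  then have "replace_letter b a (specht_vector n T) = 0"
    unfolding specht_vector_eq[OF T] using ww by (simp add: replace_letter_col_antisym)
  with step show ?case
    by (simp add: replace_letter_add replace_letter_scale)
qed simp

lemma replace_letter_same:
  assumes "v \<in> perm_module n lam" "a \<in> {1..n}"
  shows "replace_letter a a v = scalev (of_nat (lam a)) v"
  using assms(1)
proof (induction rule: perm_module_induct)
  case (step c w y)
  have w: "length w = n"
    using content_words_words[OF step(1)] by simp
  have "card {p \<in> {1..n}. w ! (p - 1) = a} = lam a"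
    using step(1) assms(2) count_list_positions[OF w, of a] unfolding content_words_def by auto
  moreover have "replace_letter a a (bvec w) = (\<Sum>p\<in>{p \<in> {1..n}. w ! (p - 1) = a}. scalev 1 (bvec w))"
    unfolding replace_letter_bvec[OF w] by (intro sum.cong refl) (auto simp: list_update_id)
  ultimately have "replace_letter a a (bvec w) = scalev (of_nat (lam a)) (bvec w)"
    unfolding fv.scale_sum_left[symmetric] by simp
  with step show ?case
    by (simp add: replace_letter_add replace_letter_scale fv.scale_right_distrib mult.commute)
qed simp

text \<open>The appended letter is one more occurrence of \<open>b\<close>, which accounts for the extra term.\<close>

lemma replace_append_letter:
  assumes "v \<in> word_module n"
  shows "replace_letter b a (append_letter b v) = append_letter b (replace_letter b a v) + append_letter a v"
  using assms
proof (induction rule: word_module_induct)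
  case (step c w y)
  have w: "length w = n"
    using step(1) by simp
  have pos: "{p \<in> {1..Suc n}. (w @ [b]) ! (p - 1) = b} = insert (Suc n) {p \<in> {1..n}. w ! (p - 1) = b}"
    using w by (auto simp: nth_append le_Suc_eq Suc_le_eq One_nat_def split: if_splits)
  have len: "length (w @ [b]) = Suc n"
    using w by simp
  have "replace_letter b a (bvec (w @ [b])) =
      bvec ((w @ [b])[Suc n - 1 := a]) + (\<Sum>p\<in>{p \<in> {1..n}. w ! (p - 1) = b}. bvec ((w @ [b])[p - 1 := a]))"
    unfolding replace_letter_bvec[OF len] pos by (subst sum.insert) auto
  also have "(w @ [b])[Suc n - 1 := a] = w @ [a]"
    using w by (simp add: list_update_append)
  also have "(\<Sum>p\<in>{p \<in> {1..n}. w ! (p - 1) = b}. bvec ((w @ [b])[p - 1 := a])) =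
      append_letter b (replace_letter b a (bvec w))"
    unfolding replace_letter_bvec[OF w] append_letter_sum
    using w by (intro sum.cong refl) (auto simp: list_update_append)
  finally show ?case
    using step by (simp add: replace_letter_add replace_letter_scale append_letter_add append_letter_scale
        fv.scale_right_distrib algebra_simps)
qed simp

section \<open>The shuffle element and its recursion\<close>

abbreviation Q_pairs :: "nat \<Rightarrow> (nat \<times> nat) set" where
  "Q_pairs n \<equiv> {(i, j). 1 \<le> i \<and> i \<le> j \<and> j \<le> n}"

lemma finite_Q_pairs: "finite (Q_pairs n)"
  by (rule finite_subset[of _ "{1..n} \<times> {1..n}"]) auto

lemma act_alg_Q:
  "act_alg (Q n) v = (\<Sum>(i, j)\<in>Q_pairs n. scalev (1 / of_nat j) (act (Transposition.transpose i j) v))"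
  unfolding act_alg_def Q_def lin_ext_sum by (intro sum.cong refl) (auto simp: lin_ext_scale)

lemma act_alg_scale: "act_alg (scalev c x) v = scalev c (act_alg x v)"
  unfolding act_alg_def by (rule lin_ext_scale)

lemma act_last_transposition:
  assumes w: "w \<in> words n" and i: "i \<in> {1..n}"
  shows "act (Transposition.transpose i (Suc n)) (bvec (w @ [a])) = append_letter (w ! (i - 1)) (bvec (w[i - 1 := a]))"
proof -
  let ?t = "Transposition.transpose i (Suc n)"
  have len: "length w = n"
    using w by simp
  have "act_word ?t (w @ [a]) = w[i - 1 := a] @ [w ! (i - 1)]"
  proof (rule word_eqI[of _ "Suc n"])
    fix k assume k: "k \<in> {1..Suc n}"
    have "act_word ?t (w @ [a]) ! (k - 1) = (w @ [a]) ! (?t k - 1)"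
      using act_word_nth[of "w @ [a]" "Suc n" k ?t] k len by (simp add: inv_transpose_eq)
    also have "\<dots> = (w[i - 1 := a] @ [w ! (i - 1)]) ! (k - 1)"
    proof -
      consider "k = Suc n" | "k = i" | "k \<in> {1..n}" "k \<noteq> i"
        using k by fastforce
      then show ?thesis
      proof cases
        case 1
        then show ?thesis
          using len i by (auto simp: nth_append)
      next
        case 2
        then show ?thesis
          using len i by (auto simp: nth_append)
      next
        case 3
        then have "?t k = k" "k - 1 < n"
          by (auto simp: Transposition.transpose_def)
        then show ?thesis
          using nth_update_position[OF len i 3(1), of a] 3(2) len by (simp add: nth_append)
      qed
    qed
    finally show "act_word ?t (w @ [a]) ! (k - 1) = (w[i - 1 := a] @ [w ! (i - 1)]) ! (k - 1)" .
  qed (use len in simp_all)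
  then show ?thesis
    by simp
qed

lemma sum_last_transpositions:
  assumes v: "v \<in> word_module n"
  shows "(\<Sum>i = 1..n. act (Transposition.transpose i (Suc n)) (append_letter a v)) =
    (\<Sum>b = 1..n. append_letter b (replace_letter b a v))"
  using v
proof (induction rule: word_module_induct)
  case (step c w y)
  have w: "length w = n" and ran: "(\<lambda>i. w ! (i - 1)) ` {1..n} \<subseteq> {1..n}"
    using step(1) unfolding words_iff by auto
  have "(\<Sum>i = 1..n. act (Transposition.transpose i (Suc n)) (append_letter a (bvec w))) =
      (\<Sum>i = 1..n. append_letter (w ! (i - 1)) (bvec (w[i - 1 := a])))"
    by (intro sum.cong refl) (simp only: append_letter_bvec[of a] act_last_transposition[OF step(1)])
  also have "\<dots> = (\<Sum>b = 1..n. \<Sum>i\<in>{i \<in> {1..n}. w ! (i - 1) = b}. append_letter (w ! (i - 1)) (bvec (w[i - 1 := a])))"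
    by (rule sum.group[OF _ _ ran, symmetric]) simp_all
  also have "\<dots> = (\<Sum>b = 1..n. append_letter b (replace_letter b a (bvec w)))"
    unfolding replace_letter_bvec[OF w] append_letter_sum by (intro sum.cong refl) auto
  finally show ?case
    using step(3) by (simp only: append_letter_add append_letter_scale replace_letter_add replace_letter_scale
        act_add act_scale sum.distrib fv.scale_sum_right[symmetric])
qed simp

text \<open>The new transpositions of \<open>Q\<^sub>n\<^sub>+\<^sub>1\<close> exchange the appended letter with one of the word.\<close>

lemma Q_append_letter:
  assumes v: "v \<in> word_module n" and a: "a \<in> {1..Suc n}"
  shows "act_alg (Q (Suc n)) (append_letter a v) = append_letter a (act_alg (Q n) v) +
    scalev (1 / of_nat (Suc n)) (append_letter a v + (\<Sum>b = 1..n. append_letter b (replace_letter b a v)))"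
proof -
  let ?g = "\<lambda>(i, j). scalev (1 / of_nat j) (act (Transposition.transpose i j) (append_letter a v))"
  have split: "Q_pairs (Suc n) = Q_pairs n \<union> (\<lambda>i. (i, Suc n)) ` {1..Suc n}"
    by (auto simp: le_Suc_eq)
  have "act_alg (Q (Suc n)) (append_letter a v) = sum ?g (Q_pairs n) + sum ?g ((\<lambda>i. (i, Suc n)) ` {1..Suc n})"
    unfolding act_alg_Q split by (rule sum.union_disjoint[OF finite_Q_pairs]) auto
  also have "sum ?g (Q_pairs n) = append_letter a (act_alg (Q n) v)"
    unfolding act_alg_Q append_letter_sum
    by (intro sum.cong refl) (auto simp: append_letter_scale act_append_letter[OF _ v])
  also have "sum ?g ((\<lambda>i. (i, Suc n)) ` {1..Suc n}) =
      scalev (1 / of_nat (Suc n)) (\<Sum>i = 1..Suc n. act (Transposition.transpose i (Suc n)) (append_letter a v))"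
    by (subst sum.reindex) (auto simp: inj_on_def fv.scale_sum_right o_def simp del: sum.cl_ivl_Suc)
  also have "(\<Sum>i = 1..Suc n. act (Transposition.transpose i (Suc n)) (append_letter a v)) =
      (\<Sum>i = 1..n. act (Transposition.transpose i (Suc n)) (append_letter a v)) +
      act (Transposition.transpose (Suc n) (Suc n)) (append_letter a v)"
    by simp
  also have "act (Transposition.transpose (Suc n) (Suc n)) (append_letter a v) = append_letter a v"
    using act_id[OF append_letter_word_module[OF v a]] by (simp add: transpose_eq_id_iff[THEN iffD2])
  finally show ?thesis
    by (simp add: sum_last_transpositions[OF v] add.commute)
qed

section \<open>Lifting eigenvectors\<close>

abbreviation specht_proj :: "nat \<Rightarrow> (nat \<Rightarrow> nat) \<Rightarrow> (nat list \<Rightarrow>\<^sub>0 complex) \<Rightarrow> (nat list \<Rightarrow>\<^sub>0 complex)" where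
  "specht_proj n lam \<equiv> orth_proj (full_specht n lam)"

lemma specht_proj_act:
  assumes lam: "lam \<in> partitions_of n" and \<sigma>: "\<sigma> \<in> Sym n" and u: "u \<in> word_module n"
  shows "specht_proj n lam (act \<sigma> u) = act \<sigma> (specht_proj n lam u)"
proof (rule orth_proj_eqI)
  note fd = fin_dim_full_specht[OF lam]
  show "fin_dim_subspace (full_specht n lam)"
    by (rule fd)
  have p: "specht_proj n lam u \<in> full_specht n lam"
    by (rule orth_proj_mem[OF fd])
  then show "act \<sigma> (specht_proj n lam u) \<in> full_specht n lam"
    by (rule act_full_specht[OF lam \<sigma>])
  fix x assume x: "x \<in> full_specht n lam"
  have x': "act (pinv \<sigma>) x \<in> full_specht n lam"
    by (rule act_full_specht[OF lam inv_Sym[OF \<sigma>] x])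
  show "ip (act \<sigma> (specht_proj n lam u)) x = ip (act \<sigma> u) x"
    unfolding ip_act_left[OF \<sigma> u full_specht_word_module[OF lam x]]
      ip_act_left[OF \<sigma> full_specht_word_module[OF lam p] full_specht_word_module[OF lam x]]
    by (rule ip_orth_proj(1)[OF fd x'])
qed

lemma specht_proj_Q:
  assumes lam: "lam \<in> partitions_of n" and u: "u \<in> word_module n"
  shows "specht_proj n lam (act_alg (Q n) u) = act_alg (Q n) (specht_proj n lam u)"
proof -
  note lin = linear_orth_proj[OF fin_dim_full_specht[OF lam]]
  show ?thesis
    unfolding act_alg_Q fv2.linear_sum[OF lin]
    by (intro sum.cong refl) (auto simp: fv2.linear_scale[OF lin] specht_proj_act[OF lam _ u])
qed

text \<open>Modulo vectors orthogonal to \<open>S\<^sup>\<mu>\<close>, the new transpositions act on an appended letter as a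
  scalar, the content of the added box.  Letters \<open>b\<close> below row \<open>a\<close> cannot be raised to \<open>a\<close>, letters
  \<open>a\<close> are counted, and lowering a letter \<open>b\<close> above row \<open>a\<close> is adjoint to raising \<open>a\<close> to \<open>b\<close> in
  \<open>S\<^sup>\<mu>\<close>, which leaves only the correction term from the appended letter.\<close>

lemma ip_sum_replace_append:
  assumes lam: "lam \<in> partitions_of n" and a: "a \<in> addable lam"
    and v: "v \<in> full_specht n lam" and x: "x \<in> full_specht (Suc n) (add_box lam a)"
  shows "ip (\<Sum>b = 1..n. append_letter b (replace_letter b a v)) x =
    (of_nat (lam a) - of_nat (a - 1)) * ip (append_letter a v) x"
proof -
  have an: "a \<in> {1..Suc n}"
    by (rule addable_le[OF lam a])
  note mu = add_box_partition[OF lam a]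
  note vw = full_specht_word_module[OF lam v]
  note xw = full_specht_word_module[OF mu x]
  have vM: "v \<in> perm_module n lam"
    using full_specht_perm_module[OF lam] v by blast
  have "ip (append_letter b (replace_letter b a v)) x =
      (if b = a then of_nat (lam a) else if b < a then -1 else 0) * ip (append_letter a v) x"
    if b: "b \<in> {1..n}" for b
  proof (cases rule: linorder_cases[of b a])
    case less
    have bw: "append_letter b v \<in> word_module (Suc n)"
      using vw b by (intro append_letter_word_module) auto
    have "append_letter b (replace_letter b a v) = replace_letter b a (append_letter b v) - append_letter a v"
      by (simp add: replace_append_letter[OF vw])
    moreover have "ip (replace_letter b a (append_letter b v)) x = ip (append_letter b v) (replace_letter a b x)"
      by (rule replace_letter_adjoint[OF bw xw])
    moreover have "replace_letter a b x = 0"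
      using b less by (intro raising_full_specht[OF mu _ _ x]) auto
    ultimately show ?thesis
      using less by (simp add: ip_diff_left)
  next
    case equal
    then show ?thesis
      using replace_letter_same[OF vM, of a] b by (simp add: append_letter_scale ip_scale_left)
  next
    case greater
    have "replace_letter b a v = 0"
      using an greater by (intro raising_full_specht[OF lam _ _ v]) auto
    then show ?thesis
      using greater by simp
  qed
  then have "ip (\<Sum>b = 1..n. append_letter b (replace_letter b a v)) x =
      (\<Sum>b = 1..n. if b = a then of_nat (lam a) else if b < a then -1 else 0) * ip (append_letter a v) x"
    unfolding ip_sum_left sum_distrib_right by (intro sum.cong refl) blast
  also have "(\<Sum>b = 1..n. if b = a then of_nat (lam a) else if b < a then -1 else 0 :: complex) =
      (\<Sum>b = 1..n. if b = a then of_nat (lam a) else 0) + (\<Sum>b = 1..n. if b < a then -1 else 0)"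
    unfolding sum.distrib[symmetric] by (intro sum.cong refl) auto
  also have "(\<Sum>b = 1..n. if b = a then of_nat (lam a) else 0 :: complex) = of_nat (lam a)"
  proof (cases "a \<in> {1..n}")
    case False
    then have "lam a = 0"
      using an partitions_of_zero[OF lam, of a] by auto
    then show ?thesis
      by simp
  qed simp
  also have "(\<Sum>b = 1..n. if b < a then -1 else 0 :: complex) = (\<Sum>b\<in>{1..<a}. -1)"
    using an by (intro sum.mono_neutral_cong_right) auto
  finally show ?thesis
    by simp
qed

text \<open>The summand \<open>1\<close> in the numerator comes from the trivial transposition \<open>(n+1 n+1)\<close> of \<open>Q\<^sub>n\<^sub>+\<^sub>1\<close>.\<close>

lemma lifted_eigenvector:
  assumes lam: "lam \<in> partitions_of n" and a: "a \<in> addable lam"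
    and v: "v \<in> full_specht n lam" and eig: "act_alg (Q n) v = scalev (of_real c) v"
  defines "u \<equiv> specht_proj (Suc n) (add_box lam a) (append_letter a v)"
  shows "act_alg (Q (Suc n)) u = scalev (of_real (c + (1 + real (lam a) - real (a - 1)) / real (Suc n))) u"
proof -
  have an: "a \<in> {1..Suc n}"
    by (rule addable_le[OF lam a])
  note mu = add_box_partition[OF lam a]
  note vw = full_specht_word_module[OF lam v]
  note fd = fin_dim_full_specht[OF mu]
  note lin = linear_orth_proj[OF fd]
  let ?S = "\<Sum>b = 1..n. append_letter b (replace_letter b a v)"
  let ?K = "of_nat (lam a) - of_nat (a - 1) :: complex"
  have S: "specht_proj (Suc n) (add_box lam a) ?S = scalev ?K u"
    unfolding u_def
    by (rule orth_proj_eqI[OF fd])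
      (simp_all add: fv.subspace_scale orth_proj_mem[OF fd] ip_scale_left ip_orth_proj(1)[OF fd]
        ip_sum_replace_append[OF lam a v])
  have "act_alg (Q (Suc n)) u =
      specht_proj (Suc n) (add_box lam a) (append_letter a (scalev (of_real c) v) +
        scalev (1 / of_nat (Suc n)) (append_letter a v + ?S))"
    unfolding u_def specht_proj_Q[OF mu append_letter_word_module[OF vw an], symmetric]
      Q_append_letter[OF vw an] eig ..
  also have "\<dots> = scalev (of_real c) u + scalev (1 / of_nat (Suc n)) (u + scalev ?K u)"
    unfolding fv2.linear_add[OF lin] fv2.linear_scale[OF lin] append_letter_scale S u_def ..
  also have "u + scalev ?K u = scalev (1 + ?K) u"
    by (simp add: fv.scale_left_distrib)
  also have "scalev (of_real c) u + scalev (1 / of_nat (Suc n)) (scalev (1 + ?K) u) =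
      scalev (of_real c + 1 / of_nat (Suc n) * (1 + ?K)) u"
    by (simp only: fv.scale_scale fv.scale_left_distrib[of "of_real c" "1 / of_nat (Suc n) * (1 + ?K)"])
  also have "of_real c + 1 / of_nat (Suc n) * (1 + ?K) =
      complex_of_real (c + (1 + real (lam a) - real (a - 1)) / real (Suc n))"
    by simp
  finally show ?thesis .
qed

subsection \<open>Lifting is injective\<close>

lemma row_col_of_extend:
  assumes a1: "a \<ge> 1" and T: "T \<in> tableaux n lam" and k: "k \<in> {1..n}"
  defines "T' \<equiv> T((a, Suc (lam a)) := Suc n)"
  shows "row_of T' k = row_of T k" "col_of T' k = col_of T k"
proof -
  note T' = tableaux_extend[OF a1 T, folded T'_def]
  note D = diagram_add_box[OF a1, of lam]
  have b: "(row_of T k, col_of T k) \<in> diagram lam" "T (row_of T k, col_of T k) = k"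
    by (rule box_of_entry[OF T k])+
  then have "T' (row_of T k, col_of T k) = k"
    using D(2) by (auto simp: T'_def)
  moreover have "(row_of T k, col_of T k) \<in> diagram (add_box lam a)"
    using b(1) by (simp add: D(1))
  ultimately show "row_of T' k = row_of T k" "col_of T' k = col_of T k"
    using row_col_of_entry[OF T'] by metis+
qed

lemma row_of_extend_last:
  assumes a1: "a \<ge> 1" and T: "T \<in> tableaux n lam"
  shows "row_of (T((a, Suc (lam a)) := Suc n)) (Suc n) = a"
    "col_of (T((a, Suc (lam a)) := Suc n)) (Suc n) = Suc (lam a)"
  using row_col_of_entry[OF tableaux_extend[OF a1 T], of a "Suc (lam a)"] diagram_add_box(1)[OF a1, of lam]
  by simp_all

text \<open>Among the terms of the polytabloid of the extended tableau, those ending with \<open>a\<close> form the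
  polytabloid of the original tableau: the box of \<open>n + 1\<close> is the only one of its column in row \<open>a\<close>.\<close>

lemma ip_append_letter_specht_vector:
  assumes lam: "lam \<in> partitions_of n" and a: "a \<in> addable lam"
    and T: "T \<in> tableaux n lam" and v: "v \<in> word_module n"
  shows "ip (append_letter a v) (specht_vector (Suc n) (T((a, Suc (lam a)) := Suc n))) = ip v (specht_vector n T)"
proof -
  have a1: "a \<ge> 1"
    using a by (simp add: addable_def)
  define T' where "T' = T((a, Suc (lam a)) := Suc n)"
  note T' = tableaux_extend[OF a1 T, folded T'_def]
  note ext = row_col_of_extend[OF a1 T, folded T'_def]
  note lst = row_of_extend_last[OF a1 T, folded T'_def]
  have words: "\<sigma> \<in> column_group (Suc n) T' \<and> tableau_word (Suc n) (\<sigma> \<circ> T') = w @ [a] \<longleftrightarrow>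
      \<sigma> \<in> column_group n T \<and> tableau_word n (\<sigma> \<circ> T) = w" if w: "length w = n" for \<sigma> w
  proof -
    have row: "row_of (\<sigma> \<circ> T') k = row_of T' (pinv \<sigma> k)" "pinv \<sigma> k \<in> {1..Suc n}"
      if "\<sigma> \<in> Sym (Suc n)" "k \<in> {1..Suc n}" for k
      using row_col_of_comp(1)[OF that(1) T', of "pinv \<sigma> k"] that by (simp_all del: atLeastAtMost_iff)
    have last: "pinv \<sigma> (Suc n) = Suc n"
      if \<sigma>: "\<sigma> \<in> column_group (Suc n) T'" and eq: "tableau_word (Suc n) (\<sigma> \<circ> T') = w @ [a]"
    proof -
      have \<sigma>S: "\<sigma> \<in> Sym (Suc n)"
        using \<sigma> by (rule column_group_Sym)
      let ?k = "pinv \<sigma> (Suc n)"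
      have k: "?k \<in> {1..Suc n}"
        by (rule row(2)[OF \<sigma>S]) simp
      have "row_of T' ?k = row_of (\<sigma> \<circ> T') (Suc n)"
        by (rule row(1)[OF \<sigma>S, symmetric]) simp
      also have "\<dots> = a"
        using tableau_word_nth[of "Suc n" "Suc n" "\<sigma> \<circ> T'"] eq w by (simp add: nth_append)
      finally have "row_of T' ?k = a" .
      moreover have "col_of T' ?k = col_of T' (Suc n)"
        using \<sigma> k unfolding column_group_iff[OF T'] using Sym_inv_simps(1)[OF \<sigma>S] by metis
      moreover have "T' (a, Suc (lam a)) = Suc n"
        by (simp add: T'_def)
      ultimately show ?thesis
        using box_of_entry(2)[OF T' k] lst(2) by simp
    qed
    have fixS: "\<sigma> \<in> Sym n" if "\<sigma> \<in> Sym (Suc n)" "pinv \<sigma> (Suc n) = Suc n"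
    proof -
      have "\<sigma> (Suc n) = Suc n"
        using Sym_inv_simps(1)[OF that(1), of "Suc n"] that(2) by simp
      then have "\<sigma> x = x" if "x \<in> {1..Suc n} - {1..n}" for x
        using that by (cases "x = Suc n") auto
      then show ?thesis
        using permutes_superset[OF that(1)[unfolded Sym_iff]] unfolding Sym_iff by blast
    qed
    have wds: "tableau_word (Suc n) (\<sigma> \<circ> T') = w @ [a] \<longleftrightarrow> tableau_word n (\<sigma> \<circ> T) = w"
      if \<sigma>: "\<sigma> \<in> Sym n"
    proof -
      have \<sigma>S: "\<sigma> \<in> Sym (Suc n)"
        by (rule Sym_mono[OF \<sigma>]) simp
      have fx: "pinv \<sigma> (Suc n) = Suc n"
        using inv_Sym[OF \<sigma>] by (simp add: Sym_iff permutes_def)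
      have "tableau_word (Suc n) (\<sigma> \<circ> T') = tableau_word n (\<sigma> \<circ> T) @ [a]"
      proof (rule word_eqI[of _ "Suc n"])
        fix k assume k: "k \<in> {1..Suc n}"
        show "tableau_word (Suc n) (\<sigma> \<circ> T') ! (k - 1) = (tableau_word n (\<sigma> \<circ> T) @ [a]) ! (k - 1)"
        proof (cases "k = Suc n")
          case True
          then show ?thesis
            using tableau_word_nth[OF k, of "\<sigma> \<circ> T'"] row(1)[OF \<sigma>S k] fx lst(1) by (simp add: nth_append)
        next
          case False
          then have kn: "k \<in> {1..n}"
            using k by auto
          then have kn: "k \<in> {1..n}" "pinv \<sigma> k \<in> {1..n}"
            using Sym_in[OF inv_Sym[OF \<sigma>], of k] by blast+
          then have "k - 1 < n"
            by auto
          moreover have "row_of (\<sigma> \<circ> T) k = row_of T (pinv \<sigma> k)"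
            using row_col_of_comp(1)[OF \<sigma> T kn(2)] \<sigma> by simp
          ultimately show ?thesis
            using tableau_word_nth[OF k, of "\<sigma> \<circ> T'"] tableau_word_nth[OF kn(1), of "\<sigma> \<circ> T"]
              row(1)[OF \<sigma>S k] ext(1)[OF kn(2)] by (simp add: nth_append)
        qed
      qed simp_all
      then show ?thesis
        by simp
    qed
    have grp: "\<sigma> \<in> column_group (Suc n) T' \<longleftrightarrow> \<sigma> \<in> column_group n T" if \<sigma>: "\<sigma> \<in> Sym n"
    proof -
      have \<sigma>S: "\<sigma> \<in> Sym (Suc n)"
        by (rule Sym_mono[OF \<sigma>]) simp
      have "\<sigma> (Suc n) = Suc n"
        using \<sigma> by (simp add: Sym_iff permutes_def)
      then have "(\<forall>k\<in>{1..Suc n}. col_of T' (\<sigma> k) = col_of T' k) \<longleftrightarrow> (\<forall>k\<in>{1..n}. col_of T' (\<sigma> k) = col_of T' k)"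
        by (auto simp: le_Suc_eq)
      also have "\<dots> \<longleftrightarrow> (\<forall>k\<in>{1..n}. col_of T (\<sigma> k) = col_of T k)"
        using ext(2) \<sigma> by (intro ball_cong refl) (simp del: atLeastAtMost_iff)
      finally show ?thesis
        unfolding column_group_iff[OF T'] column_group_iff[OF T] using \<sigma> \<sigma>S by blast
    qed
    show ?thesis
      using last fixS wds grp column_group_Sym[of \<sigma> n T] column_group_Sym[of \<sigma> "Suc n" T'] by blast
  qed
  show ?thesis
    unfolding T'_def[symmetric]
    using v
  proof (induction rule: word_module_induct)
    case (step c w y)
    have len: "length w = n"
      using step(1) by simp
    have "Poly_Mapping.lookup (specht_vector (Suc n) T') (w @ [a]) =
        (\<Sum>\<sigma>\<in>{\<sigma> \<in> column_group (Suc n) T'. tableau_word (Suc n) (\<sigma> \<circ> T') = w @ [a]}. of_int (sign \<sigma>))"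
      by (auto simp: specht_vector_def lookup_sum lookup_single when_def if_distrib sum.inter_filter cong: if_cong)
    also have "{\<sigma> \<in> column_group (Suc n) T'. tableau_word (Suc n) (\<sigma> \<circ> T') = w @ [a]} =
        {\<sigma> \<in> column_group n T. tableau_word n (\<sigma> \<circ> T) = w}"
      using words[OF len] by blast
    also have "(\<Sum>\<sigma>\<in>{\<sigma> \<in> column_group n T. tableau_word n (\<sigma> \<circ> T) = w}. of_int (sign \<sigma>)) =
        Poly_Mapping.lookup (specht_vector n T) w"
      by (auto simp: specht_vector_def lookup_sum lookup_single when_def if_distrib sum.inter_filter cong: if_cong)
    finally have "ip (bvec (w @ [a])) (specht_vector (Suc n) T') = ip (bvec w) (specht_vector n T)"
      by (simp add: ip_bvec_left)
    with step show ?case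
      by (simp add: append_letter_add append_letter_scale ip_add_left ip_scale_left)
  qed simp
qed

lemma lifting_nonzero:
  assumes lam: "lam \<in> partitions_of n" and a: "a \<in> addable lam"
    and v: "v \<in> full_specht n lam" "v \<noteq> 0"
  shows "specht_proj (Suc n) (add_box lam a) (append_letter a v) \<noteq> 0"
proof -
  obtain T where T: "T \<in> tableaux n lam" "ip v (specht_vector n T) \<noteq> 0"
    using full_specht_separated[OF v] .
  have a1: "a \<ge> 1"
    using a by (simp add: addable_def)
  have "ip (append_letter a v) (specht_vector (Suc n) (T((a, Suc (lam a)) := Suc n))) \<noteq> 0"
    using ip_append_letter_specht_vector[OF lam a T(1) full_specht_word_module[OF lam v(1)]] T(2) by simp
  moreover have "specht_vector (Suc n) (T((a, Suc (lam a)) := Suc n)) \<in> full_specht (Suc n) (add_box lam a)"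
    by (rule specht_vector_full_specht[OF tableaux_extend[OF a1 T(1)]])
  ultimately show ?thesis
    unfolding orth_proj_eq_0_iff[OF fin_dim_full_specht[OF add_box_partition[OF lam a]]] by blast
qed

subsection \<open>Lifting preserves orthogonality\<close>

lemma invariant_form_lifting:
  assumes mu: "mu \<in> partitions_of (Suc n)" and a: "a \<in> {1..Suc n}" "a' \<in> {1..Suc n}"
  shows "invariant_form n (\<lambda>x y. ip (specht_proj (Suc n) mu (append_letter a x)) (specht_proj (Suc n) mu (append_letter a' y)))"
  unfolding invariant_form_def
proof (intro conjI allI ballI)
  note fd = fin_dim_full_specht[OF mu]
  note lin = linear_orth_proj[OF fd]
  let ?p = "specht_proj (Suc n) mu"
  fix u u' v v' :: "nat list \<Rightarrow>\<^sub>0 complex" and c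
  show "ip (?p (append_letter a (u + u'))) (?p (append_letter a' v)) =
      ip (?p (append_letter a u)) (?p (append_letter a' v)) + ip (?p (append_letter a u')) (?p (append_letter a' v))"
    by (simp only: append_letter_add fv2.linear_add[OF lin] ip_add_left)
  show "ip (?p (append_letter a (scalev c u))) (?p (append_letter a' v)) = c * ip (?p (append_letter a u)) (?p (append_letter a' v))"
    by (simp only: append_letter_scale fv2.linear_scale[OF lin] ip_scale_left)
  show "ip (?p (append_letter a u)) (?p (append_letter a' (v + v'))) =
      ip (?p (append_letter a u)) (?p (append_letter a' v)) + ip (?p (append_letter a u)) (?p (append_letter a' v'))"
    by (simp only: append_letter_add fv2.linear_add[OF lin] ip_add_right)
  show "ip (?p (append_letter a u)) (?p (append_letter a' (scalev c v))) = cnj c * ip (?p (append_letter a u)) (?p (append_letter a' v))"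
    by (simp only: append_letter_scale fv2.linear_scale[OF lin] ip_scale_right)
  fix \<sigma> assume \<sigma>: "\<sigma> \<in> Sym n" and u: "u \<in> word_module n" and v: "v \<in> word_module n"
  have \<sigma>S: "\<sigma> \<in> Sym (Suc n)"
    by (rule Sym_mono[OF \<sigma>]) simp
  have mem: "?p w \<in> word_module (Suc n)" for w
    by (rule full_specht_word_module[OF mu orth_proj_mem[OF fd]])
  show "ip (?p (append_letter a (act \<sigma> u))) (?p (append_letter a' (act \<sigma> v))) = ip (?p (append_letter a u)) (?p (append_letter a' v))"
    using u v a by (simp add: act_append_letter[OF \<sigma>, symmetric] specht_proj_act[OF mu \<sigma>S] ip_act[OF \<sigma>S mem mem]
        del: atLeastAtMost_iff)
qed

text \<open>If the boxes were added to different shapes, Schur's lemma makes the images orthogonal; if they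
  were added to the same shape, it says that lifting multiplies inner products by a constant.\<close>

lemma lifting_orthogonal:
  assumes lam: "lam \<in> partitions_of n" "lam' \<in> partitions_of n"
    and a: "a \<in> addable lam" "a' \<in> addable lam'" and eq: "add_box lam a = add_box lam' a'"
    and x: "x \<in> full_specht n lam" and y: "y \<in> full_specht n lam'" and o: "lam = lam' \<Longrightarrow> ip x y = 0"
  shows "ip (specht_proj (Suc n) (add_box lam a) (append_letter a x))
    (specht_proj (Suc n) (add_box lam' a') (append_letter a' y)) = 0"
proof -
  note inv = invariant_form_lifting[OF add_box_partition[OF lam(1) a(1)] addable_le[OF lam(1) a(1)] addable_le[OF lam(2) a(2)]]
  show ?thesis
    unfolding eq[symmetric]
  proof (cases "lam = lam'")
    case False
    then show "ip (specht_proj (Suc n) (add_box lam a) (append_letter a x))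
        (specht_proj (Suc n) (add_box lam a) (append_letter a' y)) = 0"
      by (rule form_different_shapes[OF inv lam _ x y])
  next
    case True
    obtain K where "\<And>x y. x \<in> full_specht n lam \<Longrightarrow> y \<in> full_specht n lam \<Longrightarrow>
        ip (specht_proj (Suc n) (add_box lam a) (append_letter a x))
        (specht_proj (Suc n) (add_box lam a) (append_letter a' y)) = K * ip x y"
      using form_same_shape[OF inv lam(1)] by metis
    then show "ip (specht_proj (Suc n) (add_box lam a) (append_letter a x))
        (specht_proj (Suc n) (add_box lam a) (append_letter a' y)) = 0"
      using x y o True by simp
  qed
qed

section \<open>The vectors of standard tableaux\<close>

lemma subshape_full:
  assumes lam: "lam \<in> partitions_of n" and T: "T \<in> tableaux n lam"
  shows "subshape T n = lam"
proof
  fix i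
  have "{j. T (i, j) \<in> {1..n}} = {j. (i, j) \<in> diagram lam}"
    using tableau_entry_in[OF T] tableau_pos_imp_diagram[OF T] by blast
  moreover have "card {j. (i, j) \<in> diagram lam} = lam i"
  proof (cases "i = 0")
    case True
    then show ?thesis
      using lam by (simp add: diagram_def partitions_of_def)
  next
    case False
    then have "{j. (i, j) \<in> diagram lam} = {1..lam i}"
      by (auto simp: diagram_def)
    then show ?thesis
      by simp
  qed
  ultimately show "subshape T n i = lam i"
    by (simp add: subshape_def)
qed

text \<open>The vectors of the first steps depend only on the positions of the entries up to \<open>n\<close>.\<close>

lemma lift_vec_restrict:
  assumes b: "T b = Suc n" and "m \<le> n"
  shows "lift_vec (T(b := 0)) m = lift_vec T m"
proof -
  define T0 where "T0 = T(b := 0)"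
  have same: "T0 b' = k \<longleftrightarrow> T b' = k" if "k \<in> {1..n}" for b' k
    using that b by (auto simp: T0_def)
  have row: "row_of T0 k = row_of T k" if "k \<in> {1..n}" for k
    unfolding row_of_def same[OF that] ..
  have shape: "subshape T0 k = subshape T k" if "k \<le> n" for k
  proof -
    have "T0 b' \<in> {1..k} \<longleftrightarrow> T b' \<in> {1..k}" for b'
      using that b by (auto simp: T0_def)
    then show ?thesis
      unfolding subshape_def by simp
  qed
  have "lift_vec T0 m = lift_vec T m"
    using assms(2)
  proof (induction m)
    case (Suc m)
    then show ?case
      by (cases m) (simp_all add: row shape)
  qed simp
  then show ?thesis
    by (simp only: T0_def)
qed

lemma lift_vec_step:
  assumes n: "n \<ge> 1" and mu: "mu \<in> partitions_of (Suc n)" and T: "T \<in> SYT (Suc n) mu"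
    and v: "lift_vec (T((row_of T (Suc n), mu (row_of T (Suc n))) := 0)) n
      \<in> full_specht n (remove_box mu (row_of T (Suc n)))" (is "?v \<in> full_specht n ?lam")
  shows "lift_vec T (Suc n) = specht_proj (Suc n) mu (append_letter (row_of T (Suc n)) ?v)"
proof -
  let ?a = "row_of T (Suc n)"
  note last = SYT_last_box[OF mu T]
  obtain m where m: "n = Suc m"
    using n by (cases n) auto
  have "lift_vec T (Suc n) = lifting (Suc n) mu ?a (lift_vec T n)"
    using subshape_full[OF mu SYT_tableaux[OF T]] by (simp add: m)
  also have "lift_vec T n = ?v"
    using lift_vec_restrict[of T _ n, OF last(2)] by simp
  also have "lifting (Suc n) mu ?a ?v = specht_proj (Suc n) mu (append_letter ?a ?v)"
    unfolding lifting_def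
  proof (rule isotypic_proj_eq_orth_proj[OF mu])
    show "tableaux (Suc n) mu \<noteq> {}"
      using SYT_tableaux[OF T] by blast
    note lam = remove_box_partition[OF mu last(1)]
    have "append_letter ?a ?v \<in> perm_module (Suc n) (add_box ?lam ?a)"
      using full_specht_perm_module[OF lam] v removable_le[OF mu last(1)]
      by (intro append_letter_perm_module[OF _ lam]) auto
    then show "append_letter ?a ?v \<in> perm_module (Suc n) mu"
      by (simp add: add_remove_box[OF last(1)])
  qed
  finally show ?thesis .
qed

lemma lift_vec_one:
  assumes lam: "lam \<in> partitions_of 1" and T: "T \<in> SYT 1 lam"
  shows "lift_vec T 1 = specht_vector 1 T" "row_of T 1 = 1"
proof -
  note T' = SYT_tableaux[OF T]
  show row: "row_of T 1 = 1"
    using diagram_row_le[OF lam box_of_entry(1)[OF T', of 1]] by simp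
  have "tableau_word 1 T = [1]"
  proof (rule word_eqI[of _ 1])
    fix k :: nat assume "k \<in> {1..1}"
    then show "tableau_word 1 T ! (k - 1) = [1] ! (k - 1)"
      using tableau_word_nth[of k 1 T] row by simp
  qed simp_all
  moreover have "Sym 1 = {id}"
    using card_Sym[of 1] id_Sym(1)[of 1] by (metis card_1_singletonE fact_1 singletonD)
  then have "column_group 1 T = {id}"
    using column_group_closed(1)[OF T'] column_group_Sym by blast
  ultimately show "lift_vec T 1 = specht_vector 1 T"
    by (simp add: specht_vector_def sign_id One_nat_def)
qed

theorem lift_vec_eigenvector:
  assumes "n \<ge> 1" "lam \<in> partitions_of n" "T \<in> SYT n lam"
  shows "lift_vec T n \<in> full_specht n lam \<and> lift_vec T n \<noteq> 0 \<and>
    (\<exists>c :: real. act_alg (Q n) (lift_vec T n) = scalev (of_real c) (lift_vec T n))"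
  using assms
proof (induction n arbitrary: lam T rule: nat_induct_at_least)
  case (base lam T)
  note T = SYT_tableaux[OF base(2)]
  have "Q_pairs 1 = {(1, 1)}"
    by auto
  then have "act_alg (Q 1) (specht_vector 1 T) = act (Transposition.transpose 1 1) (specht_vector 1 T)"
    by (simp add: act_alg_Q)
  also have "\<dots> = specht_vector 1 T"
    using act_id[OF full_specht_word_module[OF base(1) specht_vector_full_specht[OF T]]]
    by (simp add: transpose_eq_id_iff[THEN iffD2])
  finally have "act_alg (Q 1) (specht_vector 1 T) = scalev (of_real 1) (specht_vector 1 T)"
    by simp
  then show ?case
    unfolding lift_vec_one(1)[OF base] using specht_vector_full_specht[OF T] specht_vector_nonzero[OF base(1) T] by blast
next
  case (Suc n mu T)
  let ?a = "row_of T (Suc n)"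
  let ?lam = "remove_box mu ?a" and ?T = "T((?a, mu ?a) := 0)"
  note last = SYT_last_box[OF Suc.prems]
  note lam = remove_box_partition[OF Suc.prems(1) last(1)]
  note a = addable_remove_box[OF Suc.prems(1) last(1)]
  obtain c :: real where v: "lift_vec ?T n \<in> full_specht n ?lam" "lift_vec ?T n \<noteq> 0"
      "act_alg (Q n) (lift_vec ?T n) = scalev (of_real c) (lift_vec ?T n)"
    using Suc.IH[OF lam SYT_restrict[OF Suc.prems]] by blast
  have st: "lift_vec T (Suc n) = specht_proj (Suc n) (add_box ?lam ?a) (append_letter ?a (lift_vec ?T n))"
    using lift_vec_step[OF Suc.hyps Suc.prems v(1)] by (simp add: add_remove_box[OF last(1)])
  have "lift_vec T (Suc n) \<in> full_specht (Suc n) mu"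
    using orth_proj_mem[OF fin_dim_full_specht[OF Suc.prems(1)]] st by (simp add: add_remove_box[OF last(1)])
  moreover have "lift_vec T (Suc n) \<noteq> 0"
    unfolding st by (rule lifting_nonzero[OF lam a v(1,2)])
  ultimately show ?case
    using lifted_eigenvector[OF lam a v(1,3)] unfolding st[symmetric] by blast
qed

text \<open>Two tableaux of the same shape differ either in the box of the largest entry, and then the
  shapes before the last lifting differ, or in the tableaux before the last lifting.\<close>

theorem lift_vec_orthogonal:
  assumes "n \<ge> 1" "lam \<in> partitions_of n" "T \<in> SYT n lam" "U \<in> SYT n lam" "T \<noteq> U"
  shows "ip (lift_vec T n) (lift_vec U n) = 0"
  using assms
proof (induction n arbitrary: lam T U rule: nat_induct_at_least)
  case (base lam T U)
  have "T = U"
    using lift_vec_one(2)[OF base(1,2)] lift_vec_one(2)[OF base(1,3)]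
    by (intro SYT_determined_by_rows[OF base(1-3)]) (metis atLeastAtMost_singleton singletonD)
  with base(4) show ?case ..
next
  case (Suc n mu T U)
  let ?a = "\<lambda>V. row_of V (Suc n)"
  let ?lam = "\<lambda>V. remove_box mu (?a V)" and ?r = "\<lambda>V. V((?a V, mu (?a V)) := 0)"
  have last: "?a V \<in> removable mu" "V (?a V, mu (?a V)) = Suc n" "?lam V \<in> partitions_of n"
    "?a V \<in> addable (?lam V)" "?r V \<in> SYT n (?lam V)" "lift_vec (?r V) n \<in> full_specht n (?lam V)"
    "lift_vec V (Suc n) = specht_proj (Suc n) (add_box (?lam V) (?a V)) (append_letter (?a V) (lift_vec (?r V) n))"
    "add_box (?lam V) (?a V) = mu"
    if V: "V \<in> SYT (Suc n) mu" for V
  proof -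
    show l: "?a V \<in> removable mu" "V (?a V, mu (?a V)) = Suc n"
      by (rule SYT_last_box[OF Suc.prems(1) V])+
    show p: "?lam V \<in> partitions_of n" "?a V \<in> addable (?lam V)"
      by (rule remove_box_partition[OF Suc.prems(1) l(1)], rule addable_remove_box[OF Suc.prems(1) l(1)])
    show r: "?r V \<in> SYT n (?lam V)"
      by (rule SYT_restrict[OF Suc.prems(1) V])
    show v: "lift_vec (?r V) n \<in> full_specht n (?lam V)"
      using lift_vec_eigenvector[OF Suc.hyps p(1) r] by blast
    show m: "add_box (?lam V) (?a V) = mu"
      by (rule add_remove_box[OF l(1)])
    show "lift_vec V (Suc n) = specht_proj (Suc n) (add_box (?lam V) (?a V)) (append_letter (?a V) (lift_vec (?r V) n))"
      unfolding m by (rule lift_vec_step[OF Suc.hyps Suc.prems(1) V v])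
  qed
  note lT = last[OF Suc.prems(2)] and lU = last[OF Suc.prems(3)]
  show ?case
    unfolding lT(7) lU(7)
  proof (rule lifting_orthogonal[OF lT(3) lU(3) lT(4) lU(4) _ lT(6) lU(6)])
    show "add_box (?lam T) (?a T) = add_box (?lam U) (?a U)"
      unfolding lT(8) lU(8) ..
    assume eq: "?lam T = ?lam U"
    have aeq: "?a T = ?a U"
    proof (rule ccontr)
      assume ne: "?a T \<noteq> ?a U"
      have "?lam U (?a T) = mu (?a T)"
        using ne by (simp add: remove_box_def)
      moreover have "?lam T (?a T) < mu (?a T)"
        using lT(1) by (simp add: remove_box_def removable_def)
      ultimately show False
        using eq by simp
    qed
    have "?r T \<noteq> ?r U"
    proof
      assume "?r T = ?r U"
      then have "(?r T)((?a T, mu (?a T)) := Suc n) = (?r U)((?a T, mu (?a T)) := Suc n)"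
        by simp
      then have "T = U"
        using lT(2) lU(2) aeq by (metis fun_upd_triv fun_upd_upd)
      with Suc.prems(4) show False ..
    qed
    have "?r U \<in> SYT n (?lam T)"
      unfolding eq by (rule lU(5))
    then show "ip (lift_vec (?r T) n) (lift_vec (?r U) n) = 0"
      using \<open>?r T \<noteq> ?r U\<close> by (rule Suc.IH[OF lT(3,5)])
  qed
qed

section \<open>The walk on the symmetric group\<close>

lemma proots_char_poly_orthogonal_eigenvectors:
  fixes A :: "complex mat"
  assumes A: "A \<in> carrier_mat N N"
    and eig: "\<And>k j. k < N \<Longrightarrow> j < N \<Longrightarrow> (\<Sum>l<N. A $$ (k, l) * f j l) = c j * f j k"
    and orth: "\<And>i j. i < N \<Longrightarrow> j < N \<Longrightarrow> i \<noteq> j \<Longrightarrow> (\<Sum>k<N. f j k * cnj (f i k)) = 0"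
    and nz: "\<And>i. i < N \<Longrightarrow> (\<Sum>k<N. f i k * cnj (f i k)) \<noteq> 0"
  shows "proots (char_poly A) = mset (map c [0..<N])"
proof -
  define S where "S = mat N N (\<lambda>(k, j). f j k)"
  \<comment> \<open>The columns of \<open>S\<close> are the eigenvectors; rescaling its adjoint gives its inverse \<open>R\<close>.\<close>
  define R where "R = mat N N (\<lambda>(i, k). cnj (f i k) / (\<Sum>k<N. f i k * cnj (f i k)))"
  define D where "D = mat N N (\<lambda>(i, j). if i = j then c i else 0)"
  have carr: "S \<in> carrier_mat N N" "R \<in> carrier_mat N N" "D \<in> carrier_mat N N"
    by (simp_all add: S_def R_def D_def)
  have RS: "R * S = 1\<^sub>m N"
  proof (rule eq_matI)
    fix i j assume "i < dim_row (1\<^sub>m N)" "j < dim_col (1\<^sub>m N)"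
    then have ij: "i < N" "j < N" by auto
    have "(R * S) $$ (i, j) = (\<Sum>k<N. f j k * cnj (f i k)) / (\<Sum>k<N. f i k * cnj (f i k))"
      using ij by (simp add: R_def S_def scalar_prod_def sum_divide_distrib atLeast0LessThan mult.commute)
    then show "(R * S) $$ (i, j) = 1\<^sub>m N $$ (i, j)"
      using ij orth[of i j] nz[of i] by auto
  qed (simp_all add: R_def S_def)
  have SR: "S * R = 1\<^sub>m N"
    by (rule mat_mult_left_right_inverse[OF carr(2,1) RS])
  have "A * S = S * D"
  proof (rule eq_matI)
    fix k j assume "k < dim_row (S * D)" "j < dim_col (S * D)"
    then have kj: "k < N" "j < N"
      by (simp_all add: S_def D_def)
    have "(A * S) $$ (k, j) = c j * f j k"
      using A kj eig[OF kj] by (simp add: S_def scalar_prod_def atLeast0LessThan)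
    also have "\<dots> = (\<Sum>l\<in>{j}. f l k * (if l = j then c l else 0))"
      by simp
    also have "\<dots> = (\<Sum>l<N. f l k * (if l = j then c l else 0))"
      using kj by (intro sum.mono_neutral_left) auto
    also have "\<dots> = (S * D) $$ (k, j)"
      using kj by (simp add: S_def D_def scalar_prod_def atLeast0LessThan)
    finally show "(A * S) $$ (k, j) = (S * D) $$ (k, j)" .
  qed (use A in \<open>simp_all add: S_def D_def\<close>)
  then have "A = S * D * R"
    using SR A carr by (metis assoc_mult_mat right_mult_one_mat)
  then have "similar_mat A D"
    using A carr SR RS by (intro similar_matI[of A D S R N]) auto
  then have "char_poly A = char_poly D"
    by (rule char_poly_similar)
  also have "\<dots> = (\<Prod>a\<leftarrow>diag_mat D. [:- a, 1:])"
    using carr(3) by (rule char_poly_upper_triangular) (auto simp: upper_triangular_def D_def)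
  also have "diag_mat D = map c [0..<N]"
    by (auto simp: diag_mat_def D_def)
  finally have eq: "char_poly A = (\<Prod>a\<leftarrow>map c [0..<N]. [:- a, 1:])" .
  have "proots (\<Prod>a\<leftarrow>as. [:- a, 1:]) = mset as" for as :: "complex list"
  proof (induction as)
    case (Cons a as)
    have "(\<Prod>a\<leftarrow>as. [:- a, 1:]) \<noteq> (0 :: complex poly)"
      by (auto simp: prod_list_zero_iff)
    then show ?case
      using Cons proots_mult[of "[:- a, 1:]" "\<Prod>a\<leftarrow>as. [:- a, 1:]"] by simp
  qed simp
  then show ?thesis
    by (simp only: eq)
qed

lemma act_alg_walk:
  "act_alg (scalev (1 / of_nat n) (Q n)) x = (\<Sum>\<tau>\<in>Sym n. scalev (of_real (P n \<tau>)) (act \<tau> x))"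
proof -
  have outside: "Poly_Mapping.lookup (Q n) \<tau> = 0" if "\<tau> \<notin> Sym n" for \<tau>
  proof -
    have "Transposition.transpose i j \<noteq> \<tau>" if "(i, j) \<in> Q_pairs n" for i j
      using that \<open>\<tau> \<notin> Sym n\<close> transpose_Sym[of i n j] by auto
    then show ?thesis
      unfolding Q_def lookup_sum by (intro sum.neutral) (auto simp: lookup_single when_def)
  qed
  have "Poly_Mapping.keys (scalev (1 / of_nat n) (Q n)) \<subseteq> Sym n"
  proof
    fix \<tau> assume "\<tau> \<in> Poly_Mapping.keys (scalev (1 / of_nat n) (Q n))"
    then have "Poly_Mapping.lookup (Q n) \<tau> \<noteq> 0"
      by (simp add: in_keys_iff)
    with outside show "\<tau> \<in> Sym n"
      by blast
  qed
  then show ?thesis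
    unfolding act_alg_def by (subst lin_ext_superset[OF finite_Sym]) (simp_all only: lookup_Q)
qed

lemma walk_self_adjoint:
  assumes "x \<in> word_module n" "y \<in> word_module n"
  shows "ip (act_alg (scalev (1 / of_nat n) (Q n)) x) y = ip x (act_alg (scalev (1 / of_nat n) (Q n)) y)"
proof -
  have "ip (act_alg (Q n) x) y = ip x (act_alg (Q n) y)"
    unfolding act_alg_Q ip_sum_left ip_sum_right
  proof (intro sum.cong refl)
    fix p assume "p \<in> Q_pairs n"
    then obtain i j where p: "p = (i, j)" "i \<in> {1..n}" "j \<in> {1..n}"
      by auto
    have "ip (act (Transposition.transpose i j) x) y = ip x (act (Transposition.transpose i j) y)"
      using ip_act_left[OF transpose_Sym[OF p(2,3)] assms] by (simp add: inv_transpose_eq)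
    then show "ip (case p of (i, j) \<Rightarrow> scalev (1 / of_nat j) (act (Transposition.transpose i j) x)) y =
        ip x (case p of (i, j) \<Rightarrow> scalev (1 / of_nat j) (act (Transposition.transpose i j) y))"
      by (simp add: p(1) ip_scale_left ip_scale_right)
  qed
  then show ?thesis
    by (simp add: act_alg_scale ip_scale_left ip_scale_right)
qed

text \<open>The eigenvalue is real, so it may be taken out of either argument of the inner product.\<close>

lemma eig_eigenvalue:
  assumes n: "n \<ge> 1" and lam: "lam \<in> partitions_of n" and T: "T \<in> SYT n lam"
  shows "act_alg (scalev (1 / of_nat n) (Q n)) (lift_vec T n) = scalev (eig n T) (lift_vec T n)"
    and "cnj (eig n T) = eig n T"
proof -
  obtain c :: real where v: "lift_vec T n \<noteq> 0" "act_alg (Q n) (lift_vec T n) = scalev (of_real c) (lift_vec T n)"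
    using lift_vec_eigenvector[OF assms] by blast
  have e: "act_alg (scalev (1 / of_nat n) (Q n)) (lift_vec T n) = scalev (of_real (c / real n)) (lift_vec T n)"
    by (simp add: act_alg_scale v(2))
  have "eig n T = of_real (c / real n)"
    unfolding eig_def e using v(1) by (intro the_equality) (simp_all only: fv.scale_cancel_right simp_thms)
  with e show "act_alg (scalev (1 / of_nat n) (Q n)) (lift_vec T n) = scalev (eig n T) (lift_vec T n)"
    "cnj (eig n T) = eig n T"
    by (simp_all only: complex_cnj_complex_of_real)
qed

text \<open>A step of the walk from \<open>\<rho>\<close> multiplies by \<open>\<tau>\<close> on the left.  Averaging \<open>\<langle>\<tau> \<rho> x, v\<^sub>T\<rangle>\<close> over \<open>\<tau>\<close> is pairing
  \<open>Q\<^sub>n \<rho> x / n\<close> with \<open>v\<^sub>T\<close>, and \<open>Q\<^sub>n\<close> is self-adjoint because transpositions are involutions.\<close>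

lemma mcoef_eigenfunction:
  assumes n: "n \<ge> 1" and lam: "lam \<in> partitions_of n" and T: "T \<in> SYT n lam"
    and x: "x \<in> word_module n" and \<rho>: "\<rho> \<in> Sym n"
  shows "(\<Sum>\<sigma>\<in>Sym n. of_real (P n (\<sigma> \<circ> pinv \<rho>)) * ip (act \<sigma> x) (lift_vec T n)) =
    eig n T * ip (act \<rho> x) (lift_vec T n)"
proof -
  let ?v = "lift_vec T n"
  have v: "?v \<in> word_module n"
    using lift_vec_eigenvector[OF n lam T] full_specht_word_module[OF lam] by blast
  have "(\<Sum>\<sigma>\<in>Sym n. of_real (P n (\<sigma> \<circ> pinv \<rho>)) * ip (act \<sigma> x) ?v) =
      (\<Sum>\<sigma>\<in>Sym n. of_real (P n (\<sigma> \<circ> \<rho> \<circ> pinv \<rho>)) * ip (act (\<sigma> \<circ> \<rho>) x) ?v)"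
    by (rule sum_Sym_comp_right[OF \<rho>, symmetric])
  also have "\<dots> = (\<Sum>\<sigma>\<in>Sym n. of_real (P n \<sigma>) * ip (act \<sigma> (act \<rho> x)) ?v)"
    by (intro sum.cong refl) (simp only: comp_assoc Sym_inv_simps(4)[OF \<rho>] comp_id act_act[OF _ \<rho> x])
  also have "\<dots> = ip (act_alg (scalev (1 / of_nat n) (Q n)) (act \<rho> x)) ?v"
    unfolding act_alg_walk ip_sum_left ip_scale_left ..
  also have "\<dots> = ip (act \<rho> x) (act_alg (scalev (1 / of_nat n) (Q n)) ?v)"
    by (rule walk_self_adjoint[OF act_word_module[OF \<rho> x] v])
  also have "\<dots> = eig n T * ip (act \<rho> x) ?v"
    unfolding eig_eigenvalue(1)[OF n lam T] ip_scale_right eig_eigenvalue(2)[OF n lam T] ..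
  finally show ?thesis .
qed

lemma image_mset_mset_set: "finite A \<Longrightarrow> image_mset g (mset_set A) = (\<Sum>a\<in>A. {#g a#})"
  by (induction A rule: finite_induct) simp_all

lemma sum_singleton_const: "finite A \<Longrightarrow> (\<Sum>a\<in>A. {#x#}) = replicate_mset (card A) x"
  by (induction A rule: finite_induct) simp_all

theorem theorem5:
  fixes n :: nat and ps :: "(nat \<Rightarrow> nat) list"
  assumes "n \<ge> 1"
    and "distinct ps" and "set ps = Sym n"
  shows "(\<forall>lam\<in>partitions_of n. \<forall>T\<in>SYT n lam.
            lift_vec T n \<noteq> 0 \<and>
            (\<exists>c. act_alg (scalev (1 / of_nat n) (Q n)) (lift_vec T n) = scalev c (lift_vec T n))) \<and>
         proots (char_poly (transition_matrix n ps)) =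
           (\<Sum>lam\<in>partitions_of n. \<Sum>T\<in>SYT n lam. replicate_mset (card (SYT n lam)) (eig n T))"
proof (intro conjI ballI)
  fix lam T assume "lam \<in> partitions_of n" "T \<in> SYT n lam"
  then show "lift_vec T n \<noteq> 0"
    "\<exists>c. act_alg (scalev (1 / of_nat n) (Q n)) (lift_vec T n) = scalev c (lift_vec T n)"
    using lift_vec_eigenvector[OF assms(1)] eig_eigenvalue(1)[OF assms(1)] by blast+
next
  \<comment> \<open>The eigenfunctions are indexed by the pairs \<open>(T, U)\<close> of standard tableaux of equal shape.  The
    eigenvalue depends on \<open>T\<close> only, which produces the multiplicity \<open>d\<^sub>\<lambda>\<close>.\<close>
  define E where "E = (SIGMA lam:partitions_of n. SYT n lam \<times> SYT n lam)"
  have finS: "finite (SYT n lam)" if "lam \<in> partitions_of n" for lam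
    by (rule finite_SYT[OF that])
  have finE: "finite E"
    unfolding E_def using finite_partitions_of finS by (intro finite_SigmaI) auto
  obtain es where es: "set es = E" "distinct es"
    using finite_distinct_list[OF finE] by blast
  define N where "N = length ps"
  have bij: "bij_betw ((!) ps) {..<N} (Sym n)"
    unfolding N_def using assms(2,3) by (intro bij_betw_nth) auto
  then have N: "N = fact n"
    using bij_betw_same_card[OF bij] by (simp add: card_Sym)
  have "length es = card E"
    using distinct_card[OF es(2)] es(1) by simp
  also have "\<dots> = (\<Sum>lam\<in>partitions_of n. (card (SYT n lam))\<^sup>2)"
    unfolding E_def using finite_partitions_of finS
    by (subst card_SigmaI) (auto simp: card_cartesian_product power2_eq_square)
  also have "\<dots> = N"
    unfolding N by (rule sum_card_SYT_squared)
  finally have len: "length es = N" .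
  define shape where "shape = (\<lambda>j. fst (es ! j))"
  define TT where "TT = (\<lambda>j. fst (snd (es ! j)))"
  define UU where "UU = (\<lambda>j. snd (snd (es ! j)))"
  have es_j: "es ! j = (shape j, TT j, UU j)" for j
    by (simp add: shape_def TT_def UU_def)
  have mem: "shape j \<in> partitions_of n" "TT j \<in> SYT n (shape j)" "UU j \<in> SYT n (shape j)" if "j < N" for j
    using nth_mem[of j es] that len es(1) es_j[of j] by (auto simp: E_def)
  have v: "lift_vec T n \<in> full_specht n lam" "lift_vec T n \<noteq> 0" if "lam \<in> partitions_of n" "T \<in> SYT n lam" for lam T
    using lift_vec_eigenvector[OF assms(1) that] by blast+
  define f where "f = (\<lambda>j k. ip (act (ps ! k) (lift_vec (UU j) n)) (lift_vec (TT j) n))"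
  have gram: "(\<Sum>k<N. f j k * cnj (f i k)) =
      ip (mcoef n (lift_vec (UU j) n) (lift_vec (TT j) n)) (mcoef n (lift_vec (UU i) n) (lift_vec (TT i) n))" for i j
    unfolding f_def ip_mcoef by (rule sum.reindex_bij_betw[OF bij])
  have "proots (char_poly (transition_matrix n ps)) = mset (map (\<lambda>j. eig n (TT j)) [0..<N])"
  proof (rule proots_char_poly_orthogonal_eigenvectors[where f = f])
    show "transition_matrix n ps \<in> carrier_mat N N"
      by (simp add: transition_matrix_def N_def)
  next
    fix k j assume kj: "k < N" "j < N"
    have \<rho>: "ps ! k \<in> Sym n"
      using bij kj(1) by (auto dest: bij_betwE)
    have "(\<Sum>l<N. transition_matrix n ps $$ (k, l) * f j l) =
        (\<Sum>l<N. of_real (P n (ps ! l \<circ> pinv (ps ! k))) * ip (act (ps ! l) (lift_vec (UU j) n)) (lift_vec (TT j) n))"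
      using kj by (intro sum.cong refl) (simp add: transition_matrix_def f_def N_def)
    also have "\<dots> = (\<Sum>\<sigma>\<in>Sym n. of_real (P n (\<sigma> \<circ> pinv (ps ! k))) * ip (act \<sigma> (lift_vec (UU j) n)) (lift_vec (TT j) n))"
      by (rule sum.reindex_bij_betw[OF bij])
    also have "\<dots> = eig n (TT j) * f j k"
      unfolding f_def
      by (rule mcoef_eigenfunction[OF assms(1) mem(1,2)[OF kj(2)]
            full_specht_word_module[OF mem(1)[OF kj(2)] v(1)[OF mem(1,3)[OF kj(2)]]] \<rho>])
    finally show "(\<Sum>l<N. transition_matrix n ps $$ (k, l) * f j l) = eig n (TT j) * f j k" .
  next
    fix i j assume ij: "i < N" "j < N" "i \<noteq> j"
    note mi = mem[OF ij(1)] and mj = mem[OF ij(2)]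
    have ne: "(shape j, TT j, UU j) \<noteq> (shape i, TT i, UU i)"
      using ij nth_eq_iff_index_eq[OF es(2), of j i] len by (simp add: es_j[symmetric])
    show "(\<Sum>k<N. f j k * cnj (f i k)) = 0"
      unfolding gram
    proof (rule mcoef_orthogonal[OF mj(1) mi(1) v(1)[OF mj(1,3)] v(1)[OF mj(1,2)] v(1)[OF mi(1,3)] v(1)[OF mi(1,2)]])
      assume eq: "shape j = shape i"
      then have "UU j \<noteq> UU i \<or> TT j \<noteq> TT i"
        using ne by auto
      then show "ip (lift_vec (UU j) n) (lift_vec (UU i) n) = 0 \<or> ip (lift_vec (TT j) n) (lift_vec (TT i) n) = 0"
        using lift_vec_orthogonal[OF assms(1) mj(1)] mi mj unfolding eq by blast
    qed
  next
    fix i assume i: "i < N"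
    note mi = mem[OF i]
    show "(\<Sum>k<N. f i k * cnj (f i k)) \<noteq> 0"
      unfolding gram ip_self_eq_0_iff by (rule mcoef_nonzero[OF mi(1) v[OF mi(1,3)] v[OF mi(1,2)]])
  qed
  also have "map (\<lambda>j. eig n (TT j)) [0..<N] = map (\<lambda>e. eig n (fst (snd e))) es"
    by (rule nth_equalityI) (simp_all add: len TT_def)
  also have "mset (map (\<lambda>e. eig n (fst (snd e))) es) = (\<Sum>e\<in>E. {#eig n (fst (snd e))#})"
    using image_mset_mset_set[OF finE] mset_set_set[OF es(2)] es(1) by (simp add: mset_map)
  also have "\<dots> = (\<Sum>lam\<in>partitions_of n. \<Sum>p\<in>SYT n lam \<times> SYT n lam. {#eig n (fst p)#})"
    unfolding E_def using finite_partitions_of finS by (subst sum.Sigma) (auto simp: case_prod_unfold)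
  also have "\<dots> = (\<Sum>lam\<in>partitions_of n. \<Sum>T\<in>SYT n lam. \<Sum>U\<in>SYT n lam. {#eig n T#})"
    by (simp add: sum.cartesian_product case_prod_unfold)
  also have "\<dots> = (\<Sum>lam\<in>partitions_of n. \<Sum>T\<in>SYT n lam. replicate_mset (card (SYT n lam)) (eig n T))"
    using finS by (intro sum.cong refl) (simp only: sum_singleton_const)
  finally show "proots (char_poly (transition_matrix n ps)) =
      (\<Sum>lam\<in>partitions_of n. \<Sum>T\<in>SYT n lam. replicate_mset (card (SYT n lam)) (eig n T))" .
qed

end
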